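(* Let $P=[v_1,\dots,v_n]\subset\mathbb{R}^3$ with $n\ge 6$ be a space polygon, let $T^+$ (resp. $T^-$) be its number of pairs of parallel vertices with the same (resp. inverse) orientation, $T=T^++T^-$, and $F$ its number of flattenings. Then $2T+F\ge 6$.
   Context: A space polygon $P=[v_1,\dots,v_n]$ is a closed polygonal line in $\mathbb{R}^3$ (indices mod $n$). Its tangent indicatrix is the spherical polygon $Q=[u_1,\dots,u_n]$ with $u_i=(v_{i+1}-v_i)/|v_{i+1}-v_i|$, whose edges are the minimal great-circle arcs from $u_i$ to $u_{i+1}$; standing assumption: no three of the $u_i$ are coplanar (through the origin). A flattening of $P$ is a triple $\{v_i,v_{i+1},v_{i+2}\}$ such that $v_{i-1}$ and $v_{i+3}$ lie on the same side of the plane through $v_i,v_{i+1},v_{i+2}$. A pair of vertices $v_i,v_j$ is a pair of parallel vertices with the same (resp. inverse) orientation if the spherical edges $u_{i-1}u_i$ and $u_{j-1}u_j$ of $Q$ intersect (resp. the edge $u_{i-1}u_i$ intersects the antipode $-(u_{j-1}u_j)$ of the other edge). *)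

theory Defs
  imports "HOL-Analysis.Analysis"
begin

text \<open>A space polygon with n vertices is given by v :: nat => real^3, whose
  vertices are v 0, ..., v (n-1); indices are read modulo n via pv.\<close>

definition pv :: "nat \<Rightarrow> (nat \<Rightarrow> real^3) \<Rightarrow> int \<Rightarrow> real^3" where
  "pv n v k = v (nat (k mod int n))"

definition tang :: "nat \<Rightarrow> (nat \<Rightarrow> real^3) \<Rightarrow> int \<Rightarrow> real^3" where
  "tang n v k = sgn (pv n v (k + 1) - pv n v k)"

text \<open>Minimal great-circle arc between two (non-antipodal) unit vectors:
  the radial projection of the chord to the sphere.\<close>
definition sarc :: "real^3 \<Rightarrow> real^3 \<Rightarrow> (real^3) set" where
  "sarc a b = sgn ` closed_segment a b"

definition tedge :: "nat \<Rightarrow> (nat \<Rightarrow> real^3) \<Rightarrow> int \<Rightarrow> (real^3) set" where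
  "tedge n v i = sarc (tang n v (i - 1)) (tang n v i)"

definition general_position :: "nat \<Rightarrow> (nat \<Rightarrow> real^3) \<Rightarrow> bool" where
  "general_position n v \<longleftrightarrow>
     (\<forall>i<n. v ((i + 1) mod n) \<noteq> v i) \<and>
     (\<forall>i j k. i < n \<and> j < n \<and> k < n \<and> i \<noteq> j \<and> j \<noteq> k \<and> i \<noteq> k \<longrightarrow>
        \<not> coplanar {0, tang n v (int i), tang n v (int j), tang n v (int k)})"

definition flattening :: "nat \<Rightarrow> (nat \<Rightarrow> real^3) \<Rightarrow> int \<Rightarrow> bool" where
  "flattening n v i \<longleftrightarrow>
     (let N = cross3 (pv n v (i + 1) - pv n v i) (pv n v (i + 2) - pv n v i)
      in (N \<bullet> (pv n v (i - 1) - pv n v i)) * (N \<bullet> (pv n v (i + 3) - pv n v i)) > 0)"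

definition num_flattenings :: "nat \<Rightarrow> (nat \<Rightarrow> real^3) \<Rightarrow> nat" where
  "num_flattenings n v = card {i. i < n \<and> flattening n v (int i)}"

definition nonadj :: "nat \<Rightarrow> nat \<Rightarrow> nat \<Rightarrow> bool" where
  "nonadj n i j \<longleftrightarrow> i \<noteq> j \<and> (i + 1) mod n \<noteq> j \<and> (j + 1) mod n \<noteq> i"

definition parallel_same :: "nat \<Rightarrow> (nat \<Rightarrow> real^3) \<Rightarrow> nat \<Rightarrow> nat \<Rightarrow> bool" where
  "parallel_same n v i j \<longleftrightarrow> tedge n v (int i) \<inter> tedge n v (int j) \<noteq> {}"

definition parallel_inv :: "nat \<Rightarrow> (nat \<Rightarrow> real^3) \<Rightarrow> nat \<Rightarrow> nat \<Rightarrow> bool" where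
  "parallel_inv n v i j \<longleftrightarrow> tedge n v (int i) \<inter> uminus ` tedge n v (int j) \<noteq> {}"

definition Tplus :: "nat \<Rightarrow> (nat \<Rightarrow> real^3) \<Rightarrow> nat" where
  "Tplus n v = card {(i, j). i < j \<and> j < n \<and> nonadj n i j \<and> parallel_same n v i j}"

definition Tminus :: "nat \<Rightarrow> (nat \<Rightarrow> real^3) \<Rightarrow> nat" where
  "Tminus n v = card {(i, j). i < j \<and> j < n \<and> nonadj n i j \<and> parallel_inv n v i j}"

end

theory Submission
  imports Defs
begin

text \<open>
  The edge vectors of the polygon sum to 0, so its tangent indicatrix lies in no open hemisphere.
  Flattenings are the inflections of the indicatrix, i.e. the sign changes of the determinant of
  three consecutive vertices, and pairs of parallel vertices are the crossings of two edges or of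
  an edge and the antipode of another one.

  A polygon that closes up antipodally and has no crossings has at least three inflections
  (Moebius), by induction on the number of vertices: slide a vertex along the edge to its
  neighbour. Either nothing is met and the vertex can be deleted, or the moving edge first meets a
  vertex or the antipode of a vertex, and the polygon splits there into two shorter polygons
  without crossings. The same induction, with a parity argument that keeps one of the two parts
  out of every hemisphere, gives six inflections for a polygon without crossings that lies in no
  hemisphere. In general, use induction on the number of crossings. A crossing of an edge with the
  antipode of another one splits the polygon into two antipodally closing ones. At a crossing of
  two edges, reversing one of the two arcs between them removes a crossing and adds at most two
  inflections.
\<close>

subsection \<open>Crossings of great-circle arcs\<close>

text \<open>The quantity under induction is \<open>num_crossings ps + inflections 1 ps\<close>,
  where crossings are counted as ordered pairs of edges, so that they weigh 2T. With this weight
  reconnecting never increases the sum: at least two ordered pairs go and at most two inflections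
  come. At an antipodal crossing the two loops have together at most two inflections more than the
  polygon, and its own two ordered pairs make up for that.

  General position concerns vertices only. New vertices at crossing points therefore need
  perturbation, and three edges may pass through one point, where an edge could cross both halves of
  a split edge. But three pairwise crossing edges already make six ordered pairs, so this case needs
  no induction.

  A crossing with an antipode counts as a crossing, hence a sliding edge may be stopped by an
  antipode. So closing signs enter even for closed polygons: the loops close with \<kappa> and e *
  \<kappa>. The turn at the obstacle decides how the loops share the inflections; for closed
  polygons it follows from parity arguments.\<close>

definition D :: "real^3 \<Rightarrow> real^3 \<Rightarrow> real^3 \<Rightarrow> real" where
  "D a b c = a \<bullet> cross3 b c"

lemma D_coord: "D a b c = a$1*(b$2*c$3 - b$3*c$2) + a$2*(b$3*c$1 - b$1*c$3) + a$3*(b$1*c$2 - b$2*c$1)"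
  by (simp add: D_def cross3_def inner_vec_def sum_3)

lemma D_lin [simp]:
  "D (x + y) b c = D x b c + D y b c" "D a (x + y) c = D a x c + D a y c" "D a b (x + y) = D a b x + D a b y"
  "D (t *\<^sub>R x) b c = t * D x b c" "D a (t *\<^sub>R x) c = t * D a x c" "D a b (t *\<^sub>R x) = t * D a b x"
  "D (- x) b c = - D x b c" "D a (- x) c = - D a x c" "D a b (- x) = - D a b x"
  "D (x - y) b c = D x b c - D y b c" "D a (x - y) c = D a x c - D a y c" "D a b (x - y) = D a b x - D a b y"
  "D 0 b c = 0" "D a 0 c = 0" "D a b 0 = 0"
  by (simp_all add: D_coord algebra_simps)

lemma D_same [simp]: "D a a c = 0" "D a b a = 0" "D a c c = 0"
  by (simp_all add: D_coord algebra_simps)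

lemma D_cyc: "D b c a = D a b c" "D c a b = D a b c"
  by (simp_all add: D_coord algebra_simps)

lemma D_swap: "D b a c = - D a b c" "D a c b = - D a b c" "D c b a = - D a b c"
  by (simp_all add: D_coord algebra_simps)

text \<open>Four vectors of a 3-space are dependent; Cramer's rule gives the coefficients.\<close>

lemma D_relation: "D b p q *\<^sub>R a - D a p q *\<^sub>R b + D a b q *\<^sub>R p - D a b p *\<^sub>R q = 0"
  by (simp add: vec_eq_iff forall_3 D_coord algebra_simps)

text \<open>Up to the factor \<open>D c a b\<close>, the coordinates of r with respect to c, a, b
  are \<open>D r a b\<close>, \<open>D c r b\<close>, \<open>D c a r\<close>. The right-hand sides
  are the 2x2 minors of the coordinates of r and s, so conditions on the edge rs become inequalities
  between six numbers.\<close>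

lemma D_minor:
  "D c a b * D c r s = D c r b * D c a s - D c a r * D c s b"
  "D c a b * D a r s = D c a r * D s a b - D r a b * D c a s"
  "D c a b * D b r s = D r a b * D c s b - D c r b * D s a b"
  by (simp_all add: D_coord algebra_simps)

text \<open>The open arc from p to q meets the open arc from r to s or the antipode of that arc; below,
  \<open>Y\<close> excludes the antipodal case.\<close>

definition X :: "real^3 \<Rightarrow> real^3 \<Rightarrow> real^3 \<Rightarrow> real^3 \<Rightarrow> bool" where
  "X p q r s \<longleftrightarrow> D p r s * D q r s < 0 \<and> D p q r * D p q s < 0"

lemma X_sym: "X p q r s = X r s p q"
  unfolding X_def using D_cyc D_swap by (smt (verit) mult.commute mult_minus_left mult_minus_right)

lemma X_swap: "X q p r s = X p q r s" "X p q s r = X p q r s"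
  unfolding X_def using D_swap by (smt (verit) mult.commute mult_minus_left mult_minus_right)+

lemma X_neg [simp]: "X (- p) (- q) r s = X p q r s" "X p q (- r) (- s) = X p q r s"
  unfolding X_def by simp_all

lemma X_share [simp]: "\<not> X p q p s" "\<not> X p q r p" "\<not> X p q q s" "\<not> X p q r q"
  "\<not> X p q (- p) s" "\<not> X p q r (- p)" "\<not> X p q (- q) s" "\<not> X p q r (- q)"
  "\<not> X (- p) q p s" "\<not> X (- p) q r p" "\<not> X p (- q) q s" "\<not> X p (- q) r q"
  unfolding X_def by simp_all

text \<open>\<open>D_relation\<close> writes one vector of the line common to the planes pq and rs
  in two ways. The two conditions of \<open>X\<close> say that each pair of coefficients has a
  constant sign; multiplying by these signs makes all four positive and leaves \<kappa>, which tells
  an intersection from an antipodal one.\<close>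

lemma X_combo:
  assumes "X p q r s"
  obtains \<alpha> \<beta> \<gamma> \<delta> \<kappa> where "\<alpha> > 0" "\<beta> > 0" "\<gamma> > 0" "\<delta> > 0" "\<kappa> = 1 \<or> \<kappa> = (-1::real)"
    "\<alpha> *\<^sub>R p + \<beta> *\<^sub>R q = \<kappa> *\<^sub>R (\<gamma> *\<^sub>R r + \<delta> *\<^sub>R s)"
proof -
  have rel: "D q r s *\<^sub>R p - D p r s *\<^sub>R q = D p q r *\<^sub>R s - D p q s *\<^sub>R r"
    using D_relation[of q r s p] by (simp add: algebra_simps)
  define A where "A = D q r s" define B where "B = - D p r s"
  define C where "C = - D p q s" define E where "E = D p q r"
  have rel': "A *\<^sub>R p + B *\<^sub>R q = C *\<^sub>R r + E *\<^sub>R s"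
    using rel by (simp add: A_def B_def C_def E_def algebra_simps)
  have AB: "A * B > 0" "C * E > 0"
    using assms by (auto simp: X_def A_def B_def C_def E_def mult.commute)
  define u where "u = sgn A" define v where "v = sgn C"
  have u: "u * u = 1" "u * A > 0" "u * B > 0" "u = 1 \<or> u = -1" and v: "v * v = 1" "v * C > 0" "v * E > 0" "v = 1 \<or> v = -1"
    using AB by (auto simp: u_def v_def sgn_if zero_less_mult_iff split: if_splits)
  have "(u * A) *\<^sub>R p + (u * B) *\<^sub>R q = (u * v) *\<^sub>R ((v * C) *\<^sub>R r + (v * E) *\<^sub>R s)"
  proof -
    have "(u * A) *\<^sub>R p + (u * B) *\<^sub>R q = u *\<^sub>R (A *\<^sub>R p + B *\<^sub>R q)" by (simp add: algebra_simps)
    also have "\<dots> = u *\<^sub>R (C *\<^sub>R r + E *\<^sub>R s)" by (simp add: rel')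
    also have "\<dots> = (u * v) *\<^sub>R ((v * C) *\<^sub>R r + (v * E) *\<^sub>R s)"
      using v(1) by (simp add: algebra_simps flip: mult.assoc)
    finally show ?thesis .
  qed
  then show ?thesis using u v that[of "u * A" "u * B" "v * C" "v * E" "u * v"] by auto
qed

definition Y :: "real^3 \<Rightarrow> real^3 \<Rightarrow> real^3 \<Rightarrow> real^3 \<Rightarrow> bool" where
  "Y a b p q \<longleftrightarrow> (D b p q > 0 \<and> D a p q < 0 \<and> D a b q < 0 \<and> D a b p > 0) \<or>
                 (D b p q < 0 \<and> D a p q > 0 \<and> D a b q > 0 \<and> D a b p < 0)"

lemma Y_imp_X: "Y a b p q \<Longrightarrow> X a b p q"
  unfolding X_def Y_def by (auto simp: mult_less_0_iff)

text \<open>The two sign patterns of \<open>Y\<close> are those for which both sides of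
  \<open>D_relation\<close> become positive combinations at once.\<close>

lemma Y_combo:
  assumes "Y p q r s"
  obtains \<alpha> \<beta> \<gamma> \<delta> where "\<alpha> > 0" "\<beta> > 0" "\<gamma> > 0" "\<delta> > 0"
    "\<alpha> *\<^sub>R p + \<beta> *\<^sub>R q = (\<gamma> *\<^sub>R r + \<delta> *\<^sub>R s)"
proof -
  have rel: "D q r s *\<^sub>R p + (- D p r s) *\<^sub>R q = (- D p q s) *\<^sub>R r + D p q r *\<^sub>R s"
       and rel2: "(- D q r s) *\<^sub>R p + D p r s *\<^sub>R q = D p q s *\<^sub>R r + (-D p q r) *\<^sub>R s"
    using D_relation[of q r s p] by (simp_all add: algebra_simps)
  show ?thesis
    using assms that[OF _ _ _ _ rel] that[OF _ _ _ _ rel2] unfolding Y_def by auto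
qed

lemma Y_sym: "Y a b p q = Y b a p q" "Y a b p q = Y a b q p"
  unfolding Y_def by (auto simp: D_swap[of b a] D_swap(2)[of _ q p])

lemma Y_share [simp]: "\<not> Y p q p s" "\<not> Y p q r p" "\<not> Y p q q s" "\<not> Y p q r q"
  "\<not> Y p q (- p) s" "\<not> Y p q r (- p)" "\<not> Y p q (- q) s" "\<not> Y p q r (- q)"
  "\<not> Y (- p) q p s" "\<not> Y (- p) q r p" "\<not> Y p (- q) q s" "\<not> Y p (- q) r q"
  unfolding Y_def by simp_all

text \<open>In coordinates with respect to c, a, b, where z has second and third coordinates y and w: between
  P and s the arc leaves the cone over c, a, b, and both points lie on the side of a of the plane
  through c and z, so it crosses the wall ca or the wall ab.\<close>

lemma cone_exit:
  fixes y w p q r1 r2 r3 s1 s2 s3 :: real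
  assumes "y \<ge> 0" "w > 0" "p > 0" "q > 0"
    and P: "P1 = p*r1 + q * s1" "P2 = p*r2 + q * s2" "P3 = p*r3 + q * s3"
    and pos: "P1 > 0" "P2 \<ge> 0" "P3 > 0" and gP: "y * P3 \<le> w * P2"
    and gs: "y * s3 < w * s2" and nobs: "\<not> (s1 > 0 \<and> s2 > 0 \<and> s3 > 0)"
    and nz: "s1 \<noteq> 0" "s3 \<noteq> 0" "r1 * s3 - r3 * s1 \<noteq> 0"
  shows "((r2 * s3 - r3 * s2) * (r3 * s1 - r1 * s3) < 0 \<and> r3 * s3 < 0) \<or>
         ((r3 * s1 - r1 * s3) * (r1 * s2 - r2 * s1) < 0 \<and> r1 * s1 < 0)"
proof -
  \<comment> \<open>Minors of P and s replace those of r and s: they agree up to sign and the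
    positive factor p, and P is known to lie in the cone.\<close>
  define m23 where "m23 = P2 * s3 - P3 * s2"
  define m13 where "m13 = P1 * s3 - P3 * s1"
  define m12 where "m12 = P1 * s2 - P2 * s1"
  have m: "m23 = p * (r2 * s3 - r3 * s2)" "m13 = - (p * (r3 * s1 - r1 * s3))" "m12 = p * (r1 * s2 - r2 * s1)"
    by (simp_all add: m23_def m13_def m12_def P algebra_simps)
  have m13nz: "m13 \<noteq> 0" using nz(3) \<open>p > 0\<close> by (auto simp: m algebra_simps)
  have s2: "s2 > 0" if "s3 > 0"
    using that gs assms(1,2) by (smt (verit) mult_nonneg_nonneg zero_less_mult_pos)
  have some: "s1 < 0 \<or> s3 < 0" using nobs s2 nz by linarith
  have "(m23 * m13 > 0 \<and> s3 < 0) \<or> (m13 * m12 > 0 \<and> s1 < 0)"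
  \<comment> \<open>In this case the wall ca is reached first. Otherwise s1 < 0 and m13 > 0, and the
    wall ab is reached.\<close>
  proof (cases "s3 < 0 \<and> m13 < 0")
    case True
    have "w * m23 < 0"
    proof -
      have "w * m23 = (w*P2) * s3 - P3 * (w * s2)" by (simp add: m23_def algebra_simps)
      moreover have "(w*P2) * s3 \<le> (y*P3) * s3" using True gP by (intro mult_right_mono_neg) auto
      moreover have "P3 * (w * s2) > P3 * (y * s3)" using gs pos by simp
      ultimately show ?thesis by (simp add: algebra_simps)
    qed
    then have "m23 < 0" using \<open>w > 0\<close> by (simp add: mult_less_0_iff)
    then show ?thesis using True by (simp add: mult_neg_neg)
  next
    case False
    have s1: "s1 < 0"
    proof (rule ccontr)
      assume "\<not> s1 < 0"
      then have "s1 > 0" "s3 < 0" using some nz by auto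
      then have "P1 * s3 < 0" "P3 * s1 > 0" using pos by (simp_all add: mult_pos_neg)
      then show False using False \<open>s3 < 0\<close> unfolding m13_def by linarith
    qed
    have m13: "m13 > 0"
    proof (cases "s3 < 0")
      case True then show ?thesis using False m13nz by linarith
    next
      case False2: False
      then have "P1 * s3 > 0" "P3 * s1 < 0" using pos nz s1 by (simp_all add: mult_pos_neg)
      then show ?thesis by (simp add: m13_def)
    qed
    have "w * m12 > 0"
    proof -
      have "P1 * (w * s2) > P1 * (y * s3)" using gs pos by simp
      moreover have "(w*P2) * s1 \<le> (y*P3) * s1" using s1 gP by (intro mult_right_mono_neg) auto
      moreover have "w * m12 = P1 * (w * s2) - (w*P2) * s1" by (simp add: m12_def algebra_simps)
      moreover have "P1 * (y * s3) - (y*P3) * s1 = y * m13" by (simp add: m13_def algebra_simps)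
      moreover have "y * m13 \<ge> 0" using m13 assms(1) by simp
      ultimately show ?thesis by linarith
    qed
    then have "m12 > 0" using \<open>w > 0\<close> by (simp add: zero_less_mult_iff)
    then show ?thesis using m13 s1 by simp
  qed
  then show ?thesis
  proof
    assume h: "m23 * m13 > 0 \<and> s3 < 0"
    have "p * r3 = P3 - q * s3" using P by simp
    then have "p * r3 > 0" using h pos assms by (smt (verit) mult_pos_neg)
    then have "r3 > 0" using \<open>p > 0\<close> by (simp add: zero_less_mult_iff)
    then have "r3 * s3 < 0" using h by (simp add: mult_pos_neg)
    moreover have "m23 * m13 = - (p * p * ((r2 * s3 - r3 * s2) * (r3 * s1 - r1 * s3)))" by (simp add: m)
    then have "p * p * ((r2 * s3 - r3 * s2) * (r3 * s1 - r1 * s3)) < 0" using h by linarith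
    then have "((r2 * s3 - r3 * s2) * (r3 * s1 - r1 * s3)) < 0" using \<open>p > 0\<close>
      by (meson mult_nonneg_nonneg less_imp_le not_less)
    ultimately show ?thesis by blast
  next
    assume h: "m13 * m12 > 0 \<and> s1 < 0"
    have "p * r1 = P1 - q * s1" using P by simp
    then have "p * r1 > 0" using h pos assms by (smt (verit) mult_pos_neg)
    then have "r1 > 0" using \<open>p > 0\<close> by (simp add: zero_less_mult_iff)
    then have "r1 * s1 < 0" using h by (simp add: mult_pos_neg)
    moreover have "m13 * m12 = - (p * p * ((r3 * s1 - r1 * s3) * (r1 * s2 - r2 * s1)))" by (simp add: m)
    then have "p * p * ((r3 * s1 - r1 * s3) * (r1 * s2 - r2 * s1)) < 0" using h by linarith
    then have "((r3 * s1 - r1 * s3) * (r1 * s2 - r2 * s1)) < 0" using \<open>p > 0\<close>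
      by (meson mult_nonneg_nonneg less_imp_le not_less)
    ultimately show ?thesis by blast
  qed
qed

subsection \<open>Closed spherical polygons\<close>

fun steps :: "'a list \<Rightarrow> ('a \<times> 'a) set" where
  "steps (x # y # zs) = insert (x, y) (steps (y # zs))"
| "steps _ = {}"

fun tri :: "(real^3) list \<Rightarrow> bool list" where
  "tri (x # y # z # r) = (D x y z > 0) # tri (y # z # r)"
| "tri _ = []"

fun nzt :: "(real^3) list \<Rightarrow> bool" where
  "nzt (x # y # z # r) \<longleftrightarrow> D x y z \<noteq> 0 \<and> nzt (y # z # r)"
| "nzt _ \<longleftrightarrow> True"

fun changes :: "bool list \<Rightarrow> nat" where
  "changes (x # y # r) = (if x = y then 0 else 1) + changes (y # r)"
| "changes _ = 0"

definition flip_sign :: "real \<Rightarrow> bool \<Rightarrow> bool" where "flip_sign e s = (if e > 0 then s else \<not> s)"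

text \<open>A list with closing sign e stands for the polygon that runs through the list and then to e times
  its head. For e = -1 this is one half of a centrally symmetric polygon, and \<open>flip_sign\<close> transports a
  turning direction through the closing.\<close>

definition edges :: "real \<Rightarrow> (real^3) list \<Rightarrow> ((real^3) \<times> (real^3)) set" where
  "edges e ps = steps (ps @ [e *\<^sub>R hd ps])"

definition noX :: "((real^3) \<times> (real^3)) set \<Rightarrow> ((real^3) \<times> (real^3)) set \<Rightarrow> bool" where
  "noX E G \<longleftrightarrow> (\<forall>p q r s. (p,q) \<in> E \<longrightarrow> (r,s) \<in> G \<longrightarrow> \<not> X p q r s)"

definition simple :: "real \<Rightarrow> (real^3) list \<Rightarrow> bool" where
  "simple e ps \<longleftrightarrow> noX (edges e ps) (edges e ps)"

text \<open>The entry at index i is the turn at vertex i: for e = 1 or e = -1 the point before the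
  head is e times the last one.\<close>

definition turn_signs :: "real \<Rightarrow> (real^3) list \<Rightarrow> bool list" where
  "turn_signs e ps = tri ((e *\<^sub>R last ps) # ps @ [e *\<^sub>R hd ps])"

definition inflections :: "real \<Rightarrow> (real^3) list \<Rightarrow> nat" where
  "inflections e ps = changes (turn_signs e ps @ [flip_sign e (hd (turn_signs e ps))])"

text \<open>Distinctness in the projective plane. Genericity is only required up to sign, because
  antipodes of vertices act as obstacles too.\<close>

definition ne2 :: "real^3 \<Rightarrow> real^3 \<Rightarrow> bool" where "ne2 x y \<longleftrightarrow> x \<noteq> y \<and> x \<noteq> - y"

lemma ne2_sym: "ne2 x y = ne2 y x" by (auto simp: ne2_def)
lemma ne2_neg [simp]: "ne2 (- x) y = ne2 x y" "ne2 x (- y) = ne2 x y" by (auto simp: ne2_def minus_equation_iff)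
lemma ne2_irrefl [simp]: "\<not> ne2 x x" by (simp add: ne2_def)

definition generic :: "(real^3) set \<Rightarrow> bool" where
  "generic S \<longleftrightarrow> (\<forall>x\<in>S. \<forall>y\<in>S. \<forall>z\<in>S. ne2 x y \<and> ne2 y z \<and> ne2 x z \<longrightarrow> D x y z \<noteq> 0)"

fun pairwise_ne2 :: "(real^3) list \<Rightarrow> bool" where
  "pairwise_ne2 (x # xs) \<longleftrightarrow> (\<forall>y\<in>set xs. ne2 x y) \<and> pairwise_ne2 xs"
| "pairwise_ne2 [] \<longleftrightarrow> True"

definition gen_pos :: "(real^3) list \<Rightarrow> bool" where
  "gen_pos ps \<longleftrightarrow> 3 \<le> length ps \<and> pairwise_ne2 ps \<and> generic (set ps)"

lemma noX_Un [simp]: "noX (A \<union> B) G \<longleftrightarrow> noX A G \<and> noX B G" "noX G (A \<union> B) \<longleftrightarrow> noX G A \<and> noX G B"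
  by (auto simp: noX_def)
lemma noX_mono: "noX A G \<Longrightarrow> B \<subseteq> A \<Longrightarrow> H \<subseteq> G \<Longrightarrow> noX B H"
  unfolding noX_def by blast
lemma noX_sym: "noX A B = noX B A"
  unfolding noX_def using X_sym by blast
lemma noXD: "noX A B \<Longrightarrow> (p,q) \<in> A \<Longrightarrow> (r,s) \<in> B \<Longrightarrow> \<not> X p q r s"
  by (auto simp: noX_def)
lemma noX_neg: "noX (insert (-p,-q) A) B = noX (insert (p,q) A) B" "noX B (insert (-p,-q) A) = noX B (insert (p,q) A)"
  by (auto simp: noX_def)

section \<open>Combinatorics of steps, turning signs and sign changes\<close>

lemma pe_append: "steps (xs @ u # ys) = steps (xs @ [u]) \<union> steps (u # ys)"
proof (induction xs rule: steps.induct)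
  case (1 x y zs) then show ?case by simp
next
  case "2_1" then show ?case by simp
next
  case ("2_2" v) then show ?case by (cases ys) auto
qed

lemma pe_set: "(p,q) \<in> steps xs \<Longrightarrow> p \<in> set xs \<and> q \<in> set xs"
  by (induction xs rule: steps.induct) auto

lemma pe_map: "steps (map f xs) = (\<lambda>(p,q). (f p, f q)) ` steps xs"
  by (induction xs rule: steps.induct) auto

lemma tri_append: "tri (xs @ u # v # ys) = tri (xs @ [u, v]) @ tri (u # v # ys)"
proof (induction xs rule: tri.induct)
  case (1 x y z r) then show ?case by simp
next
  case ("2_3" v va)
  then show ?case by (cases ys) auto
next
  case ("2_2" v)
  then show ?case by (cases ys) auto
qed auto

lemma length_tri: "length (tri xs) = length xs - 2"
  by (induction xs rule: tri.induct) auto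

lemma nzt_append: "nzt (xs @ u # v # ys) \<longleftrightarrow> nzt (xs @ [u, v]) \<and> nzt (u # v # ys)"
proof (induction xs rule: tri.induct)
  case (1 x y z r) then show ?case by simp
next
  case ("2_3" v va)
  then show ?case by (cases ys) auto
next
  case ("2_2" v)
  then show ?case by (cases ys) auto
qed auto

lemma ch_append: "changes (xs @ y # ys) = changes (xs @ [y]) + changes (y # ys)"
proof (induction xs rule: changes.induct)
  case (1 x y r) then show ?case by simp
next
  case ("2_2" v) then show ?case by (cases ys) auto
qed auto

lemma ch_Not [simp]: "changes (map Not xs) = changes xs"
  by (induction xs rule: changes.induct) auto

lemma ch_rev [simp]: "changes (rev xs) = changes xs"
proof (induction xs rule: changes.induct)
  case (1 x y r)
  then show ?case using ch_append[of "rev r" y "[x]"] by auto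
qed auto

lemma ch_parity: "xs \<noteq> [] \<Longrightarrow> even (changes xs) \<longleftrightarrow> hd xs = last xs"
  by (induction xs rule: changes.induct) auto

lemma fl_simps [simp]: "flip_sign 1 s = s" "flip_sign (-1) s = (\<not> s)"
  by (auto simp: flip_sign_def)

lemma tri_uminus: "nzt xs \<Longrightarrow> tri (map uminus xs) = map Not (tri xs)"
  by (induction xs rule: tri.induct) auto

lemma gset_mono: "generic S \<Longrightarrow> T \<subseteq> S \<Longrightarrow> generic T"
  unfolding generic_def by blast

lemma gset_neg: assumes "generic S" shows "generic (S \<union> uminus ` S)"
  using assms unfolding generic_def by auto

lemma gsetD: "generic S \<Longrightarrow> x \<in> S \<Longrightarrow> y \<in> S \<Longrightarrow> z \<in> S \<Longrightarrow> ne2 x y \<Longrightarrow> ne2 y z \<Longrightarrow> ne2 x z \<Longrightarrow> D x y z \<noteq> 0"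
  unfolding generic_def by blast

lemma sdist_append: "pairwise_ne2 (xs @ ys) \<longleftrightarrow> pairwise_ne2 xs \<and> pairwise_ne2 ys \<and> (\<forall>x\<in>set xs. \<forall>y\<in>set ys. ne2 x y)"
  by (induction xs) auto

lemma sdist_neg: "pairwise_ne2 (map uminus xs) = pairwise_ne2 xs"
  by (induction xs) auto

lemma nzt_gp: "pairwise_ne2 xs \<Longrightarrow> generic (set xs) \<Longrightarrow> nzt xs"
proof (induction xs rule: nzt.induct)
  case (1 x y z r)
  have "D x y z \<noteq> 0" using 1 by (intro gsetD[OF 1(3)]) auto
  moreover have "generic (set (y # z # r))" using 1(3) by (rule gset_mono) auto
  ultimately show ?case using 1 by simp
qed auto

abbreviation unit_sign :: "real \<Rightarrow> bool" where "unit_sign e \<equiv> e = 1 \<or> e = -1"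

lemma gp_list:
  assumes "gen_pos ps" obtains a b M l where "ps = a # b # M @ [l]"
  using assms unfolding gen_pos_def
  by (metis One_nat_def Suc_le_length_iff append_butlast_last_id list.distinct(1) numeral_3_eq_3)

lemma nzt_cyc:
  assumes "gen_pos ps" "unit_sign e"
  shows "nzt ((e *\<^sub>R last ps) # ps @ [e *\<^sub>R hd ps])"
proof -
  obtain x y M l where ps: "ps = x # y # M @ [l]"
    using assms unfolding gen_pos_def
    by (metis One_nat_def Suc_le_length_iff append_butlast_last_id list.distinct(1) numeral_3_eq_3)
  have "nzt ps" using assms nzt_gp by (auto simp: gen_pos_def)
  have "D l x y \<noteq> 0" using assms(1) unfolding gen_pos_def ps
    by (intro gsetD[of "set ps"]) (auto simp: sdist_append ps ne2_sym)
  obtain m M' where M: "y # M = M' @ [m]" by (metis append_butlast_last_id list.distinct(1))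
  have ps': "ps = x # M' @ [m, l]" using M ps by simp
  have "D m l x \<noteq> 0" using assms(1) unfolding gen_pos_def ps'
    by (intro gsetD[of "set ps"]) (auto simp: sdist_append ps' ne2_sym)
  have "nzt (ps @ [e *\<^sub>R x])" using nzt_append[of "x # M'" m l "[e *\<^sub>R x]"] \<open>nzt ps\<close> \<open>D m l x \<noteq> 0\<close> assms(2)
    by (auto simp: ps')
  then show ?thesis using \<open>D l x y \<noteq> 0\<close> assms(2) by (auto simp: ps)
qed

text \<open>The same polygon read from its second vertex; the head reappears behind the closing,
  multiplied by e.\<close>

definition rot1 :: "real \<Rightarrow> (real^3) list \<Rightarrow> (real^3) list" where
  "rot1 e ps = tl ps @ [e *\<^sub>R hd ps]"

lemma rot1_gp: assumes "gen_pos ps" "unit_sign e" shows "gen_pos (rot1 e ps)"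
proof -
  obtain x xs where ps: "ps = x # xs" using assms by (cases ps) (auto simp: gen_pos_def)
  have "generic (set ps \<union> uminus ` set ps)" using assms gset_neg by (auto simp: gen_pos_def)
  then have "generic (set (rot1 e ps))" by (rule gset_mono) (use assms ps in \<open>auto simp: rot1_def\<close>)
  moreover have "ne2 y (e *\<^sub>R x)" if "y \<in> set xs" for y using that assms ne2_sym[of x y] by (auto simp: gen_pos_def ps)
  ultimately show ?thesis using assms by (auto simp: gen_pos_def rot1_def ps sdist_append)
qed

lemma rot1_simple: assumes "unit_sign e" "2 \<le> length ps" shows "simple e (rot1 e ps) = simple e ps"
proof -
  obtain x y M where ps: "ps = x # y # M" using assms(2) by (metis One_nat_def Suc_1 Suc_le_length_iff)
  define R where "R = steps (y # M @ [e *\<^sub>R x])"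
  have 1: "edges e ps = insert (x,y) R" by (simp add: ps edges_def R_def)
  have 2: "edges e (rot1 e ps) = insert (e *\<^sub>R x, e *\<^sub>R y) R"
    using pe_append[of "y # M" "e *\<^sub>R x" "[e *\<^sub>R y]"] by (simp add: ps edges_def R_def rot1_def)
  show ?thesis using assms(1) unfolding simple_def 1 2 by (auto simp: noX_neg)
qed

lemma length_sgl: "length (turn_signs e ps) = length ps"
  by (simp add: turn_signs_def length_tri)

lemma rot1_sgl: assumes "gen_pos ps" "unit_sign e"
  shows "turn_signs e (rot1 e ps) = tl (turn_signs e ps) @ [flip_sign e (hd (turn_signs e ps))]"
proof -
  obtain x y M l where ps: "ps = x # y # M @ [l]" using gp_list[OF assms(1)] .
  have "D l x y \<noteq> 0" using nzt_cyc[OF assms] assms(2) by (auto simp: ps)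
  define T where "T = tri (x # y # M @ [l, e *\<^sub>R x])"
  define d where "d \<longleftrightarrow> D (e *\<^sub>R l) x y > 0"
  have 1: "turn_signs e ps = d # T" by (simp add: turn_signs_def ps T_def d_def)
  have ee: "e * e = 1" using assms(2) by auto
  have ee': "e * (e * t) = t" for t using ee by (metis mult.assoc mult_1)
  have "(D l (e *\<^sub>R x) (e *\<^sub>R y) > 0) = flip_sign e d" using \<open>D l x y \<noteq> 0\<close> assms(2) by (auto simp: d_def flip_sign_def)
  then have 2: "turn_signs e (rot1 e ps) = T @ [flip_sign e d]"
    using tri_append[of "x # y # M" l "e *\<^sub>R x" "[e *\<^sub>R y]"] ee ee'
    by (simp add: turn_signs_def ps T_def rot1_def)
  show ?thesis by (simp add: 1 2)
qed

lemma rot1_infl: assumes "gen_pos ps" "unit_sign e" shows "inflections e (rot1 e ps) = inflections e ps"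
proof -
  have "2 \<le> length (turn_signs e ps)" using length_sgl[of e ps] assms(1) by (simp add: gen_pos_def)
  then obtain d t T where S: "turn_signs e ps = d # t # T" by (metis One_nat_def Suc_1 Suc_le_length_iff)
  have "changes ((t # T) @ [flip_sign e d, flip_sign e t]) = changes (t # T @ [flip_sign e d]) + changes [flip_sign e d, flip_sign e t]"
    using ch_append[of "t # T" "flip_sign e d" "[flip_sign e t]"] by simp
  moreover have "changes [flip_sign e d, flip_sign e t] = changes [d, t]" by (auto simp: flip_sign_def)
  ultimately show ?thesis unfolding inflections_def rot1_sgl[OF assms] S by simp
qed

lemma length_rot1: "ps \<noteq> [] \<Longrightarrow> length (rot1 e ps) = length ps"
  by (cases ps) (auto simp: rot1_def)

lemma rot1_pow:
  assumes "gen_pos ps" "unit_sign e"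
  shows "gen_pos ((rot1 e ^^ k) ps) \<and> simple e ((rot1 e ^^ k) ps) = simple e ps \<and>
         inflections e ((rot1 e ^^ k) ps) = inflections e ps \<and> length ((rot1 e ^^ k) ps) = length ps"
proof (induction k)
  case (Suc k)
  have "2 \<le> length ((rot1 e ^^ k) ps)" "(rot1 e ^^ k) ps \<noteq> []" using Suc assms by (auto simp: gen_pos_def)
  then show ?case using Suc rot1_gp rot1_simple rot1_infl length_rot1 assms by simp
qed (use assms in auto)

lemma rot1_pow_append: "(rot1 e ^^ length us) (us @ vs) = vs @ map (\<lambda>x. e *\<^sub>R x) us"
proof (induction us arbitrary: vs)
  case (Cons u us)
  have "(rot1 e ^^ length (u # us)) ((u # us) @ vs) = (rot1 e ^^ length us) (rot1 e (u # us @ vs))"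
    by (simp add: funpow_swap1)
  also have "\<dots> = (rot1 e ^^ length us) (us @ (vs @ [e *\<^sub>R u]))" by (simp add: rot1_def)
  finally show ?case using Cons by simp
qed simp

lemma pe_distinct: "pairwise_ne2 xs \<Longrightarrow> (p,q) \<in> steps xs \<Longrightarrow> ne2 p q"
  by (induction xs rule: steps.induct) auto

lemma gp_D:
  "gen_pos ps \<Longrightarrow> x \<in> set ps \<Longrightarrow> y \<in> set ps \<Longrightarrow> z \<in> set ps \<Longrightarrow> ne2 x y \<Longrightarrow> ne2 y z \<Longrightarrow> ne2 x z \<Longrightarrow> D x y z \<noteq> 0"
  using gsetD unfolding gen_pos_def by blast

lemma gp_uminus: "gen_pos ps \<Longrightarrow> gen_pos (map uminus ps)"
  unfolding gen_pos_def using gset_mono[OF gset_neg] by (fastforce simp: sdist_neg)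

lemma edg_uminus: "ps \<noteq> [] \<Longrightarrow> edges e (map uminus ps) = (\<lambda>(p,q). (- p, - q)) ` edges e ps"
  unfolding edges_def by (cases ps) (auto simp flip: pe_map)

lemma simple_uminus: "ps \<noteq> [] \<Longrightarrow> simple e (map uminus ps) = simple e ps"
  unfolding simple_def by (force simp: edg_uminus noX_def)

lemma sgl_uminus: "gen_pos ps \<Longrightarrow> unit_sign e \<Longrightarrow> turn_signs e (map uminus ps) = map Not (turn_signs e ps)"
proof -
  assume a: "gen_pos ps" "unit_sign e"
  then have "ps \<noteq> []" by (auto simp: gen_pos_def)
  then have "(e *\<^sub>R last (map uminus ps)) # map uminus ps @ [e *\<^sub>R hd (map uminus ps)] =
     map uminus ((e *\<^sub>R last ps) # ps @ [e *\<^sub>R hd ps])" by (simp add: last_map hd_map)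
  then show ?thesis using tri_uminus[OF nzt_cyc[OF a]] by (simp add: turn_signs_def)
qed

lemma infl_uminus: assumes "gen_pos ps" "unit_sign e" shows "inflections e (map uminus ps) = inflections e ps"
proof -
  have "turn_signs e ps \<noteq> []" using length_sgl[of e ps] assms by (auto simp: gen_pos_def)
  then have "turn_signs e (map uminus ps) @ [flip_sign e (hd (turn_signs e (map uminus ps)))] = map Not (turn_signs e ps @ [flip_sign e (hd (turn_signs e ps))])"
    by (simp add: sgl_uminus assms hd_map flip_sign_def)
  then show ?thesis unfolding inflections_def by (metis ch_Not)
qed

lemma even_infl: assumes "gen_pos ps" "unit_sign e" shows "even (inflections e ps) \<longleftrightarrow> e = 1"
proof -
  have "turn_signs e ps \<noteq> []" using length_sgl[of e ps] assms by (auto simp: gen_pos_def)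
  then show ?thesis using assms(2) unfolding inflections_def by (subst ch_parity) auto
qed

subsection \<open>Deleting a vertex\<close>

text \<open>The points v of the open cone over c, a, b that the edge from c sweeps over while its other end
  slides from a until it points at z.\<close>

definition in_swept :: "real^3 \<Rightarrow> real^3 \<Rightarrow> real^3 \<Rightarrow> real^3 \<Rightarrow> real^3 \<Rightarrow> bool" where
  "in_swept c a b z v \<longleftrightarrow> D v a b > 0 \<and> D c v b > 0 \<and> D c a v > 0 \<and> D c z v < 0"

text \<open>Multiplying by \<open>D c a b\<close> turns crossings with the walls ca and ab into the
  sign conditions that \<open>cone_exit\<close> delivers.\<close>

lemma X_from_minors:
  assumes "D c a b > 0"
  shows "X c a r s \<longleftrightarrow> (D c r b * D c a s - D c a r * D c s b) * (D c a r * D s a b - D r a b * D c a s) < 0 \<and> D c a r * D c a s < 0"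
    and "X a b r s \<longleftrightarrow> (D c a r * D s a b - D r a b * D c a s) * (D r a b * D c s b - D c r b * D s a b) < 0 \<and> D r a b * D s a b < 0"
proof -
  have *: "(D c a b * x) * (D c a b * y) < 0 \<longleftrightarrow> x * y < 0" for x y
  proof -
    have "(D c a b * x) * (D c a b * y) = (D c a b * D c a b) * (x * y)" by simp
    then show ?thesis using assms by (simp add: mult_less_0_iff zero_less_mult_iff)
  qed
  show "X c a r s \<longleftrightarrow> (D c r b * D c a s - D c a r * D c s b) * (D c a r * D s a b - D r a b * D c a s) < 0 \<and> D c a r * D c a s < 0"
    unfolding X_def D_minor[symmetric] * by simp
  show "X a b r s \<longleftrightarrow> (D c a r * D s a b - D r a b * D c a s) * (D r a b * D c s b - D c r b * D s a b) < 0 \<and> D r a b * D s a b < 0"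
    unfolding X_def D_minor[symmetric] * using D_cyc(1)[where a=r and b=a and c=b] D_cyc(1)[where a=s and b=a and c=b] by simp
qed

lemma comb_pos:
  assumes "\<alpha> > 0" "\<beta> > (0::real)"
  shows "x \<ge> 0 \<Longrightarrow> y \<ge> 0 \<Longrightarrow> x > 0 \<or> y > 0 \<Longrightarrow> \<alpha> * x + \<beta> * y > 0"
    and "x \<ge> 0 \<Longrightarrow> y \<ge> 0 \<Longrightarrow> \<alpha> * x + \<beta> * y \<ge> 0"
    and "x \<le> 0 \<Longrightarrow> y \<le> 0 \<Longrightarrow> \<alpha> * x + \<beta> * y \<le> 0"
proof -
  show "x \<ge> 0 \<Longrightarrow> y \<ge> 0 \<Longrightarrow> x > 0 \<or> y > 0 \<Longrightarrow> \<alpha> * x + \<beta> * y > 0"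
    using assms by (elim disjE) (simp_all add: add_pos_nonneg add_nonneg_pos)
  show "x \<ge> 0 \<Longrightarrow> y \<ge> 0 \<Longrightarrow> \<alpha> * x + \<beta> * y \<ge> 0" using assms by simp
  show "x \<le> 0 \<Longrightarrow> y \<le> 0 \<Longrightarrow> \<alpha> * x + \<beta> * y \<le> 0" using assms by (simp add: add_nonpos_nonpos mult_nonneg_nonpos)
qed

text \<open>The point p r + q s lies in the swept region, whereas s is outside the cone although
  still on the a side of the plane cz. So the edge leaves the region through ca or ab.\<close>

lemma slide_exit1:
  assumes D: "D c a b > 0" and z: "D c z b \<ge> 0" "D c a z > 0" and pq: "p > 0" "q > 0"
    and P: "D (p *\<^sub>R r + q *\<^sub>R s) a b > 0" "D c (p *\<^sub>R r + q *\<^sub>R s) b \<ge> 0" "D c a (p *\<^sub>R r + q *\<^sub>R s) > 0"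
      "D c z (p *\<^sub>R r + q *\<^sub>R s) \<le> 0"
    and s: "D c z s < 0" "\<not> (D s a b > 0 \<and> D c s b > 0 \<and> D c a s > 0)"
    and nz: "D s a b \<noteq> 0" "D c a s \<noteq> 0" "D a r s \<noteq> 0"
  shows "X c a r s \<or> X a b r s"
proof -
  have g: "D c a b * D c z v = D c z b * D c a v - D c a z * D c v b" for v by (rule D_minor)
  have g1: "D c z b * D c a (p *\<^sub>R r + q *\<^sub>R s) \<le> D c a z * D c (p *\<^sub>R r + q *\<^sub>R s) b"
    using g[of "p *\<^sub>R r + q *\<^sub>R s"] P(4) D by (smt (verit) mult_nonneg_nonpos)
  have g2: "D c z b * D c a s < D c a z * D c s b"
    using g[of s] s(1) D by (smt (verit) mult_pos_neg)
  have n: "D r a b * D c a s - D c a r * D s a b \<noteq> 0"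
    using D_minor(2)[of c a b r s] nz D by auto
  show ?thesis unfolding X_from_minors[OF D]
    by (rule cone_exit[OF z pq _ _ _ P(1-3) g1 g2 s(2) nz(1,2) n]) simp_all
qed

lemma not_inT_scaled:
  assumes "\<kappa> = 1 \<or> \<kappa> = (-1::real)" "\<not> in_swept c a b z v" "\<not> in_swept c a b z (-v)" "D c z (\<kappa> *\<^sub>R v) < 0"
  shows "\<not> (D (\<kappa> *\<^sub>R v) a b > 0 \<and> D c (\<kappa> *\<^sub>R v) b > 0 \<and> D c a (\<kappa> *\<^sub>R v) > 0)"
  using assms(1)
proof
  assume "\<kappa> = 1" then show ?thesis using assms(2,4) by (auto simp: in_swept_def)
next
  assume "\<kappa> = -1" then show ?thesis using assms(3,4) by (auto simp: in_swept_def)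
qed

text \<open>The arc from u1 to u2 runs in the closed swept region, hence so does its common point P
  with the edge rs or its antipode. As \<open>D c z P\<close> is not positive, one end of the edge
  is strictly on the a side of cz, and \<open>slide_exit1\<close> follows the edge towards that
  end.\<close>

lemma slide_exit:
  assumes D: "D c a b > 0" and z: "D c z b \<ge> 0" "D c a z > 0"
    and u1: "D u1 a b \<ge> 0" "D c u1 b \<ge> 0" "D c a u1 \<ge> 0" "D c z u1 \<le> 0"
    and u2: "D u2 a b \<ge> 0" "D c u2 b \<ge> 0" "D c a u2 \<ge> 0" "D c z u2 \<le> 0"
    and u12: "D u1 a b > 0 \<or> D u2 a b > 0" "D c a u1 > 0 \<or> D c a u2 > 0"
    and X: "X u1 u2 r s"
    and nobs: "\<not> in_swept c a b z r" "\<not> in_swept c a b z s" "\<not> in_swept c a b z (-r)" "\<not> in_swept c a b z (-s)"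
    and nz: "D r a b \<noteq> 0" "D c a r \<noteq> 0" "D s a b \<noteq> 0" "D c a s \<noteq> 0" "D a r s \<noteq> 0" "D c z r \<noteq> 0 \<or> D c z s \<noteq> 0"
  shows "X c a r s \<or> X a b r s"
proof -
  obtain \<alpha> \<beta> \<gamma> \<delta> \<kappa> where h: "\<alpha> > 0" "\<beta> > 0" "\<gamma> > 0" "\<delta> > 0" "\<kappa> = 1 \<or> \<kappa> = (-1::real)"
    "\<alpha> *\<^sub>R u1 + \<beta> *\<^sub>R u2 = \<kappa> *\<^sub>R (\<gamma> *\<^sub>R r + \<delta> *\<^sub>R s)" using X_combo[OF X] by metis
  define P where "P = \<alpha> *\<^sub>R u1 + \<beta> *\<^sub>R u2"
  have P1: "P = \<gamma> *\<^sub>R (\<kappa> *\<^sub>R r) + \<delta> *\<^sub>R (\<kappa> *\<^sub>R s)" "P = \<delta> *\<^sub>R (\<kappa> *\<^sub>R s) + \<gamma> *\<^sub>R (\<kappa> *\<^sub>R r)" using h by (simp_all add: P_def algebra_simps)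
  have Pk: "D P a b > 0" "D c P b \<ge> 0" "D c a P > 0" "D c z P \<le> 0"
    unfolding P_def D_lin
    by (rule comb_pos(1)[OF h(1,2) u1(1) u2(1) u12(1)] comb_pos(2)[OF h(1,2) u1(2) u2(2)]
        comb_pos(1)[OF h(1,2) u1(3) u2(3) u12(2)] comb_pos(3)[OF h(1,2) u1(4) u2(4)])+
  have "\<gamma> * D c z (\<kappa> *\<^sub>R r) + \<delta> * D c z (\<kappa> *\<^sub>R s) \<le> 0" using Pk(4) by (simp add: P1(1))
  then have n: "\<not> (D c z (\<kappa> *\<^sub>R r) \<ge> 0 \<and> D c z (\<kappa> *\<^sub>R s) \<ge> 0)"
    using nz(6) h by (smt (verit) D_lin(6) mult_nonneg_nonneg mult_pos_pos no_zero_divisors mult_minus_left mult_1)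
  have k: "\<kappa> \<noteq> 0" using h(5) by auto
  consider "D c z (\<kappa> *\<^sub>R r) < 0" | "D c z (\<kappa> *\<^sub>R s) < 0" using n by linarith
  then have "X c a (\<kappa> *\<^sub>R r) (\<kappa> *\<^sub>R s) \<or> X a b (\<kappa> *\<^sub>R r) (\<kappa> *\<^sub>R s)"
  proof cases
    case 1
    have "X c a (\<kappa> *\<^sub>R s) (\<kappa> *\<^sub>R r) \<or> X a b (\<kappa> *\<^sub>R s) (\<kappa> *\<^sub>R r)"
      by (rule slide_exit1[OF D z h(4,3) Pk[unfolded P1(2)] 1 not_inT_scaled[OF h(5) nobs(1,3) 1]])
        (use nz(1-5) k D_swap(2)[of a s r] in simp_all)
    then show ?thesis by (simp add: X_swap)
  next
    case 2
    show ?thesis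
      by (rule slide_exit1[OF D z h(3,4) Pk[unfolded P1(1)] 2 not_inT_scaled[OF h(5) nobs(2,4) 2]])
        (use nz(1-5) k in simp_all)
  qed
  then show ?thesis using h(5) by auto
qed

text \<open>For edges starting at b the coordinate \<open>D b a b\<close> vanishes and
  \<open>slide_exit\<close> does not apply. Here the wall ab is out of question, since it shares b,
  and the signs for ca are read off directly.\<close>

lemma slide_exit_b:
  assumes D: "D c a b > 0" and z: "D c z b > 0" "D c a z > 0"
    and u1: "D u1 a b \<ge> 0" "D c u1 b \<ge> 0" "D c a u1 \<ge> 0" "D c z u1 \<le> 0"
    and u2: "D u2 a b \<ge> 0" "D c u2 b \<ge> 0" "D c a u2 \<ge> 0" "D c z u2 \<le> 0"
    and u12: "D u1 a b > 0 \<or> D u2 a b > 0" "D c u1 b > 0 \<or> D c u2 b > 0" "D c a u1 > 0 \<or> D c a u2 > 0"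
    and X: "X u1 u2 b s"
    and nobs: "\<not> in_swept c a b z s" and nz: "D c a s \<noteq> 0"
  shows "X c a b s"
proof -
  obtain \<alpha> \<beta> \<gamma> \<delta> \<kappa> where h: "\<alpha> > 0" "\<beta> > 0" "\<gamma> > 0" "\<delta> > 0" "\<kappa> = 1 \<or> \<kappa> = (-1::real)"
    "\<alpha> *\<^sub>R u1 + \<beta> *\<^sub>R u2 = \<kappa> *\<^sub>R (\<gamma> *\<^sub>R b + \<delta> *\<^sub>R s)" using X_combo[OF X] by metis
  define P where "P = \<alpha> *\<^sub>R u1 + \<beta> *\<^sub>R u2"
  have Pk: "D P a b > 0" "D c P b > 0" "D c a P > 0" "D c z P \<le> 0"
    unfolding P_def D_lin
    by (rule comb_pos(1)[OF h(1,2) u1(1) u2(1) u12(1)] comb_pos(1)[OF h(1,2) u1(2) u2(2) u12(2)]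
        comb_pos(1)[OF h(1,2) u1(3) u2(3) u12(3)] comb_pos(3)[OF h(1,2) u1(4) u2(4)])+
  have P1: "P = \<kappa> *\<^sub>R (\<gamma> *\<^sub>R b + \<delta> *\<^sub>R s)" using h by (simp add: P_def)
  have Q: "\<kappa> * (\<delta> * D s a b) > 0" "\<kappa> * (\<delta> * D c s b) > 0" "\<kappa> * (\<gamma> * D c a b + \<delta> * D c a s) > 0"
     "\<kappa> * (\<gamma> * D c z b + \<delta> * D c z s) \<le> 0"
    using Pk by (simp_all add: P1)
  have e: "D c b s = - D c s b" "D a b s = D s a b" using D_swap(2)[of c b s] D_cyc(1)[where a=s and b=a and c=b] by auto
  show ?thesis using h(5)
  proof
    assume k: "\<kappa> = 1"
    have 1: "D s a b > 0" "D c s b > 0" using Q k h by (auto simp: zero_less_mult_iff)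
    have "\<delta> * D c z s < 0" using Q(4) k h z by (smt (verit) mult_1 mult_pos_pos)
    then have "D c z s < 0" using h by (simp add: mult_less_0_iff)
    then have "D c a s < 0" using nobs 1 nz by (auto simp: in_swept_def)
    then show ?thesis using 1 D by (simp add: X_def e mult_less_0_iff zero_less_mult_iff)
  next
    assume k: "\<kappa> = -1"
    have 1: "D s a b < 0" "D c s b < 0" using Q k h by (auto simp: zero_less_mult_iff mult_less_0_iff)
    have "\<delta> * D c a s < 0" using Q(3) k h D by (smt (verit) mult_minus_left mult_1 mult_pos_pos)
    then have "D c a s < 0" using h by (simp add: mult_less_0_iff)
    then show ?thesis using 1 D by (simp add: X_def e mult_less_0_iff zero_less_mult_iff)
  qed
qed

text \<open>The point r precedes c. If the corner at c turned left towards a but not towards z, then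
  r would lie in the angle at c between a and z. Not being in the swept triangle it would lie beyond
  ab, and the edge rc would cross ab.\<close>

lemma corner_prev:
  assumes D: "D c a b > 0" and z: "D c z b \<ge> 0" "D c a z > 0"
   and nobs: "\<not> in_swept c a b z r" and nX: "\<not> X a b r c" and nz: "D r a b \<noteq> 0" "D c z r \<noteq> 0" and r: "D r c a > 0"
  shows "D r c z > 0"
proof (rule ccontr)
  assume "\<not> D r c z > 0"
  then have 1: "D c z r < 0" using nz D_cyc(1)[of c z r] by auto
  have 2: "D c a r > 0" using r D_cyc(1)[of c a r] by simp
  have "D c z b * D c a r - D c a z * D c r b < 0" using D_minor(1)[of c a b z r] mult_pos_neg[OF D 1] by linarith
  then have "D c a z * D c r b > 0" using z 2 by (smt (verit) mult_nonneg_nonneg)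
  then have 3: "D c r b > 0" using z by (simp add: zero_less_mult_iff)
  then have 4: "D r a b < 0" using nobs 1 2 nz by (auto simp: in_swept_def)
  have "D a r c = D c a r" "D b r c = - D c r b" "D a b r = D r a b" "D a b c = D c a b"
    by (simp_all add: D_coord algebra_simps)
  then have "X a b r c" unfolding X_def using 2 3 4 D by (simp add: mult_less_0_iff)
  then show False using nX by simp
qed

text \<open>The counterpart of \<open>corner_prev\<close> at b, with successor s: otherwise s would
  lie in the angle at b between c and a, beyond ca, and bs would cross ca.\<close>

lemma corner_next:
  assumes D: "D c a b > 0" and nobs: "\<not> in_swept c a b b s" and nX: "\<not> X c a b s"
   and nz: "D c a s \<noteq> 0" "D c b s \<noteq> 0" and s: "D a b s > 0"
  shows "D c b s > 0"
proof (rule ccontr)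
  assume "\<not> D c b s > 0"
  then have 1: "D c b s < 0" "D c s b > 0" using nz D_swap(2)[of c s b] by auto
  have 2: "D s a b > 0" using s D_cyc(1)[where a=s and b=a and c=b] by simp
  have 3: "D c a s < 0" using 1 2 nobs nz by (auto simp: in_swept_def)
  have "X c a b s" unfolding X_def using 1 2 3 s D by (auto simp: mult_less_0_iff)
  then show False using nX by simp
qed

lemma ch_cons_snoc2:
  "T \<noteq> [] \<Longrightarrow> changes (x # T @ [y, z]) = (if x = hd T then 0 else 1) + changes T + (if last T = y then 0 else 1) + (if y = z then 0 else 1)"
proof -
  assume "T \<noteq> []"
  then obtain T' t where T: "T = T' @ [t]" by (metis append_butlast_last_id)
  have "changes (x # T) = (if x = hd T then 0 else 1) + changes T" using \<open>T \<noteq> []\<close> by (cases T) auto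
  then show ?thesis using ch_append[of "x # T'" t "[y, z]"] by (simp add: T)
qed

text \<open>The entry True belongs to the deleted vertex. Its neighbours' signs can only change to
  that sign, read through the closing where necessary, so every new sign change is paid for by one
  that disappears.\<close>

lemma ch_delete:
  assumes "T \<noteq> []" "d1 \<longrightarrow> d1'" "x2 \<longrightarrow> x2'"
  shows "changes (d1' # T @ [flip_sign e x2', flip_sign e d1']) \<le> changes (True # d1 # T @ [flip_sign e x2, flip_sign e True])"
  using assms by (auto simp: ch_cons_snoc2 flip_sign_def)

lemma ch_mono_last:
  assumes "T \<noteq> []" "x \<longrightarrow> x'"
  shows "changes (d # T @ [flip_sign e x', flip_sign e True]) \<le> changes (d # T @ [flip_sign e x, flip_sign e True])"
  using assms by (auto simp: ch_cons_snoc2 flip_sign_def)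

definition swept_free where "swept_free c a b z V \<longleftrightarrow> (\<forall>v\<in>V. \<not> in_swept c a b z v \<and> \<not> in_swept c a b z (-v))"

text \<open>The only new edge joins c to b, and by \<open>slide_exit\<close> an edge crossing it
  would have crossed ca or ab. Turning signs change at most at b and l, and
  \<open>corner_next\<close> and \<open>corner_prev\<close> control them there.\<close>

lemma delete_vertex:
  assumes gen_pos: "gen_pos (a # b # M @ [l])" and M: "M \<noteq> []" and e: "unit_sign e"
    and s: "simple e (a # b # M @ [l])" and D: "D (e *\<^sub>R l) a b > 0"
    and free: "swept_free (e *\<^sub>R l) a b b (set M)"
  shows "gen_pos (b # M @ [l])" "simple e (b # M @ [l])" "inflections e (b # M @ [l]) \<le> inflections e (a # b # M @ [l])"
proof -
  define c where "c = e *\<^sub>R l"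
  have ee: "e * e = 1" using e by auto
  have ee': "e * (e * t) = t" for t using ee by (metis mult.assoc mult_1)
  have el: "e *\<^sub>R c = l" using ee by (simp add: c_def)
  define E where "E = steps (b # M @ [l])"
  let ?ps = "a # b # M @ [l]"
  show gp': "gen_pos (b # M @ [l])" using gen_pos M unfolding gen_pos_def by (auto intro: gset_mono simp: Suc_le_eq)
  have edges: "edges e ?ps = insert (a,b) (E \<union> {(l, e *\<^sub>R a)})"
    using pe_append[of "b # M" l "[e *\<^sub>R a]"] by (simp add: edges_def E_def)
  have edg': "edges e (b # M @ [l]) = E \<union> {(l, e *\<^sub>R b)}"
    using pe_append[of "b # M" l "[e *\<^sub>R b]"] by (simp add: edges_def E_def)
  have Xc: "X l (e *\<^sub>R x) r s = X c x r s" for x r s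
    using e X_neg(1)[of l "- x" r s] by (auto simp: c_def)
  have nab: "\<not> X a b r s" and nca: "\<not> X c a r s" if "(r,s) \<in> E" for r s
    using noXD[OF s[unfolded simple_def edges], of a b r s] noXD[OF s[unfolded simple_def edges], of l "e *\<^sub>R a" r s] that Xc
    by simp_all
  have nEE: "noX E E" by (rule noX_mono[OF s[unfolded simple_def edges]]) auto
  have distE: "pairwise_ne2 (b#M@[l])" using gen_pos by (simp add: gen_pos_def)
  have ne: "ne2 a w \<and> ne2 b w \<and> ne2 w l" if "w \<in> set M" for w
    using that gen_pos by (simp add: gen_pos_def sdist_append)
  have ab: "ne2 a b" "ne2 a l" "ne2 b l"
    using gen_pos by (simp_all add: gen_pos_def sdist_append)
  have nzw: "D w a b \<noteq> 0" "D c a w \<noteq> 0" "D c b w \<noteq> 0" "D w l a \<noteq> 0" "D w l b \<noteq> 0" if "w \<in> set M" for w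
  proof -
    show "D w a b \<noteq> 0" "D w l a \<noteq> 0" "D w l b \<noteq> 0" using ne[OF that] ab that by (intro gp_D[OF gen_pos]; simp add: ne2_sym)+
    have "D l a w \<noteq> 0" "D l b w \<noteq> 0" using ne[OF that] ab that by (intro gp_D[OF gen_pos]; simp add: ne2_sym)+
    then show "D c a w \<noteq> 0" "D c b w \<noteq> 0" using e by (auto simp: c_def)
  qed
  have ns: "noX {(l, e *\<^sub>R b)} E"
  proof -
    have "\<not> X c b r s" if rs: "(r,s) \<in> E" for r s
    proof
      assume X: "X c b r s"
      have "r \<noteq> b" "s \<noteq> b" "r \<noteq> l" "s \<noteq> l" using X e by (auto simp: c_def)
      then have rsM: "r \<in> set M" "s \<in> set M" using pe_set[of r s "b#M@[l]"] rs by (auto simp: E_def)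
      have "ne2 r s" using pe_distinct[OF distE, of r s] rs by (simp_all add: E_def)
      have "X c a r s \<or> X a b r s"
      proof (rule slide_exit[OF _ _ _ _ _ _ _ _ _ _ _ _ _ X])
        show "D r a b \<noteq> 0" "D s a b \<noteq> 0" "D c a r \<noteq> 0" "D c a s \<noteq> 0" "D c b r \<noteq> 0 \<or> D c b s \<noteq> 0"
          using nzw rsM by auto
        show "D a r s \<noteq> 0" using rsM ne[of r] ne[of s] \<open>ne2 r s\<close> by (intro gp_D[OF gen_pos]) (auto simp: ne2_sym)
      qed (use D free rsM D_swap(2)[of c b a] in \<open>auto simp: c_def[symmetric] swept_free_def\<close>)
      then show False using nab nca rs by auto
    qed
    then show ?thesis by (simp add: noX_def Xc)
  qed
  moreover have "noX E {(l, e *\<^sub>R b)}" using ns noX_sym by blast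
  moreover have "noX {(l, e *\<^sub>R b)} {(l, e *\<^sub>R b)}" by (simp add: noX_def)
  ultimately show "simple e (b # M @ [l])" unfolding simple_def edg' noX_Un using nEE by blast
  obtain m1 M1 where m1: "M = m1 # M1" using M by (cases M) auto
  obtain Mk mk where mk: "M = Mk @ [mk]" using M by (metis append_butlast_last_id)
  define T where "T = tri (b # M @ [l])"
  have T: "T \<noteq> []" using length_tri[of "b # M @ [l]"] M by (auto simp: T_def)
  define x2 where "x2 \<longleftrightarrow> D (e *\<^sub>R mk) c a > 0"
  define x2' where "x2' \<longleftrightarrow> D (e *\<^sub>R mk) c b > 0"
  have mkin: "mk \<in> set M" by (simp add: mk)
  have m1in: "m1 \<in> set M" by (simp add: m1)
  have nzmk: "D mk l a \<noteq> 0" "D mk l b \<noteq> 0" "D mk a b \<noteq> 0" "D c a m1 \<noteq> 0" "D c b m1 \<noteq> 0"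
    by (simp_all add: nzw mkin m1in)
  have e2: "(D mk l (e *\<^sub>R a) > 0) = flip_sign e x2" "(D mk l (e *\<^sub>R b) > 0) = flip_sign e x2'"
    using e nzmk by (auto simp: x2_def x2'_def c_def flip_sign_def)
  have "tri (b # M @ [l, e *\<^sub>R x]) = T @ [D mk l (e *\<^sub>R x) > 0]" for x
    using tri_append[of "b # Mk" mk l "[e *\<^sub>R x]"] by (simp add: T_def mk)
  then have s1: "turn_signs e ?ps = True # (D a b m1 > 0) # T @ [flip_sign e x2]"
    and s2: "turn_signs e (b # M @ [l]) = (D c b m1 > 0) # T @ [flip_sign e x2']"
    using D e2 by (simp_all add: turn_signs_def m1 c_def)
  have "(e *\<^sub>R mk) = mk \<or> (e *\<^sub>R mk) = - mk" using e by auto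
  then have fr: "\<not> in_swept c a b b (e *\<^sub>R mk)" using free mkin unfolding swept_free_def c_def by metis
  have "(mk, l) \<in> E" using pe_append[of "b # Mk" mk "[l]"] by (auto simp: E_def mk)
  then have nX1: "\<not> X a b (e *\<^sub>R mk) c" using nab[of mk l] X_neg(2)[of a b mk "l"] e by (auto simp: c_def)
  have i2: "x2 \<longrightarrow> x2'" unfolding x2_def x2'_def
  proof
    assume "D (e *\<^sub>R mk) c a > 0"
    then show "D (e *\<^sub>R mk) c b > 0"
    proof (intro corner_prev[OF _ _ _ fr nX1])
      have "D c b mk = e * D mk l b" by (simp add: c_def D_coord algebra_simps)
      then show "D c b (e *\<^sub>R mk) \<noteq> 0" using nzmk e by auto
    qed (use D nzmk e in \<open>auto simp: c_def\<close>)
  qed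
  have bm1: "(b, m1) \<in> E" by (simp add: E_def m1)
  have fr1: "\<not> in_swept c a b b m1" using free m1in unfolding swept_free_def c_def by blast
  have i1: "D a b m1 > 0 \<longrightarrow> D c b m1 > 0"
    using corner_next[OF D[folded c_def] fr1 nca[OF bm1] nzmk(4,5)] by blast
  show "inflections e (b # M @ [l]) \<le> inflections e ?ps"
    unfolding inflections_def s1 s2 using ch_delete[OF T i1 i2, of e] by simp
qed

subsection \<open>The first obstacle\<close>

lemma cramer: "D c a b *\<^sub>R z = D z a b *\<^sub>R c + D c z b *\<^sub>R a + D c a z *\<^sub>R b"
  by (simp add: vec_eq_iff forall_3 D_coord algebra_simps)

text \<open>The edge from c, turning from a towards b, meets z first. Here c is the predecessor of a, up to
  the closing sign, and z is the vertex u or its antipode.\<close>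

locale slide =
  fixes e \<kappa> :: real and a b u l :: "real^3" and X' Y' :: "(real^3) list" and c z :: "real^3"
  assumes e: "unit_sign e" and k: "unit_sign \<kappa>"
    and c_def: "c = e *\<^sub>R l" and z_def: "z = \<kappa> *\<^sub>R u"
    and gen_pos: "gen_pos (a # b # X' @ u # Y' @ [l])"
    and sim: "simple e (a # b # X' @ u # Y' @ [l])"
    and D: "D c a b > 0"
    and zk: "D z a b > 0" "D c z b > 0" "D c a z > 0"
    and free: "swept_free c a b z (set X' \<union> set Y')"
begin

definition "E0 = steps (b # X' @ u # Y' @ [l])"

lemma ee: "e * e = 1" "e * (e * t) = t" "\<kappa> * \<kappa> = 1" "\<kappa> * (\<kappa> * t) = t"
  using e k by auto

lemma edg_ps: "edges e (a # b # X' @ u # Y' @ [l]) = insert (a,b) (E0 \<union> {(l, e *\<^sub>R a)})"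
  using pe_append[of "b # X' @ u # Y'" l "[e *\<^sub>R a]"] by (simp add: edges_def E0_def)

lemma Xc: "X l (e *\<^sub>R x) r s = X c x r s"
  using e X_neg(1)[of l "- x" r s] by (auto simp: c_def)

lemma nab: "(r,s) \<in> E0 \<Longrightarrow> \<not> X a b r s"
  and nca: "(r,s) \<in> E0 \<Longrightarrow> \<not> X c a r s"
  using noXD[OF sim[unfolded simple_def edg_ps], of a b r s]
    noXD[OF sim[unfolded simple_def edg_ps], of l "e *\<^sub>R a" r s] Xc
  by simp_all

lemma nE0: "noX E0 E0" by (rule noX_mono[OF sim[unfolded simple_def edg_ps]]) auto

lemma ne_ab: "ne2 a b" "ne2 a u" "ne2 a l" "ne2 b u" "ne2 b l" "ne2 u l"
  and ne_XY: "x \<in> set X' \<union> set Y' \<Longrightarrow> ne2 a x \<and> ne2 b x \<and> ne2 u x \<and> ne2 l x"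
  and sd: "pairwise_ne2 (a # b # X' @ u # Y' @ [l])"
proof -
  show sd: "pairwise_ne2 (a # b # X' @ u # Y' @ [l])" using gen_pos by (simp add: gen_pos_def)
  show "ne2 a b" "ne2 a u" "ne2 a l" "ne2 b u" "ne2 b l" "ne2 u l"
    using sd by (simp_all add: sdist_append)
  show "x \<in> set X' \<union> set Y' \<Longrightarrow> ne2 a x \<and> ne2 b x \<and> ne2 u x \<and> ne2 l x"
    using sd ne2_sym[of x u] ne2_sym[of x l] by (auto simp: sdist_append)
qed

lemma gnz: "x \<in> {a,b,u,l} \<union> set X' \<union> set Y' \<Longrightarrow> y \<in> {a,b,u,l} \<union> set X' \<union> set Y' \<Longrightarrow>
   w \<in> {a,b,u,l} \<union> set X' \<union> set Y' \<Longrightarrow> ne2 x y \<Longrightarrow> ne2 y w \<Longrightarrow> ne2 x w \<Longrightarrow> D x y w \<noteq> 0"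
  by (rule gp_D[OF gen_pos]) auto

lemma nzXY:
  assumes "x \<in> set X' \<union> set Y'"
  shows "D x a b \<noteq> 0" "D c a x \<noteq> 0" "D c z x \<noteq> 0" "D x c a \<noteq> 0" "D x c z \<noteq> 0"
proof -
  have "D x a b \<noteq> 0" "D l a x \<noteq> 0" "D l u x \<noteq> 0" "D x l a \<noteq> 0" "D x l u \<noteq> 0"
    using assms ne_XY[OF assms] ne_ab by (intro gnz; simp add: ne2_sym)+
  then show "D x a b \<noteq> 0" "D c a x \<noteq> 0" "D c z x \<noteq> 0" "D x c a \<noteq> 0" "D x c z \<noteq> 0"
    using e k by (auto simp: c_def z_def)
qed

lemma small_pos: assumes "x > 0" "y > 0" "w > (0::real)"
  shows "\<exists>\<delta>>0. x + \<delta> * x' > 0 \<and> y + \<delta> * y' > 0 \<and> w + \<delta> * w' > 0"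
proof -
  have "\<forall>\<^sub>F \<delta> in at_right 0. x + \<delta> * x' > 0" if "x > 0" for x x' :: real
  proof -
    have "((\<lambda>\<delta>. x + \<delta> * x') \<longlongrightarrow> x + 0 * x') (at_right 0)" by (intro tendsto_intros)
    then show ?thesis using that by (intro order_tendstoD(1)) auto
  qed
  then have "\<forall>\<^sub>F \<delta> in at_right 0. \<delta> > 0 \<and> x + \<delta> * x' > 0 \<and> y + \<delta> * y' > 0 \<and> w + \<delta> * w' > 0"
    using assms by (intro eventually_conj eventually_at_right_less) auto
  then show ?thesis using eventually_happens' trivial_limit_at_right_real by blast
qed

text \<open>If a neighbour x of u were on the a side of cz, the edge from z towards \<kappa> x would
  run into the swept region and have to leave it through ca or ab. The point z + \<delta> \<kappa> x
  serves as a point of this edge that is still in the cone.\<close>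

lemma tip:
  assumes x: "x \<in> set X' \<union> set Y'" and nX: "\<not> X c a u x" "\<not> X a b u x"
  shows "D c z (\<kappa> *\<^sub>R x) > 0"
proof (rule ccontr)
  assume "\<not> ?thesis"
  then have 1: "D c z (\<kappa> *\<^sub>R x) < 0" using nzXY[OF x] k by auto
  obtain \<delta> where d: "\<delta> > 0" "D z a b + \<delta> * D (\<kappa> *\<^sub>R x) a b > 0" "D c z b + \<delta> * D c (\<kappa> *\<^sub>R x) b > 0"
     "D c a z + \<delta> * D c a (\<kappa> *\<^sub>R x) > 0" using small_pos[OF zk] by blast
  have fr: "\<not> in_swept c a b z x" "\<not> in_swept c a b z (-x)" using free x by (auto simp: swept_free_def)
  have "D a u x \<noteq> 0" using x ne_XY[OF x] ne_ab by (intro gnz) (simp_all add: ne2_sym)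
  have "X c a z (\<kappa> *\<^sub>R x) \<or> X a b z (\<kappa> *\<^sub>R x)"
    by (rule slide_exit1[where z=z and p=1 and q=\<delta>, OF D _ _ _ _ _ _ _ _ 1 not_inT_scaled[OF k fr 1]])
      (use d zk nzXY[OF x] k 1 \<open>D a u x \<noteq> 0\<close> mult_pos_neg[OF d(1) 1] in \<open>auto simp: z_def\<close>)
  then show False using nX k by (auto simp: z_def)
qed

definition "prev = last (b # X')"
definition "nxt = hd (Y' @ [l])"

lemma prev_edge: "(prev, u) \<in> E0" and nxt_edge: "(u, nxt) \<in> E0"
proof -
  obtain W where W: "b # X' = W @ [prev]" unfolding prev_def by (metis append_butlast_last_id list.distinct(1))
  have W2: "b # X' @ u # Y' @ [l] = W @ prev # u # Y' @ [l]" using W by (metis append.assoc append_Cons append_Nil)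
  show "(prev, u) \<in> E0" unfolding E0_def W2 using pe_append[of W prev "u # Y' @ [l]"] by simp
  obtain Q where Q: "Y' @ [l] = nxt # Q" unfolding nxt_def by (metis list.collapse snoc_eq_iff_butlast)
  show "(u, nxt) \<in> E0" using pe_append[of "b # X'" u "Y' @ [l]"] by (simp add: E0_def Q)
qed

lemma Dcb: "D b z a = D z a b" "D c b z = - D c z b" "D a b z = D z a b" "D a b c = D c a b"
  "D a z c = D c a z" "D b z c = - D c z b" "D b c z = D c z b" "D a c z = - D c a z" "D z c a = D c a z"
  by (simp_all add: D_coord algebra_simps)

text \<open>\<open>tip\<close> does not cover prev = b. Then \<kappa> = -1 is impossible, because
  the edge from b to -z would cross ca.\<close>

lemma prev_pos: "D c z (\<kappa> *\<^sub>R prev) > 0"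
proof (cases "X' = []")
  case False
  then have "prev \<in> set X'" by (simp add: prev_def)
  then show ?thesis using tip[of prev] nab[OF prev_edge] nca[OF prev_edge] by (auto simp: X_swap)
next
  case True
  then have p: "prev = b" unfolding prev_def by simp
  have "\<kappa> \<noteq> -1"
  proof
    assume k1: "\<kappa> = -1"
    have "u = - z" by (simp add: z_def k1)
    have "X c a b (-z)" unfolding X_def using zk D by (simp add: Dcb mult_less_0_iff)
    then show False using nca[OF prev_edge] p \<open>u = - z\<close> by simp
  qed
  then show ?thesis using k zk p by auto
qed

lemma nxt_pos: assumes "Y' \<noteq> []" shows "D c z (\<kappa> *\<^sub>R nxt) > 0"
proof -
  have "nxt \<in> set Y'" using assms by (simp add: nxt_def)
  then show ?thesis using tip[of nxt] nab[OF nxt_edge] nca[OF nxt_edge] by auto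
qed

text \<open>The obstacle is adjacent to l. With \<kappa> = -e the edge from u to l would cross ab;
  so z is the predecessor of c. The triangle z c a is part of the region swept so far and contains
  no obstacle, which allows c to be deleted instead of a.\<close>

lemma degenerate:
  assumes "Y' = []"
  shows "\<kappa> = e" "D z c a > 0" "swept_free z c a a (set (b # X'))"
proof -
  have n: "nxt = l" unfolding nxt_def using assms by simp
  show ke: "\<kappa> = e"
  proof (rule ccontr)
    assume "\<kappa> \<noteq> e" then have ke: "\<kappa> = - e" using e k by auto
    have "X a b z (-c)" unfolding X_def using zk D by (simp add: Dcb mult_less_0_iff)
    moreover have "X a b z (-c) = X a b u l" using e by (auto simp: z_def c_def ke)
    ultimately show False using nab[OF nxt_edge] n by simp
  qed
  show "D z c a > 0" using zk Dcb(9) by simp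
  show "swept_free z c a a (set (b # X'))"
  proof -
    have key: "in_swept c a b z r" if r: "in_swept z c a a r" for r
    proof -
      define t where "t = D z c a"
      have t: "t > 0" using zk(3) Dcb(9) by (simp add: t_def)
      have r1: "D r c a > 0" "D z r a > 0" "D z c r > 0" using r by (simp_all add: in_swept_def)
      have R: "t *\<^sub>R r = D r c a *\<^sub>R z + D z r a *\<^sub>R c + D z c r *\<^sub>R a" using cramer[of z c a r] by (simp add: t_def)
      have "t * D r a b = D (t *\<^sub>R r) a b" by simp
      also have "\<dots> = D r c a * D z a b + D z r a * D c a b" unfolding R by simp
      also have "\<dots> > 0" using r1 zk D by (intro add_pos_pos mult_pos_pos)
      finally have 1: "D r a b > 0" using t by (simp add: zero_less_mult_iff)
      have "t * D c r b = D c (t *\<^sub>R r) b" by simp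
      also have "\<dots> = D r c a * D c z b + D z c r * D c a b" unfolding R by simp
      also have "\<dots> > 0" using r1 zk D by (intro add_pos_pos mult_pos_pos)
      finally have 2: "D c r b > 0" using t by (simp add: zero_less_mult_iff)
      have "D c a r = D r c a" "D c z r = - D z c r" by (simp_all add: D_coord algebra_simps)
      then show ?thesis using 1 2 r1 by (simp add: in_swept_def)
    qed
    have "\<not> in_swept z c a a b" "\<not> in_swept z c a a (-b)"
      using zk D D_cyc(1)[of b c a] by (simp_all add: in_swept_def Dcb D_swap(1)[of c z b])
    then show ?thesis using key free by (auto simp: swept_free_def)
  qed
qed

lemma ev_lin_ne:
  fixes A B :: real assumes "A \<noteq> 0 \<or> B \<noteq> 0"
  shows "\<forall>\<^sub>F \<rho> in at_left t. A + \<rho> * B \<noteq> 0"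
proof (cases "B = 0")
  case False
  have "\<forall>\<^sub>F \<rho> in at_left t. \<rho> \<noteq> - A / B"
  proof (cases "t = - A / B")
    case True
    have "\<forall>\<^sub>F \<rho> in at_left t. \<rho> < t" by (simp add: eventually_at_left_field) (use lt_ex in blast)
    then show ?thesis by eventually_elim (use True in auto)
  next
    case False
    have "((\<lambda>\<rho>. \<rho>) \<longlongrightarrow> t) (at_left t)" by (rule tendsto_ident_at)
    then show ?thesis using False by (rule tendsto_imp_eventually_ne)
  qed
  then show ?thesis
  proof eventually_elim
    case (elim \<rho>)
    then show ?case using False by (auto simp: field_simps add_eq_0_iff)
  qed
qed (use assms in auto)

text \<open>All strict conditions except the first already hold at the position where the line cz
  meets ab, hence slightly before it; the first holds strictly before it, and finitely many
  non-generic parameters are avoided.\<close>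

lemma ex_rho:
  assumes "Y' \<noteq> []"
  shows "\<exists>\<rho>>0. D c z (a + \<rho> *\<^sub>R b) < 0 \<and> D (\<kappa> *\<^sub>R prev) z (a + \<rho> *\<^sub>R b) > 0 \<and> D z (a + \<rho> *\<^sub>R b) (\<kappa> *\<^sub>R nxt) > 0 \<and>
    (\<forall>p\<in>set (b # X' @ u # Y' @ [l]). \<forall>q\<in>set (b # X' @ u # Y' @ [l]). ne2 p q \<longrightarrow> D (a + \<rho> *\<^sub>R b) p q \<noteq> 0)"
proof -
  \<comment> \<open>The parameter for which a + t b lies in the plane of c and z.\<close>
  define t where "t = D c a z / D c z b"
  define v v' where "v = \<kappa> *\<^sub>R prev" and "v' = \<kappa> *\<^sub>R nxt"
  have t: "t > 0" using zk by (simp add: t_def)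
  have vpos: "D c z v > 0" "D c z v' > 0" using prev_pos nxt_pos assms by (auto simp: v_def v'_def)
  have lim: "\<forall>\<^sub>F \<rho> in at_left t. A + \<rho> * B > 0" if "A + t * B > 0" for A B :: real
  proof -
    have "((\<lambda>\<rho>. A + \<rho> * B) \<longlongrightarrow> A + t * B) (at_left t)" by (intro tendsto_intros)
    then show ?thesis using that by (rule order_tendstoD(1))
  qed
  have "D v z (D c a b *\<^sub>R z) = 0" by simp
  then have "D z a b * D v z c + D c z b * D v z a + D c a z * D v z b = 0"
    unfolding cramer[of c a b z] by simp
  moreover have "D v z c = - D c z v" by (rule D_swap(3))
  ultimately have "D c z b * (D v z a + t * D v z b) = D z a b * D c z v" using zk by (simp add: t_def field_simps)
  then have "D c z b * (D v z a + t * D v z b) > 0" using zk vpos by simp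
  then have 1: "D v z a + t * D v z b > 0" using zk by (simp add: zero_less_mult_iff)
  have "D z (D c a b *\<^sub>R z) v' = 0" by simp
  then have "D z a b * D z c v' + D c z b * D z a v' + D c a z * D z b v' = 0"
    unfolding cramer[of c a b z] by simp
  moreover have "D z c v' = - D c z v'" by (rule D_swap(1))
  ultimately have "D c z b * (D z a v' + t * D z b v') = D z a b * D c z v'" using zk by (simp add: t_def field_simps)
  then have "D c z b * (D z a v' + t * D z b v') > 0" using zk vpos by simp
  then have 2: "D z a v' + t * D z b v' > 0" using zk by (simp add: zero_less_mult_iff)
  let ?V = "set (b # X' @ u # Y' @ [l])"
  have ev: "\<forall>\<^sub>F \<rho> in at_left t. ne2 p q \<longrightarrow> D a p q + \<rho> * D b p q \<noteq> 0" if p: "p \<in> ?V" and q: "q \<in> ?V" for p q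
  proof (cases "ne2 p q")
    case True
    have bp: "p = b \<or> ne2 b p" and bq: "q = b \<or> ne2 b q" and ap: "ne2 a p" "ne2 a q"
      using sd p q by auto
    have V: "p \<in> {a,b,u,l} \<union> set X' \<union> set Y'" "q \<in> {a,b,u,l} \<union> set X' \<union> set Y'" using p q by auto
    have "D a p q \<noteq> 0 " using True ap V by (intro gnz) auto
    then show ?thesis using ev_lin_ne[of "D a p q" "D b p q" t] by auto
  qed auto
  have "\<forall>\<^sub>F \<rho> in at_left t. \<forall>p\<in>?V. \<forall>q\<in>?V. ne2 p q \<longrightarrow> D a p q + \<rho> * D b p q \<noteq> 0"
    by (intro eventually_ball_finite ballI ev) auto
  moreover have "\<forall>\<^sub>F \<rho> in at_left t. \<rho> > 0" using lim[of 0 1] t by simp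
  moreover have "\<forall>\<^sub>F \<rho> in at_left t. \<rho> < t" by (simp add: eventually_at_left_field) (use lt_ex in blast)
  ultimately have "\<forall>\<^sub>F \<rho> in at_left t. \<rho> > 0 \<and> \<rho> < t \<and> D v z a + \<rho> * D v z b > 0 \<and> D z a v' + \<rho> * D z b v' > 0 \<and>
     (\<forall>p\<in>?V. \<forall>q\<in>?V. ne2 p q \<longrightarrow> D a p q + \<rho> * D b p q \<noteq> 0)"
    using lim[OF 1] lim[OF 2] by eventually_elim auto
  then obtain \<rho> where r: "\<rho> > 0" "\<rho> < t" "D v z a + \<rho> * D v z b > 0" "D z a v' + \<rho> * D z b v' > 0"
     "\<forall>p\<in>?V. \<forall>q\<in>?V. ne2 p q \<longrightarrow> D a p q + \<rho> * D b p q \<noteq> 0"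
    using eventually_happens'[OF trivial_limit_at_left_real] by blast
  have "D c z (a + \<rho> *\<^sub>R b) < 0" using r(2) zk D_swap(2)[of c z a] by (simp add: t_def field_simps)
  moreover have "D v z (a + \<rho> *\<^sub>R b) > 0" "D z (a + \<rho> *\<^sub>R b) v' > 0"
    and "\<forall>p\<in>?V. \<forall>q\<in>?V. ne2 p q \<longrightarrow> D (a + \<rho> *\<^sub>R b) p q \<noteq> 0"
    using r(3-5) by (simp_all only: D_lin)
  ultimately show ?thesis using r(1) unfolding v_def v'_def by blast
qed

end

lemma obstacle:
  assumes gen_pos: "gen_pos (a # b # M @ [l])" and e: "unit_sign e"
    and s: "simple e (a # b # M @ [l])" and D: "D (e *\<^sub>R l) a b > 0"
    and nf: "\<not> swept_free (e *\<^sub>R l) a b b (set M)"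
  obtains X' u Y' \<kappa> where "M = X' @ u # Y'" "slide e \<kappa> a b u l X' Y' (e *\<^sub>R l) (\<kappa> *\<^sub>R u)"
proof -
  define c where "c = e *\<^sub>R l"
  define oct where "oct v \<longleftrightarrow> D v a b > 0 \<and> D c v b > 0 \<and> D c a v > 0" for v
  define Os where "Os = {v \<in> set M \<union> uminus ` set M. oct v}"
  have fin: "finite Os" by (simp add: Os_def)
  obtain v0 where "v0 \<in> set M" "in_swept c a b b v0 \<or> in_swept c a b b (-v0)" using nf by (auto simp: swept_free_def c_def)
  then have "v0 \<in> Os \<or> -v0 \<in> Os" by (auto simp: Os_def oct_def in_swept_def)
  then have "Os \<noteq> {}" by auto
  \<comment> \<open>By \<open>cramer\<close>, v is seen from c in the direction of
    \<open>D c v b\<close> a + \<open>D c a v\<close> b. The quotient is thus the position on ab at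
    which the sliding edge meets v, and z is met first.\<close>
  then obtain z where z: "z \<in> Os" "\<forall>v\<in>Os. D c a z / D c z b \<le> D c a v / D c v b"
    using obtains_MIN[OF fin, of "\<lambda>v. D c a v / D c v b"] fin by (metis (no_types, lifting) Min_le finite_imageI image_eqI)
  have zo: "oct z" using z by (simp add: Os_def)
  have nin: "\<not> in_swept c a b z v" if "v \<in> set M \<union> uminus ` set M" for v
  proof
    assume i: "in_swept c a b z v"
    then have "v \<in> Os" using that by (auto simp: Os_def oct_def in_swept_def)
    then have "D c a z * D c v b \<le> D c a v * D c z b" using z zo i by (auto simp: oct_def in_swept_def field_simps)
    then have "D c a b * D c z v \<ge> 0" unfolding D_minor(1)[of c a b z v] by (simp add: algebra_simps)
    moreover have "D c z v < 0" using i by (simp add: in_swept_def)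
    ultimately show False using mult_pos_neg[OF D[folded c_def]] by fastforce
  qed
  obtain \<kappa> u where ku: "unit_sign \<kappa>" "z = \<kappa> *\<^sub>R u" "u \<in> set M"
  proof (cases "z \<in> set M")
    case True then show ?thesis using that[of 1 z] by simp
  next
    case False then show ?thesis using that[of "-1" "-z"] z(1) by (auto simp: Os_def)
  qed
  obtain X' Y' where M: "M = X' @ u # Y'" using ku(3) by (meson split_list)
  have "slide e \<kappa> a b u l X' Y' c z"
    by unfold_locales (use e ku c_def gen_pos s D zo nin M in \<open>auto simp: oct_def swept_free_def\<close>)
  then show ?thesis using that M ku c_def by blast
qed

subsection \<open>Splitting at an obstacle\<close>

lemma gset_insert:
  assumes "generic S" "\<And>p q. p \<in> S \<Longrightarrow> q \<in> S \<Longrightarrow> ne2 p q \<Longrightarrow> D w p q \<noteq> 0"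
  shows "generic (insert w S)"
  unfolding generic_def
proof (intro ballI impI)
  fix x y z assume m: "x \<in> insert w S" "y \<in> insert w S" "z \<in> insert w S" and n: "ne2 x y \<and> ne2 y z \<and> ne2 x z"
  consider "x = w" "y \<in> S" "z \<in> S" | "y = w" "x \<in> S" "z \<in> S" | "z = w" "x \<in> S" "y \<in> S" | "x \<in> S" "y \<in> S" "z \<in> S"
    using m n by auto
  then show "D x y z \<noteq> 0"
  proof cases
    case 1 then show ?thesis using assms(2) n by auto
  next
    case 2 then show ?thesis using assms(2)[of x z] n D_swap(1)[of w x z] by auto
  next
    case 3 then show ?thesis using assms(2)[of x y] n D_cyc(1)[of x y w] by auto
  next
    case 4 then show ?thesis using assms(1) n by (auto simp: generic_def)
  qed
qed

lemma X_subsegment: "\<rho> > 0 \<Longrightarrow> X (a + \<rho> *\<^sub>R b) b r s \<Longrightarrow> X a b r s"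
proof -
  assume r: "\<rho> > 0" and X: "X (a + \<rho> *\<^sub>R b) b r s"
  have "D a r s * D b r s < 0"
  proof -
    have "D a r s * D b r s + \<rho> * (D b r s * D b r s) < 0" using X by (simp add: X_def algebra_simps)
    moreover have "\<rho> * (D b r s * D b r s) \<ge> 0" using r by simp
    ultimately show ?thesis by linarith
  qed
  then show ?thesis using X by (simp add: X_def)
qed

text \<open>The point \<open>i2\<close> on the edge from a to b lies just before the point that c and z determine, so that the
  arc from z to \<open>i2\<close> is a shortcut that cuts the polygon into the loops \<open>AA\<close> and \<open>BB\<close>.\<close>

locale slide2 = slide +
  fixes \<rho> :: real and i2 :: "real^3"
  assumes Yne: "Y' \<noteq> []" and rho: "\<rho> > 0" and i2: "i2 = a + \<rho> *\<^sub>R b"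
    and i2c: "D c z i2 < 0" and i2p: "D (\<kappa> *\<^sub>R prev) z i2 > 0" and i2n: "D z i2 (\<kappa> *\<^sub>R nxt) > 0"
    and i2g: "\<forall>p\<in>set (b # X' @ u # Y' @ [l]). \<forall>q\<in>set (b # X' @ u # Y' @ [l]). ne2 p q \<longrightarrow> D i2 p q \<noteq> 0"
begin

definition "AA = z # i2 # b # X'"
definition "BB = u # Y' @ [l]"
definition "GA = steps (b # X' @ [u])"
definition "GB = steps (u # Y' @ [l])"

lemma E0_split: "E0 = GA \<union> GB"
  using pe_append[of "b # X'" u "Y' @ [l]"] by (simp add: E0_def GA_def GB_def)

lemma kz: "\<kappa> *\<^sub>R z = u" using ee by (simp add: z_def)

lemma gsetW: "generic (insert i2 (set (b # X' @ u # Y' @ [l])))"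
proof (rule gset_insert)
  show "generic (set (b # X' @ u # Y' @ [l]))" using gen_pos unfolding gen_pos_def by (auto intro: gset_mono)
qed (use i2g in blast)

lemma ne_i2: assumes "p \<in> set (b # X' @ u # Y' @ [l])" shows "ne2 i2 p"
proof -
  have "\<exists>q\<in>set (b # X' @ u # Y' @ [l]). ne2 p q"
  proof (cases "p = u")
    case True then show ?thesis using ne_ab ne2_sym[of u b] by auto
  next
    case False
    then have "ne2 p u" using assms ne_XY[of p] ne_ab ne2_sym[of u p] ne2_sym[of u l] by auto
    then show ?thesis by auto
  qed
  then obtain q where "q \<in> set (b # X' @ u # Y' @ [l])" "ne2 p q" by blast
  then have "D i2 p q \<noteq> 0" using i2g assms by blast
  then show ?thesis by (auto simp: ne2_def)
qed

lemma gpA: "gen_pos AA"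
proof -
  have "generic (insert i2 (set (b # X' @ u # Y' @ [l])) \<union> uminus ` insert i2 (set (b # X' @ u # Y' @ [l])))"
    by (rule gset_neg[OF gsetW])
  moreover have "set AA \<subseteq> insert i2 (set (b # X' @ u # Y' @ [l])) \<union> uminus ` insert i2 (set (b # X' @ u # Y' @ [l]))"
  proof -
    have "z = u \<or> z = - u" using k by (auto simp: z_def)
    then show ?thesis unfolding AA_def by auto
  qed
  ultimately have 1: "generic (set AA)" by (rule gset_mono)
  have "pairwise_ne2 (b # X')" using sd by (simp add: sdist_append)
  moreover have "ne2 z y" if "y \<in> set (i2 # b # X')" for y
    using that k ne_i2[of u] ne_ab ne_XY[of y] ne2_sym[of i2 u] ne2_sym[of u b] by (auto simp: z_def)
  moreover have "ne2 i2 y" if "y \<in> set (b # X')" for y using that ne_i2 by auto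
  ultimately have "pairwise_ne2 AA" by (simp add: AA_def)
  then show ?thesis using 1 by (simp add: gen_pos_def AA_def)
qed

lemma gpB: "gen_pos BB"
proof -
  have "length BB \<ge> 3" using Yne by (simp add: BB_def Suc_le_eq)
  moreover have "pairwise_ne2 BB" using sd by (simp add: sdist_append BB_def)
  moreover have "generic (set BB)" using gen_pos unfolding gen_pos_def by (auto intro: gset_mono simp: BB_def)
  ultimately show ?thesis by (simp add: gen_pos_def)
qed

lemma E0_mem: "(r,s) \<in> E0 \<Longrightarrow> r \<in> {b,u,l} \<union> set X' \<union> set Y' \<and> s \<in> {b,u,l} \<union> set X' \<union> set Y' \<and> ne2 r s"
  using pe_set[of r s "b # X' @ u # Y' @ [l]"] pe_distinct[of "b # X' @ u # Y' @ [l]" r s] sd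
  by (auto simp: E0_def)

text \<open>For shortcuts inside the closed swept region, such as cz and z i2. Edges ending at u or
  l have to be treated separately, as these points are on the border plane cz up to sign.\<close>

lemma region_free:
  assumes u1: "D u1 a b \<ge> 0" "D c u1 b \<ge> 0" "D c a u1 \<ge> 0" "D c z u1 \<le> 0"
    and u2: "D u2 a b \<ge> 0" "D c u2 b \<ge> 0" "D c a u2 \<ge> 0" "D c z u2 \<le> 0"
    and u12: "D u1 a b > 0 \<or> D u2 a b > 0" "D c u1 b > 0 \<or> D c u2 b > 0" "D c a u1 > 0 \<or> D c a u2 > 0"
    and rs: "(r,s) \<in> E0" "r \<in> insert b (set X' \<union> set Y')" "s \<in> insert b (set X' \<union> set Y')"
  shows "\<not> X u1 u2 r s"
proof
  assume X: "X u1 u2 r s"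
  have nrs: "ne2 r s" using E0_mem[OF rs(1)] by simp
  have ninT: "\<not> in_swept c a b z x \<and> \<not> in_swept c a b z (-x)" if "x \<in> set X' \<union> set Y'" for x
    using free that unfolding swept_free_def by blast
  consider "r = b" "s \<in> set X' \<union> set Y'" | "s = b" "r \<in> set X' \<union> set Y'" | "r \<in> set X' \<union> set Y'" "s \<in> set X' \<union> set Y'"
    using rs nrs by auto
  then have "X c a r s \<or> X a b r s"
  proof cases
    case 1
    have "X c a b s" using X 1 ninT[OF 1(2)] nzXY[OF 1(2)]
      by (intro slide_exit_b[OF D zk(2,3) u1 u2 u12]) auto
    then show ?thesis using 1 by simp
  next
    case 2
    have "X c a b r" using X 2 ninT[OF 2(2)] nzXY[OF 2(2)]
      by (intro slide_exit_b[OF D zk(2,3) u1 u2 u12]) (auto simp: X_swap)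
    then show ?thesis using 2 by (simp add: X_swap)
  next
    case 3
    have "D a r s \<noteq> 0" using 3 nrs ne_XY[OF 3(1)] ne_XY[OF 3(2)] by (intro gnz) auto
    show ?thesis
      by (rule slide_exit[OF D less_imp_le[OF zk(2)] zk(3) u1 u2 u12(1) u12(3) X
           conjunct1[OF ninT[OF 3(1)]] conjunct1[OF ninT[OF 3(2)]] conjunct2[OF ninT[OF 3(1)]] conjunct2[OF ninT[OF 3(2)]]
           nzXY(1)[OF 3(1)] nzXY(2)[OF 3(1)] nzXY(1)[OF 3(2)] nzXY(2)[OF 3(2)] \<open>D a r s \<noteq> 0\<close> disjI1[OF nzXY(3)[OF 3(1)]]])
  qed
  then show False using nab nca rs by blast
qed

lemma inR: "D c c b = 0" "D c a c = 0" "D c z a = - D c a z" "D i2 a b = 0" "D c i2 b = D c a b" "D c a i2 = \<rho> * D c a b"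
  by (simp_all add: i2 D_coord algebra_simps)

lemma cz_free: assumes "(r,s) \<in> E0" shows "\<not> X c z r s"
proof (cases "r \<in> {u,l} \<or> s \<in> {u,l}")
  case True then show ?thesis using e k by (auto simp: c_def z_def)
next
  case False
  then have "r \<in> insert b (set X' \<union> set Y')" "s \<in> insert b (set X' \<union> set Y')" using E0_mem[OF assms] by auto
  then show ?thesis using D zk by (intro region_free[OF _ _ _ _ _ _ _ _ _ _ _ assms]) (auto simp: inR)
qed

lemma zi_free: assumes "(r,s) \<in> GA" shows "\<not> X z i2 r s"
proof (cases "r = u \<or> s = u")
  case True then show ?thesis using e k by (auto simp: z_def)
next
  case False
  have rs: "(r,s) \<in> E0" using assms E0_split by auto
  have "r \<in> insert b (set X' \<union> set Y')" "s \<in> insert b (set X' \<union> set Y')" using pe_set[of r s "b # X' @ [u]"] False assms by (auto simp: GA_def)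
  then show ?thesis using D zk rho i2c by (intro region_free[OF _ _ _ _ _ _ _ _ _ _ _ rs]) (auto simp: inR)
qed

lemma ib_free: assumes "(r,s) \<in> E0" shows "\<not> X i2 b r s"
  using X_subsegment[OF rho] nab[OF assms] by (auto simp: i2)

lemma edgA: "edges \<kappa> AA = {(z,i2)} \<union> {(i2,b)} \<union> GA"
  using kz by (auto simp: edges_def AA_def GA_def)

lemma edgB: "edges (e * \<kappa>) BB = GB \<union> {(l, e *\<^sub>R z)}"
  using pe_append[of "u # Y'" l "[(e * \<kappa>) *\<^sub>R u]"] by (simp add: edges_def BB_def GB_def z_def)

lemma simpleA: "simple \<kappa> AA"
proof -
  have 1: "noX GA GA" using nE0 E0_split by (auto intro: noX_mono)
  have 2: "noX {(z,i2)} GA" "noX {(i2,b)} GA" using zi_free ib_free E0_split by (auto simp: noX_def)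
  then have 3: "noX GA {(z,i2)}" "noX GA {(i2,b)}" using noX_sym by blast+
  have 4: "noX {(z,i2)} {(i2,b)}" "noX {(i2,b)} {(z,i2)}" "noX {(z,i2)} {(z,i2)}" "noX {(i2,b)} {(i2,b)}" by (auto simp: noX_def)
  show ?thesis unfolding simple_def edgA noX_Un using 1 2 3 4 by blast
qed

lemma simpleB: "simple (e * \<kappa>) BB"
proof -
  have 1: "noX GB GB" using nE0 E0_split by (auto intro: noX_mono)
  have "noX {(l, e *\<^sub>R z)} GB" using cz_free Xc E0_split by (auto simp: noX_def)
  moreover have "noX GB {(l, e *\<^sub>R z)}" using calculation noX_sym by blast
  moreover have "noX {(l, e *\<^sub>R z)} {(l, e *\<^sub>R z)}" by (auto simp: noX_def)
  ultimately show ?thesis unfolding simple_def edgB noX_Un using 1 by blast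
qed

definition "TX = tri (a # b # X' @ [u])"
definition "TY = tri (u # Y' @ [l, e *\<^sub>R a])"
definition "dj \<longleftrightarrow> D prev u nxt > 0"

lemma split_prev: obtains W where "b # X' = W @ [prev]"
  unfolding prev_def by (metis append_butlast_last_id list.distinct(1))
lemma tri_nxt: "tri (x # u # Y' @ w) = (D x u nxt > 0) # tri (u # Y' @ w)"
proof -
  have "Y \<noteq> [] \<Longrightarrow> tri (x # u # Y @ w) = (D x u (hd (Y @ [l])) > 0) # tri (u # Y @ w)" for Y
    by (cases Y) auto
  then show ?thesis using Yne unfolding nxt_def by blast
qed

lemma infl_ps: "inflections e (a # b # X' @ u # Y' @ [l]) = changes (True # TX @ [dj] @ TY @ [flip_sign e True])"
proof -
  obtain W where W: "b # X' = W @ [prev]" by (rule split_prev)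
  have eq1: "a # b # X' @ u # Y' @ [l, e *\<^sub>R a] = (a # W) @ prev # u # Y' @ [l, e *\<^sub>R a]"
    using W by (metis append.assoc append_Cons append_Nil)
  have eq2: "a # b # X' @ [u] = (a # W) @ [prev, u]" using W by (metis append.assoc append_Cons append_Nil)
  have "tri (a # b # X' @ u # Y' @ [l, e *\<^sub>R a]) = TX @ tri (prev # u # Y' @ [l, e *\<^sub>R a])"
    unfolding TX_def eq1 eq2 by (rule tri_append)
  moreover have "tri (prev # u # Y' @ [l, e *\<^sub>R a]) = dj # TY" unfolding dj_def TY_def by (rule tri_nxt)
  ultimately have "tri (a # b # X' @ u # Y' @ [l, e *\<^sub>R a]) = TX @ dj # TY" by simp
  moreover have "turn_signs e (a # b # X' @ u # Y' @ [l]) = (D c a b > 0) # tri (a # b # X' @ u # Y' @ [l, e *\<^sub>R a])"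
    by (simp add: turn_signs_def c_def)
  ultimately show ?thesis using D by (simp add: inflections_def)
qed

text \<open>The loop turns left at z and at i2; from b on it has the signs of the polygon, since i2
  lies on the edge ab.\<close>

lemma infl_A: "inflections \<kappa> AA = changes (True # TX @ [flip_sign \<kappa> True])"
proof -
  have "D z i2 b > 0" using zk by (simp add: i2)
  moreover have "tri (i2 # b # xs) = tri (a # b # xs)" for xs by (cases xs) (auto simp: i2)
  then have "tri (i2 # b # X' @ [u]) = TX" unfolding TX_def by simp
  moreover have "last AA = prev" by (simp add: AA_def prev_def)
  ultimately have "turn_signs \<kappa> AA = True # True # TX" using i2p kz by (simp add: turn_signs_def AA_def)
  then show ?thesis by (simp add: inflections_def)
qed

text \<open>The loop turns at u as \<open>nxt_pos\<close> says. Only the sign at l may differ from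
  that of the polygon, and by \<open>corner_prev\<close> it can only change to the closing
  sign.\<close>

lemma infl_B: "inflections (e * \<kappa>) BB \<le> changes (flip_sign \<kappa> True # TY @ [flip_sign e True])"
proof -
  obtain Y'' y where Y: "Y' = Y'' @ [y]" using Yne by (metis append_butlast_last_id)
  have yin: "y \<in> set Y'" "y \<in> set X' \<union> set Y'" by (auto simp: Y)
  define T0 where "T0 = tri (u # Y' @ [l])"
  have T0: "T0 \<noteq> []" using length_tri[of "u # Y' @ [l]"] Yne by (auto simp: T0_def)
  have tr: "tri (u # Y' @ [l, x]) = T0 @ [D y l x > 0]" for x
    using tri_append[of "u # Y''" y l "[x]"] by (simp add: T0_def Y)
  define x2 where "x2 \<longleftrightarrow> D (e *\<^sub>R y) c a > 0"
  define x2' where "x2' \<longleftrightarrow> D (e *\<^sub>R y) c z > 0"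
  have e2: "(D y l (e *\<^sub>R a) > 0) = flip_sign e x2" "(D y l (e *\<^sub>R z) > 0) = flip_sign e x2'"
    using e nzXY[OF yin(2)] by (auto simp: x2_def x2'_def c_def flip_sign_def)
  have "(y, l) \<in> E0" using pe_append[of "b # X' @ u # Y''" y "[l]"] unfolding E0_def using Y by auto
  then have nX: "\<not> X a b (e *\<^sub>R y) c" using nab[of y l] X_neg(2)[of a b y l] e by (auto simp: c_def)
  have "(e *\<^sub>R y) = y \<or> (e *\<^sub>R y) = - y" using e by auto
  then have fr: "\<not> in_swept c a b z (e *\<^sub>R y)" using free yin by (auto simp: swept_free_def)
  have imp: "x2 \<longrightarrow> x2'" unfolding x2_def x2'_def
    using corner_prev[OF D _ zk(3) fr nX] zk nzXY[OF yin(2)] e by auto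
  have "D (\<kappa> *\<^sub>R c) u nxt = \<kappa> * D c z (\<kappa> *\<^sub>R nxt)" using ee by (simp add: z_def)
  then have "(D (\<kappa> *\<^sub>R c) u nxt > 0) = flip_sign \<kappa> True" using nxt_pos[OF Yne] k by (auto simp: flip_sign_def)
  then have "turn_signs (e * \<kappa>) BB = flip_sign \<kappa> True # tri (u # Y' @ [l, e *\<^sub>R z])"
    unfolding turn_signs_def BB_def using tri_nxt[of "\<kappa> *\<^sub>R c" "[l, e *\<^sub>R z]"] by (simp add: c_def z_def mult.commute)
  then have s: "turn_signs (e * \<kappa>) BB = flip_sign \<kappa> True # T0 @ [flip_sign e x2']" by (simp only: tr e2)
  have "flip_sign (e * \<kappa>) (flip_sign \<kappa> True) = flip_sign e True" using e k by (auto simp: flip_sign_def)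
  then have "inflections (e * \<kappa>) BB = changes (flip_sign \<kappa> True # T0 @ [flip_sign e x2', flip_sign e True])" by (simp add: inflections_def s)
  also have "\<dots> \<le> changes (flip_sign \<kappa> True # T0 @ [flip_sign e x2, flip_sign e True])" by (rule ch_mono_last[OF T0 imp])
  also have "T0 @ [flip_sign e x2, flip_sign e True] = TY @ [flip_sign e True]" by (simp only: TY_def tr e2 append_assoc append.simps)
  finally show ?thesis .
qed

text \<open>The polygon turns at u as the loop BB does, so cutting its sign list at u gives the
  lists of both loops.\<close>

lemma infl_same: assumes "dj = flip_sign \<kappa> True" shows "inflections \<kappa> AA + inflections (e * \<kappa>) BB \<le> inflections e (a # b # X' @ u # Y' @ [l])"
proof -
  have "changes (True # TX @ [dj] @ TY @ [flip_sign e True]) = changes (True # TX @ [dj]) + changes (dj # TY @ [flip_sign e True])"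
    using ch_append[of "True # TX" dj "TY @ [flip_sign e True]"] by simp
  then show ?thesis using infl_B infl_A infl_ps assms by simp
qed

lemma ch_flip_last: "changes (x # T @ [y]) \<le> changes (x # T @ [y']) + 1"
proof -
  have "\<exists>W t. x # T = W @ [t]" by (metis append_butlast_last_id list.distinct(1))
  then obtain W t where W: "x # T = W @ [t]" by blast
  have "changes (x # T @ [w]) = changes (W @ [t]) + changes [t, w]" for w
    using ch_append[of W t "[w]"] W by (metis append.assoc append_Cons append_Nil)
  then show ?thesis by simp
qed

lemma ch_flip_first: "changes (y # T @ [x]) \<le> changes (y' # T @ [x]) + 1"
  by (cases T) auto

lemma ch_pos: "x \<noteq> y \<Longrightarrow> changes (x # T @ [y]) \<ge> 1"
  using ch_parity[of "x # T @ [y]"] by (cases "changes (x # T @ [y])") auto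

text \<open>A wrong sign at the cut costs at most one change in each part. For a single loop this is
  absorbed whenever the other part of the list has different end signs and so contains a
  change.\<close>

lemma infl_opp:
  assumes "dj \<noteq> flip_sign \<kappa> True"
  shows "inflections \<kappa> AA \<le> inflections e (a # b # X' @ u # Y' @ [l]) + (if \<kappa> = e then 0 else 1)"
    and "inflections (e * \<kappa>) BB \<le> inflections e (a # b # X' @ u # Y' @ [l]) + (if \<kappa> = 1 then 0 else 1)"
    and "inflections \<kappa> AA + inflections (e * \<kappa>) BB \<le> inflections e (a # b # X' @ u # Y' @ [l]) + 2"
proof -
  have F: "inflections e (a # b # X' @ u # Y' @ [l]) = changes (True # TX @ [dj]) + changes (dj # TY @ [flip_sign e True])"
    using ch_append[of "True # TX" dj "TY @ [flip_sign e True]"] infl_ps by simp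
  have 1: "inflections \<kappa> AA \<le> changes (True # TX @ [dj]) + 1" using infl_A ch_flip_last[of True TX "flip_sign \<kappa> True" dj] by simp
  have 2: "inflections (e * \<kappa>) BB \<le> changes (dj # TY @ [flip_sign e True]) + 1"
    using infl_B ch_flip_first[of "flip_sign \<kappa> True" TY "flip_sign e True" dj] by linarith
  have 3: "changes (dj # TY @ [flip_sign e True]) \<ge> 1" if "\<kappa> = e" using that assms e k by (intro ch_pos) auto
  have 4: "changes (True # TX @ [dj]) \<ge> 1" if "\<kappa> = 1" using that assms by (intro ch_pos) auto
  show "inflections \<kappa> AA \<le> inflections e (a # b # X' @ u # Y' @ [l]) + (if \<kappa> = e then 0 else 1)" using 1 3 F by auto
  show "inflections (e * \<kappa>) BB \<le> inflections e (a # b # X' @ u # Y' @ [l]) + (if \<kappa> = 1 then 0 else 1)" using 2 4 F by auto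
  show "inflections \<kappa> AA + inflections (e * \<kappa>) BB \<le> inflections e (a # b # X' @ u # Y' @ [l]) + 2" using 1 2 F by simp
qed

end

lemma (in slide) slide2_exists:
  assumes "Y' \<noteq> []"
  obtains \<rho> i2 where "slide2 e \<kappa> a b u l X' Y' c z \<rho> i2"
proof -
  obtain \<rho> where r: "\<rho>>0" "D c z (a + \<rho> *\<^sub>R b) < 0" "D (\<kappa> *\<^sub>R prev) z (a + \<rho> *\<^sub>R b) > 0" "D z (a + \<rho> *\<^sub>R b) (\<kappa> *\<^sub>R nxt) > 0"
    "\<forall>p\<in>set (b # X' @ u # Y' @ [l]). \<forall>q\<in>set (b # X' @ u # Y' @ [l]). ne2 p q \<longrightarrow> D (a + \<rho> *\<^sub>R b) p q \<noteq> 0"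
    using ex_rho[OF assms] by blast
  have "slide2 e \<kappa> a b u l X' Y' c z \<rho> (a + \<rho> *\<^sub>R b)"
    by unfold_locales (use r assms in auto)
  then show ?thesis using that by blast
qed

subsection \<open>Centrally symmetric polygons\<close>

lemma rot_back:
  assumes "gen_pos (rot1 e L)" "unit_sign e" "L \<noteq> []"
  shows "gen_pos L" "simple e (rot1 e L) = simple e L" "inflections e (rot1 e L) = inflections e L"
proof -
  obtain x xs where L: "L = x # xs" using assms(3) by (cases L) auto
  have pw: "(rot1 e ^^ length xs) (rot1 e L) = map (\<lambda>y. e *\<^sub>R y) L"
    using rot1_pow_append[where e=e and us=xs and vs="[e *\<^sub>R x]"] by (simp add: L rot1_def)
  have *: "gen_pos (map (\<lambda>y. e *\<^sub>R y) L)" "simple e (map (\<lambda>y. e *\<^sub>R y) L) = simple e (rot1 e L)"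
     "inflections e (map (\<lambda>y. e *\<^sub>R y) L) = inflections e (rot1 e L)"
    using rot1_pow[OF assms(1,2), of "length xs"] unfolding pw by blast+
  have "gen_pos L \<and> simple e (rot1 e L) = simple e L \<and> inflections e (rot1 e L) = inflections e L"
    using assms(2)
  proof
    assume "e = 1" then show ?thesis using * by simp
  next
    assume e: "e = -1"
    then have m: "map (\<lambda>y. e *\<^sub>R y) L = map uminus L" by simp
    have "gen_pos (map uminus (map uminus L))" using *(1) unfolding m by (rule gp_uminus)
    then have g: "gen_pos L" by (simp add: o_def)
    show ?thesis using * g simple_uminus[OF assms(3)] infl_uminus[OF g assms(2)] unfolding m by simp
  qed
  then show "gen_pos L" "simple e (rot1 e L) = simple e L" "inflections e (rot1 e L) = inflections e L" by blast+
qed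

context slide begin

text \<open>The list starts one step earlier, with c at the head, in the form that
  \<open>delete_vertex\<close> needs to remove c.\<close>

lemma degenerate_delete:
  assumes "Y' = []"
  defines "L \<equiv> c # a # (b # X') @ [u]"
  shows "gen_pos L" "simple e L" "inflections e L = inflections e (a # b # X' @ u # Y' @ [l])" "rot1 e L = a # b # X' @ u # Y' @ [l]"
    "D (e *\<^sub>R u) c a > 0" "swept_free (e *\<^sub>R u) c a a (set (b # X'))"
proof -
  have ez: "e *\<^sub>R u = z" using degenerate(1)[OF assms(1)] by (simp add: z_def)
  show r: "rot1 e L = a # b # X' @ u # Y' @ [l]" using assms(1) ee by (simp add: L_def rot1_def c_def)
  have Ln: "L \<noteq> []" by (simp add: L_def)
  show "gen_pos L" by (rule rot_back(1)[of e L]) (use gen_pos e Ln in \<open>simp_all add: r\<close>)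
  have "gen_pos (rot1 e L)" using gen_pos r by simp
  then show "simple e L" "inflections e L = inflections e (a # b # X' @ u # Y' @ [l])"
    using Ln rot_back(2,3)[of e L] e sim r by simp_all
  show "D (e *\<^sub>R u) c a > 0" "swept_free (e *\<^sub>R u) c a a (set (b # X'))"
    unfolding ez using degenerate(2,3)[OF assms(1)] by auto
qed

end

text \<open>AA closes with \<kappa> and BB with -\<kappa>, so exactly one loop closes antipodally;
  it is shorter and has no more inflections than the polygon. Three vertices have the signs True,
  False, True and the closing sign False.\<close>

theorem moebius: "gen_pos ps \<Longrightarrow> simple (-1) ps \<Longrightarrow> 3 \<le> inflections (-1) ps"
proof (induction "length ps" arbitrary: ps rule: less_induct)
  case less
  let ?e = "-1 :: real"
  have u1: "unit_sign ?e" by simp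
  have main: "3 \<le> inflections ?e ps" if gen_pos: "gen_pos ps" and s: "simple ?e ps" and ps: "ps = a # b # M @ [l]" and D: "D (?e *\<^sub>R l) a b > 0"
      and IH: "\<And>qs. length qs < length ps \<Longrightarrow> gen_pos qs \<Longrightarrow> simple ?e qs \<Longrightarrow> 3 \<le> inflections ?e qs" for ps a b M l
  proof (cases "M = []")
    case True
    have "D (-l) a b = - D a b l" "D b l (-a) = - D a b l" by (simp_all add: D_coord algebra_simps)
    then have "turn_signs ?e ps = [True, False, True]" using D by (simp add: turn_signs_def ps True)
    then show ?thesis by (simp add: inflections_def)
  next
    case M: False
    show ?thesis
    proof (cases "swept_free (?e *\<^sub>R l) a b b (set M)")
      case True
      show ?thesis using delete_vertex[OF gen_pos[unfolded ps] M _ s[unfolded ps] D True] IH[of "b # M @ [l]"]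
        by (simp add: ps)
    next
      case False
      obtain X' u Y' \<kappa> where MX: "M = X' @ u # Y'" and sl: "slide ?e \<kappa> a b u l X' Y' (?e *\<^sub>R l) (\<kappa> *\<^sub>R u)"
        using obstacle[OF gen_pos[unfolded ps] u1 s[unfolded ps] D False] by blast
      interpret slide ?e \<kappa> a b u l X' Y' "?e *\<^sub>R l" "\<kappa> *\<^sub>R u" by (rule sl)
      show ?thesis
      proof (cases "Y' = []")
        case True
        note d = degenerate_delete[OF True]
        show ?thesis using delete_vertex[OF d(1) _ _ d(2) d(5,6)] d(3) IH[of "a # (b # X') @ [u]"]
          by (simp add: ps MX True)
      next
        case Y: False
        obtain \<rho> i2 where "slide2 ?e \<kappa> a b u l X' Y' (?e *\<^sub>R l) (\<kappa> *\<^sub>R u) \<rho> i2" using slide2_exists[OF Y] .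
        then interpret slide2 ?e \<kappa> a b u l X' Y' "?e *\<^sub>R l" "\<kappa> *\<^sub>R u" \<rho> i2 .
        have F: "inflections \<kappa> AA \<le> inflections ?e ps" if "\<kappa> = -1" using infl_same infl_opp(1) that unfolding ps MX by fastforce
        have G: "inflections (?e * \<kappa>) BB \<le> inflections ?e ps" if "\<kappa> = 1" using infl_same infl_opp(2) that unfolding ps MX by fastforce
        show ?thesis using k
        proof
          assume "\<kappa> = 1"
          then show ?thesis using G gpB simpleB IH[of BB] unfolding ps MX by (simp add: BB_def)
        next
          assume k: "\<kappa> = -1"
          have lenA: "length AA < length ps" unfolding ps MX AA_def by simp
          have "3 \<le> inflections \<kappa> AA" using IH[OF lenA gpA] simpleA by (simp add: k)
          then show ?thesis using F k by linarith
        qed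
      qed
    qed
  qed
  obtain a b M l where ps: "ps = a # b # M @ [l]" using gp_list[OF less(2)] .
  have "D (?e *\<^sub>R l) a b \<noteq> 0" using nzt_cyc[OF less(2), of ?e] by (simp add: ps)
  \<comment> \<open>Passing to the antipodal polygon makes the first turn positive.\<close>
  then consider "D (?e *\<^sub>R l) a b > 0" | "D (?e *\<^sub>R (-l)) (-a) (-b) > 0" by fastforce
  then show ?case
  proof cases
    case 1 then show ?thesis using main[OF less(2,3) ps 1] less(1) by blast
  next
    case 2
    have "3 \<le> inflections ?e (map uminus ps)"
    proof (rule main[OF _ _ _ 2])
      show "gen_pos (map uminus ps)" using less(2) by (rule gp_uminus)
      show "simple ?e (map uminus ps)" using less(3) simple_uminus[of ps] ps by simp
      show "map uminus ps = - a # - b # map uminus M @ [- l]" by (simp add: ps)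
    qed (use less(1) in simp)
    then show ?thesis using infl_uminus[OF less(2)] by simp
  qed
qed

subsection \<open>Parity of crossings\<close>

text \<open>\<open>inside C w\<close> is the parity of the crossings of C with the arc from the first vertex of C to w,
  corrected by whether this arc starts in the sector \<open>left_sector\<close> to the left of C. It says on which side of
  C the point w lies, without reference to the Jordan curve theorem.\<close>

fun crossing_parity :: "real^3 \<Rightarrow> real^3 \<Rightarrow> (real^3) list \<Rightarrow> bool" where
  "crossing_parity c w (p # q # r) = (Y c w p q \<noteq> crossing_parity c w (q # r))"
| "crossing_parity c w _ = False"

definition left_sector :: "real^3 \<Rightarrow> real^3 \<Rightarrow> real^3 \<Rightarrow> real^3 \<Rightarrow> bool" where
  "left_sector p c q w = (if D p c q > 0 then D p c w > 0 \<and> D c q w > 0 else D p c w > 0 \<or> D c q w > 0)"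

definition inside :: "(real^3) list \<Rightarrow> real^3 \<Rightarrow> bool" where
  "inside C w = (crossing_parity (hd C) w (tl C) \<noteq> left_sector (last C) (hd C) (hd (tl C)) w)"

text \<open>The factor \<open>D a b c\<close> makes the condition independent of the orientation of
  the triangle.\<close>

definition in_triangle :: "real^3 \<Rightarrow> real^3 \<Rightarrow> real^3 \<Rightarrow> real^3 \<Rightarrow> bool" where
  "in_triangle a b c p \<longleftrightarrow> D a b c * D p b c > 0 \<and> D a b c * D a p c > 0 \<and> D a b c * D a b p > 0"

section \<open>Parity of the crossings of a segment with a triangle\<close>

lemma sum3_signs:
  fixes x y z a b c :: real
  assumes "x * a + y * b + z * c = 0" "x \<noteq> 0" "y \<noteq> 0" "z \<noteq> 0" "a \<noteq> 0" "b \<noteq> 0" "c \<noteq> 0"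
  shows "\<not> (((x > 0) = (a > 0)) \<and> ((y > 0) = (b > 0)) \<and> ((z > 0) = (c > 0)))"
    "\<not> (((x > 0) \<noteq> (a > 0)) \<and> ((y > 0) \<noteq> (b > 0)) \<and> ((z > 0) \<noteq> (c > 0)))"
proof -
  have s: "(x * a > 0) = ((x > 0) = (a > 0))" "(y * b > 0) = ((y > 0) = (b > 0))" "(z * c > 0) = ((z > 0) = (c > 0))"
    using assms(2-) by (auto simp: zero_less_mult_iff)
  have n: "x * a \<noteq> 0" "y * b \<noteq> 0" "z * c \<noteq> 0" using assms by auto
  show "\<not> (((x > 0) = (a > 0)) \<and> ((y > 0) = (b > 0)) \<and> ((z > 0) = (c > 0)))"
    unfolding s[symmetric] using assms(1) by linarith
  have "\<not> (\<not> x * a > 0 \<and> \<not> y * b > 0 \<and> \<not> z * c > 0)" using assms(1) n by linarith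
  then show "\<not> (((x > 0) \<noteq> (a > 0)) \<and> ((y > 0) \<noteq> (b > 0)) \<and> ((z > 0) \<noteq> (c > 0)))"
    unfolding s by blast
qed

lemma diff_signs:
  fixes x y z w t d :: real
  assumes "d * t = x * y - z * w" "d > 0" "x \<noteq> 0" "y \<noteq> 0" "z \<noteq> 0" "w \<noteq> 0"
  shows "(x > 0) = (y > 0) \<Longrightarrow> (z > 0) \<noteq> (w > 0) \<Longrightarrow> t > 0"
    "(x > 0) \<noteq> (y > 0) \<Longrightarrow> (z > 0) = (w > 0) \<Longrightarrow> \<not> t > 0"
proof -
  have s: "(x * y > 0) = ((x > 0) = (y > 0))" "(z * w > 0) = ((z > 0) = (w > 0))"
    using assms(3-) by (auto simp: zero_less_mult_iff)
  have n: "x * y \<noteq> 0" "z * w \<noteq> 0" using assms by auto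
  have t: "t > 0 \<longleftrightarrow> x * y - z * w > 0" using assms(1,2) by (metis zero_less_mult_pos mult_pos_pos)
  show "(x > 0) = (y > 0) \<Longrightarrow> (z > 0) \<noteq> (w > 0) \<Longrightarrow> t > 0" using s n t by linarith
  show "(x > 0) \<noteq> (y > 0) \<Longrightarrow> (z > 0) = (w > 0) \<Longrightarrow> \<not> t > 0" using s n t by linarith
qed

text \<open>P1, P2, P3 and Q1, Q2, Q3 are the coordinate signs of p and q with respect to a, b, c,
  and A, B, C the signs of \<open>D a p q\<close>, \<open>D b p q\<close>, \<open>D c p q\<close>.
  The hypotheses are what \<open>sum3_signs\<close> and \<open>diff_signs\<close> yield; the rest is
  a check of cases.\<close>

lemma cocycle_bool:
  assumes "\<not> ((P1 = A) \<and> (P2 = B) \<and> (P3 = C))" "\<not> ((P1 \<noteq> A) \<and> (P2 \<noteq> B) \<and> (P3 \<noteq> C))"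
    and "\<not> ((Q1 = A) \<and> (Q2 = B) \<and> (Q3 = C))" "\<not> ((Q1 \<noteq> A) \<and> (Q2 \<noteq> B) \<and> (Q3 \<noteq> C))"
    and "P2 = Q3 \<Longrightarrow> P3 \<noteq> Q2 \<Longrightarrow> A" "P2 \<noteq> Q3 \<Longrightarrow> P3 = Q2 \<Longrightarrow> \<not> A"
    and "P3 = Q1 \<Longrightarrow> P1 \<noteq> Q3 \<Longrightarrow> B" "P3 \<noteq> Q1 \<Longrightarrow> P1 = Q3 \<Longrightarrow> \<not> B"
    and "P1 = Q2 \<Longrightarrow> P2 \<noteq> Q1 \<Longrightarrow> C" "P1 \<noteq> Q2 \<Longrightarrow> P2 = Q1 \<Longrightarrow> \<not> C"
  shows "((B \<and> \<not> A \<and> \<not> Q3 \<and> P3 \<or> \<not> B \<and> A \<and> Q3 \<and> \<not> P3) \<noteq>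
          ((C \<and> \<not> B \<and> \<not> Q1 \<and> P1 \<or> \<not> C \<and> B \<and> Q1 \<and> \<not> P1) \<noteq>
           (A \<and> \<not> C \<and> \<not> Q2 \<and> P2 \<or> \<not> A \<and> C \<and> Q2 \<and> \<not> P2))) = ((P1 \<and> P2 \<and> P3) \<noteq> (Q1 \<and> Q2 \<and> Q3))"
  using assms by (smt (verit))

text \<open>The exceptions are needed because the triangles used later have antipodes of polygon
  vertices among their corners b and c.\<close>

definition generic_point :: "real^3 \<Rightarrow> real^3 \<Rightarrow> real^3 \<Rightarrow> real^3 \<Rightarrow> bool" where
  "generic_point a b c p \<longleftrightarrow> (D p b c \<noteq> 0 \<and> D a p c \<noteq> 0 \<and> D a b p \<noteq> 0) \<or> p = - b \<or> p = - c"

lemma cocycle_gen_pos: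
  assumes D: "D a b c > 0"
   and p: "D p b c \<noteq> 0" "D a p c \<noteq> 0" "D a b p \<noteq> 0" and q: "D q b c \<noteq> 0" "D a q c \<noteq> 0" "D a b q \<noteq> 0"
   and pq: "D a p q \<noteq> 0" "D b p q \<noteq> 0" "D c p q \<noteq> 0"
  shows "(Y a b p q \<noteq> (Y b c p q \<noteq> Y a c p q)) = (in_triangle a b c p \<noteq> in_triangle a b c q)"
proof -
  have 1: "D a b c * D a p q = D a p c * D a b q - D a b p * D a q c"
    "D a b c * D b p q = D a b p * D q b c - D p b c * D a b q"
    "D a b c * D c p q = D p b c * D a q c - D a p c * D q b c" by (rule D_minor)+
  have 2: "D p b c * D a p q + D a p c * D b p q + D a b p * D c p q = 0"
    "D q b c * D a p q + D a q c * D b p q + D a b q * D c p q = 0" by (simp_all add: D_coord algebra_simps)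
  have n: "x < 0 \<longleftrightarrow> \<not> x > 0" if "x \<noteq> 0" for x :: real using that by linarith
  have e: "D b c p = D p b c" "D b c q = D q b c" "D a c p = - D a p c" "D a c q = - D a q c"
    by (simp_all add: D_coord algebra_simps)
  have Y1: "Y a b p q \<longleftrightarrow> (D b p q > 0 \<and> \<not> D a p q > 0 \<and> \<not> D a b q > 0 \<and> D a b p > 0 \<or> \<not> D b p q > 0 \<and> D a p q > 0 \<and> D a b q > 0 \<and> \<not> D a b p > 0)"
    unfolding Y_def n[OF pq(1)] n[OF pq(2)] n[OF p(3)] n[OF q(3)] by blast
  have Y2: "Y b c p q \<longleftrightarrow> (D c p q > 0 \<and> \<not> D b p q > 0 \<and> \<not> D q b c > 0 \<and> D p b c > 0 \<or> \<not> D c p q > 0 \<and> D b p q > 0 \<and> D q b c > 0 \<and> \<not> D p b c > 0)"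
    unfolding Y_def e n[OF pq(2)] n[OF pq(3)] n[OF p(1)] n[OF q(1)] by blast
  have Y3: "Y a c p q \<longleftrightarrow> (D a p q > 0 \<and> \<not> D c p q > 0 \<and> \<not> D a q c > 0 \<and> D a p c > 0 \<or> \<not> D a p q > 0 \<and> D c p q > 0 \<and> D a q c > 0 \<and> \<not> D a p c > 0)"
    unfolding Y_def e using pq p q by auto
  have I: "in_triangle a b c p \<longleftrightarrow> D p b c > 0 \<and> D a p c > 0 \<and> D a b p > 0" "in_triangle a b c q \<longleftrightarrow> D q b c > 0 \<and> D a q c > 0 \<and> D a b q > 0"
    using D by (simp_all add: in_triangle_def zero_less_mult_iff)
  note s = sum3_signs[OF 2(1) p pq] sum3_signs[OF 2(2) q pq]
  show ?thesis unfolding Y1 Y2 Y3 I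
    by (rule cocycle_bool[OF s diff_signs[OF 1(1) D p(2) q(3) p(3) q(2)] diff_signs[OF 1(2) D p(3) q(1) p(1) q(3)]
          diff_signs[OF 1(3) D p(1) q(2) p(2) q(1)]])
qed

lemma inn_swap: "in_triangle a c b p = in_triangle a b c p"
proof -
  have "D a c b = - D a b c" "D p c b = - D p b c" "D a p b = - D a b p" "D a c p = - D a p c"
    by (simp_all add: D_coord algebra_simps)
  then show ?thesis by (auto simp: in_triangle_def)
qed

lemma cocycle_spec_pos:
  assumes D: "D a b c > 0" and p: "p = - b \<or> p = - c"
  shows "(Y a b p q \<noteq> (Y b c p q \<noteq> Y a c p q)) = (in_triangle a b c p \<noteq> in_triangle a b c q)"
proof -
  have I: "in_triangle a b c q \<longleftrightarrow> D q b c > 0 \<and> D a q c > 0 \<and> D a b q > 0" for q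
    using D by (simp add: in_triangle_def zero_less_mult_iff)
  have e: "D a c b = - D a b c" "D a c q = - D a q c" "D b c q = D q b c" "D c b q = - D q b c" by (simp_all add: D_coord algebra_simps)
  have ni: "\<not> in_triangle a b c p" using p D by (auto simp: I e)
  show ?thesis using p
  proof
    assume pb: "p = - b"
    have "Y a c p q = in_triangle a b c q" unfolding Y_def I pb using D by (auto simp: e)
    moreover have "\<not> Y a b p q" "\<not> Y b c p q" unfolding pb by simp_all
    ultimately show ?thesis using ni by simp
  next
    assume pb: "p = - c"
    have "Y a b p q = in_triangle a b c q" unfolding Y_def I pb using D by (auto simp: e)
    moreover have "\<not> Y a c p q" "\<not> Y b c p q" unfolding pb by simp_all
    ultimately show ?thesis using ni by simp
  qed
qed

text \<open>Each crossing of a side exchanges inside and outside of the triangle. A negative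
  \<open>D a b c\<close> is reduced to a positive one by exchanging b and c.\<close>

lemma cocycle:
  assumes D: "D a b c \<noteq> 0" and ok: "generic_point a b c p" "generic_point a b c q"
   and pq: "p = - b \<or> p = - c \<or> q = - b \<or> q = - c \<or> (D a p q \<noteq> 0 \<and> D b p q \<noteq> 0 \<and> D c p q \<noteq> 0)"
  shows "(Y a b p q \<noteq> (Y b c p q \<noteq> Y a c p q)) = (in_triangle a b c p \<noteq> in_triangle a b c q)"
proof -
  have pos: "(Y a b p q \<noteq> (Y b c p q \<noteq> Y a c p q)) = (in_triangle a b c p \<noteq> in_triangle a b c q)"
    if D: "D a b c > 0" and ok: "generic_point a b c p" "generic_point a b c q"
     and pq: "p = - b \<or> p = - c \<or> q = - b \<or> q = - c \<or> (D a p q \<noteq> 0 \<and> D b p q \<noteq> 0 \<and> D c p q \<noteq> 0)" for b c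
  proof -
    consider "p = - b \<or> p = - c" | "q = -b \<or> q = -c"
      | "\<not> (p = - b \<or> p = - c)" "\<not> (q = -b \<or> q = -c)" "D a p q \<noteq> 0" "D b p q \<noteq> 0" "D c p q \<noteq> 0" using pq by blast
    then show ?thesis
    proof cases
      case 1 then show ?thesis by (rule cocycle_spec_pos[OF D])
    next
      case 2
      have "(Y a b q p \<noteq> (Y b c q p \<noteq> Y a c q p)) = (in_triangle a b c q \<noteq> in_triangle a b c p)" by (rule cocycle_spec_pos[OF D 2])
      then show ?thesis using Y_sym(2)[of _ _ p q] by auto
    next
      case 3
      then show ?thesis using ok by (intro cocycle_gen_pos[OF D]) (auto simp: generic_point_def)
    qed
  qed
  show ?thesis
  proof (cases "D a b c > 0")
    case True then show ?thesis using pos ok pq by blast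
  next
    case False
    then have D': "D a c b > 0" using D D_swap(2)[of a b c] by linarith
    have ok': "generic_point a c b p" "generic_point a c b q" using ok unfolding generic_point_def by (metis D_swap(2,3) neg_equal_0_iff_equal)+
    have "(Y a c p q \<noteq> (Y c b p q \<noteq> Y a b p q)) = (in_triangle a c b p \<noteq> in_triangle a c b q)"
      by (rule pos[OF D' ok']) (use pq in blast)
    then show ?thesis using Y_sym(1)[of c b p q] by (auto simp: inn_swap[of a b c])
  qed
qed

text \<open>Adding the cocycle relation modulo 2 along the path telescopes the right-hand
  side.\<close>

lemma path_cocycle:
  assumes "xs \<noteq> []" "\<And>p q. (p,q) \<in> steps xs \<Longrightarrow> (Y a b p q \<noteq> (Y b c p q \<noteq> Y a c p q)) = (in_triangle a b c p \<noteq> in_triangle a b c q)"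
  shows "(crossing_parity a b xs \<noteq> (crossing_parity b c xs \<noteq> crossing_parity a c xs)) = (in_triangle a b c (hd xs) \<noteq> in_triangle a b c (last xs))"
  using assms
proof (induction xs rule: steps.induct)
  case (1 x y zs)
  have "(Y a b x y \<noteq> (Y b c x y \<noteq> Y a c x y)) = (in_triangle a b c x \<noteq> in_triangle a b c y)" using 1(3) by auto
  moreover have "(crossing_parity a b (y#zs) \<noteq> (crossing_parity b c (y#zs) \<noteq> crossing_parity a c (y#zs))) = (in_triangle a b c y \<noteq> in_triangle a b c (last (y # zs)))"
    using 1 by auto
  ultimately show ?case by auto
qed auto

section \<open>Invariance of the side under moving target and base\<close>

lemma crp_False: "(\<And>p q. (p,q) \<in> steps xs \<Longrightarrow> \<not> Y c w p q) \<Longrightarrow> \<not> crossing_parity c w xs"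
  by (induction xs rule: steps.induct) auto

lemma crp_snoc: "xs \<noteq> [] \<Longrightarrow> crossing_parity c w (xs @ [y]) = (crossing_parity c w xs \<noteq> Y c w (last xs) y)"
  by (induction xs rule: steps.induct) auto

lemma crp_append: "crossing_parity c w (xs @ y # ys) = (crossing_parity c w (xs @ [y]) \<noteq> crossing_parity c w (y # ys))"
proof (induction xs rule: steps.induct)
  case ("2_2" v) then show ?case by (cases ys) auto
qed auto

text \<open>Together with \<open>sector_prev\<close> this compares the sectors at two consecutive
  bases c and d. Both contain the term \<open>D c d w > 0\<close>, which cancels in
  \<open>base_move\<close>; what remains are crossings with the edges at c and d and triangle
  terms.\<close>

lemma sector_next:
  assumes W: "D c d w \<noteq> 0" and x: "(D x d w \<noteq> 0 \<and> D c x w \<noteq> 0 \<and> D c d x \<noteq> 0) \<or> x = - w"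
  shows "left_sector c d x w = ((D c d w > 0) \<noteq> (in_triangle c d w x \<noteq> Y c w d x))"
  using x
proof
  assume x: "D x d w \<noteq> 0 \<and> D c x w \<noteq> 0 \<and> D c d x \<noteq> 0"
  have e: "D w d x = - D x d w" "D c w x = - D c x w" "D c w d = - D c d w" "D d x w = - D x d w" by (simp_all add: D_coord algebra_simps)
  show ?thesis using x W unfolding left_sector_def in_triangle_def Y_def e zero_less_mult_iff
    by (cases "D c d w > 0"; cases "D x d w > 0"; cases "D c x w > 0"; cases "D c d x > 0") auto
next
  assume x: "x = - w"
  show ?thesis using W unfolding x left_sector_def in_triangle_def Y_def by auto
qed

lemma sector_prev:
  assumes W: "D c d w \<noteq> 0" and y: "(D y d w \<noteq> 0 \<and> D c y w \<noteq> 0 \<and> D c d y \<noteq> 0) \<or> y = - w"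
  shows "left_sector y c d w = ((D c d w > 0) \<noteq> (in_triangle c d w y \<noteq> Y d w y c))"
  using y
proof
  assume y: "D y d w \<noteq> 0 \<and> D c y w \<noteq> 0 \<and> D c d y \<noteq> 0"
  have e: "D w y c = D c w y" "D c w y = - D c y w" "D d w c = D c d w" "D y c d = D c d y" "D y c w = - D c y w"
     "D d y c = - D c y d * -1 * -1" "D c y d = - D c d y" "D d w y = D y d w" by (simp_all add: D_coord algebra_simps)
  show ?thesis using y W unfolding left_sector_def in_triangle_def Y_def e zero_less_mult_iff
    by (cases "D c d w > 0"; cases "D y d w > 0"; cases "D c y w > 0"; cases "D c d y > 0") auto
next
  assume y: "y = - w"
  have e: "D w c d = D c d w" by (simp_all add: D_coord algebra_simps)
  show ?thesis using W unfolding y left_sector_def in_triangle_def Y_def by (auto simp: e)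
qed

lemma pe_sub: "steps xs \<subseteq> steps (us @ xs @ vs)"
proof -
  have a: "steps xs \<subseteq> steps (xs @ vs)" for xs vs :: "'a list"
  proof (induction xs rule: steps.induct)
    case (1 x y zs) then show ?case by auto
  qed auto
  have b: "steps ys \<subseteq> steps (us @ ys)" for us ys :: "'a list"
  proof (induction us)
    case (Cons u us) then show ?case by (cases "us @ ys") auto
  qed auto
  show ?thesis using a[of xs vs] b[of "xs @ vs" us] by auto
qed

lemma angular_bool:
  assumes "\<not> ((P = Q) \<and> ((\<not> a) = d) \<and> (c = b))" "\<not> ((P \<noteq> Q) \<and> ((\<not> a) \<noteq> d) \<and> (c \<noteq> b))"
  shows "((if Q then c \<and> \<not> a else c \<or> \<not> a) \<noteq> (if Q then d \<and> \<not> b else d \<or> \<not> b)) =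
     (((P \<and> a \<and> \<not> b) \<or> (\<not> P \<and> \<not> a \<and> b)) \<noteq> ((P \<and> c \<and> \<not> d) \<or> (\<not> P \<and> \<not> c \<and> d)))"
  using assms by (smt (verit))

text \<open>A, wx, vx, wy, vy, xy stand for \<open>D c w v\<close>, \<open>D c w x\<close>,
  \<open>D c v x\<close>, \<open>D c w y\<close>, \<open>D c v y\<close>, \<open>D c x y\<close>,
  and pl is the Pluecker relation between the directions w, v, x, y at c. The exceptional values
  admit x or y antipodal to w or v.\<close>

lemma angular:
  fixes A wx vx wy vy xy :: real
  assumes A: "A \<noteq> 0" and xy: "xy \<noteq> 0" and pl: "A * xy + (- wx) * vy + wy * vx = 0"
    and hx: "(wx \<noteq> 0 \<and> vx \<noteq> 0) \<or> (wx = 0 \<and> vx = A) \<or> (wx = - A \<and> vx = 0)"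
    and hy: "(wy \<noteq> 0 \<and> vy \<noteq> 0) \<or> (wy = 0 \<and> vy = A) \<or> (wy = - A \<and> vy = 0)"
  shows "((if xy > 0 then wy > 0 \<and> wx < 0 else wy > 0 \<or> wx < 0) \<noteq> (if xy > 0 then vy > 0 \<and> vx < 0 else vy > 0 \<or> vx < 0))
     = (((A > 0 \<and> wx > 0 \<and> vx < 0) \<or> (A < 0 \<and> wx < 0 \<and> vx > 0)) \<noteq> ((A > 0 \<and> wy > 0 \<and> vy < 0) \<or> (A < 0 \<and> wy < 0 \<and> vy > 0)))"
proof -
  have c: "s = t" if "A * s = A * t" for s t using that A by simp
  from hx consider "wx \<noteq> 0" "vx \<noteq> 0" | "wx = 0" "vx = A" | "wx = - A" "vx = 0" by blast
  then show ?thesis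
  proof cases
    case 1
    from hy consider "wy \<noteq> 0" "vy \<noteq> 0" | "wy = 0" "vy = A" | "wy = - A" "vy = 0" by blast
    then show ?thesis
    proof cases
      case y: 1
      have m: "- wx \<noteq> 0" using 1 by simp
      note s = sum3_signs[OF pl A m y(1) xy y(2) 1(2)]
      have n: "t < 0 \<longleftrightarrow> \<not> t > 0" if "t \<noteq> 0" for t :: real using that by linarith
      have mw: "- wx > 0 \<longleftrightarrow> \<not> wx > 0" using 1 by linarith
      show ?thesis unfolding n[OF A] n[OF 1(1)] n[OF 1(2)] n[OF y(1)] n[OF y(2)]
        by (rule angular_bool[OF s[unfolded mw]])
    next
      case y: 2
      have "xy = wx" using pl by - (rule c, simp add: y algebra_simps)
      then show ?thesis using y 1 A by auto
    next
      case y: 3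
      have "xy = vx" using pl by - (rule c, simp add: y algebra_simps)
      then show ?thesis using y 1 A by auto
    qed
  next
    case 2
    have "xy = - wy" using pl by - (rule c, simp add: 2 algebra_simps)
    then show ?thesis using 2 hy A xy by auto
  next
    case 3
    have "xy = - vy" using pl by - (rule c, simp add: 3 algebra_simps)
    then show ?thesis using 3 hy A xy by auto
  qed
qed

text \<open>As the edge cx does not cross wv, a point x in the angle at c between w and v stays
  inside the triangle; only its direction at c matters.\<close>

lemma sector_inn:
  assumes A: "D c w v \<noteq> 0" and x: "generic_point c w v x" and nY: "\<not> Y w v c x"
  shows "in_triangle c w v x \<longleftrightarrow> (D c w v > 0 \<and> D c w x > 0 \<and> D c v x < 0) \<or> (D c w v < 0 \<and> D c w x < 0 \<and> D c v x > 0)"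
  using x unfolding generic_point_def
proof (elim disjE)
  assume x: "D x w v \<noteq> 0 \<and> D c x v \<noteq> 0 \<and> D c w x \<noteq> 0"
  have e: "D v c x = - D c v x" "D w c x = - D c w x" "D w v x = D x w v" "D w v c = D c w v" "D c x v = - D c v x"
    by (simp_all add: D_coord algebra_simps)
  show ?thesis using x A nY unfolding in_triangle_def Y_def e zero_less_mult_iff by auto
qed (use A in \<open>auto simp: in_triangle_def\<close>)

text \<open>No edge of C crosses the arc wv. Summing the cocycle of the triangle c, w, v over the
  path from the successor to the predecessor of c expresses the change of crossing parity by these
  two neighbours alone, and \<open>angular\<close> shows that the sector changes equally.\<close>

lemma target_move:
  assumes gen_pos: "gen_pos (c # cs)" and g: "generic ({w, v} \<union> set (c # cs))"
    and wv: "w \<notin> set (c # cs)" "v \<notin> set (c # cs)" "ne2 c w" "ne2 c v" "ne2 w v"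
    and nY: "\<And>p q. (p,q) \<in> edges 1 (c # cs) \<Longrightarrow> \<not> Y w v p q"
  shows "inside (c # cs) w = inside (c # cs) v"
proof -
  obtain x r where cs: "cs = x # r" "r \<noteq> []" using gen_pos unfolding gen_pos_def by (cases cs; cases "tl cs") auto
  define y where "y = last cs"
  have sd: "pairwise_ne2 (c # cs)" using gen_pos by (simp add: gen_pos_def)
  have xy: "x \<in> set cs" "y \<in> set cs" "ne2 x y" "ne2 c x" "ne2 c y" using sd cs by (auto simp: y_def)
  have A: "D c w v \<noteq> 0" using wv by (intro gsetD[OF g]) auto
  have n2: "ne2 p w \<or> p = - w" "ne2 p v \<or> p = - v" "ne2 c p" if "p \<in> set cs" for p
    using that wv sd by (auto simp: ne2_def)
  have ok: "generic_point c w v p" if p: "p \<in> set cs" for p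
  proof (cases "p = -w \<or> p = -v")
    case False
    then have "ne2 p w" "ne2 p v" "ne2 c p" using n2[OF p] by auto
    then have "D p w v \<noteq> 0" "D c p v \<noteq> 0" "D c w p \<noteq> 0" using p wv by (intro gsetD[OF g]; simp add: ne2_sym)+
    then show ?thesis by (simp add: generic_point_def)
  qed (auto simp: generic_point_def)
  have E: "edges 1 (c # cs) = steps (c # cs @ [c])" by (simp add: edges_def)
  have pcs: "steps cs \<subseteq> edges 1 (c # cs)" unfolding E using pe_sub[of cs "[c]" "[c]"] by simp
  have "(c, x) \<in> edges 1 (c # cs)" unfolding E by (simp add: cs)
  moreover obtain r' where r': "cs = r' @ [y]" unfolding y_def using cs(1) by (metis append_butlast_last_id list.distinct(1))
  then have "(y, c) \<in> edges 1 (c # cs)" unfolding E using pe_append[of "c # r'" y "[c]"] by simp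
  ultimately have nYc: "\<not> Y w v c x" "\<not> Y w v c y" using nY Y_sym(2)[of w v y c] by blast+
  have C: "(crossing_parity c w cs \<noteq> (crossing_parity w v cs \<noteq> crossing_parity c v cs)) = (in_triangle c w v (hd cs) \<noteq> in_triangle c w v (last cs))"
  proof (rule path_cocycle)
    fix p q assume pq: "(p,q) \<in> steps cs"
    have m: "p \<in> set cs" "q \<in> set cs" using pe_set[OF pq] by auto
    have "ne2 p q" using pe_distinct[OF _ pq] sd by simp
    show "(Y c w p q \<noteq> (Y w v p q \<noteq> Y c v p q)) = (in_triangle c w v p \<noteq> in_triangle c w v q)"
    proof (rule cocycle[OF A ok[OF m(1)] ok[OF m(2)]])
      show "p = - w \<or> p = - v \<or> q = - w \<or> q = - v \<or> D c p q \<noteq> 0 \<and> D w p q \<noteq> 0 \<and> D v p q \<noteq> 0"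
      proof (cases "p = - w \<or> p = - v \<or> q = - w \<or> q = - v")
        case False
        then have "ne2 p w" "ne2 p v" "ne2 q w" "ne2 q v" using n2 m by auto
        then have "D c p q \<noteq> 0" "D w p q \<noteq> 0" "D v p q \<noteq> 0" using \<open>ne2 p q\<close> n2(3)[OF m(1)] n2(3)[OF m(2)] m
          by (intro gsetD[OF g]; simp add: ne2_sym)+
        then show ?thesis by blast
      qed blast
    qed
  qed (use cs in simp)
  have "\<not> crossing_parity w v cs" by (rule crp_False) (use nY pcs in auto)
  then have C': "(crossing_parity c w cs \<noteq> crossing_parity c v cs) = (in_triangle c w v x \<noteq> in_triangle c w v y)" using C by (simp add: y_def cs(1))
  have eL: "left_sector y c x t = (if D c x y > 0 then D c t y > 0 \<and> D c t x < 0 else D c t y > 0 \<or> D c t x < 0)" for t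
  proof -
    have "D y c x = D c x y" "D y c t = D c t y" "D c x t = - D c t x" by (simp_all add: D_coord algebra_simps)
    then show ?thesis by (simp add: left_sector_def)
  qed
  have special: "(D c w p \<noteq> 0 \<and> D c v p \<noteq> 0) \<or> (D c w p = 0 \<and> D c v p = D c w v) \<or> (D c w p = - D c w v \<and> D c v p = 0)" if p: "p \<in> set cs" for p
  proof (cases "p = -w \<or> p = -v")
    case False
    then have "ne2 p w" "ne2 p v" "ne2 c p" using n2[OF p] by auto
    then have "D c w p \<noteq> 0" "D c v p \<noteq> 0" using p wv by (intro gsetD[OF g]; simp add: ne2_sym)+
    then show ?thesis by blast
  next
    case True
    have "D c v w = - D c w v" by (rule D_swap(2))
    then show ?thesis using True by auto
  qed
  have "D c x y \<noteq> 0" using xy by (intro gsetD[OF g]) auto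
  moreover have "D c w v * D c x y + - D c w x * D c v y + D c w y * D c v x = 0" by (simp add: D_coord algebra_simps)
  ultimately have "(left_sector y c x w \<noteq> left_sector y c x v) = (in_triangle c w v x \<noteq> in_triangle c w v y)"
    unfolding eL sector_inn[OF A ok[OF xy(1)] nYc(1)] sector_inn[OF A ok[OF xy(2)] nYc(2)]
    by (intro angular A special xy)
  moreover have "inside (c # cs) t = (crossing_parity c t cs \<noteq> left_sector y c x t)" for t by (simp add: inside_def y_def cs)
  ultimately show ?thesis using C' by (smt (verit))
qed

text \<open>The same telescoping with the triangle c, d, w: its side cd is an edge of the simple
  polygon C and is crossed by no edge.\<close>

lemma base_move:
  assumes gen_pos: "gen_pos (c # d # cs)" and sim: "simple 1 (c # d # cs)" and g: "generic (insert w (set (c # d # cs)))"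
    and w: "w \<notin> set (c # d # cs)" "ne2 c w" "ne2 d w"
  shows "inside (c # d # cs) w = inside (d # cs @ [c]) w"
proof -
  obtain x r where cs: "cs = x # r" using gen_pos unfolding gen_pos_def by (cases cs) auto
  define y where "y = last cs"
  have sd: "pairwise_ne2 (c # d # cs)" using gen_pos by (simp add: gen_pos_def)
  have xy: "x \<in> set cs" "y \<in> set cs" using cs by (auto simp: y_def)
  have n2: "ne2 p w \<or> p = - w" "ne2 c p" "ne2 d p" if "p \<in> set cs" for p
    using that w sd by (auto simp: ne2_def)
  have cd: "ne2 c d" using sd by simp
  have W: "D c d w \<noteq> 0" using w cd by (intro gsetD[OF g]) auto
  have gen: "(D p d w \<noteq> 0 \<and> D c p w \<noteq> 0 \<and> D c d p \<noteq> 0) \<or> p = - w" if p: "p \<in> set cs" for p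
  proof (cases "p = -w")
    case False
    then have "ne2 p w" "ne2 c p" "ne2 d p" using n2[OF p] by auto
    then have "D p d w \<noteq> 0" "D c p w \<noteq> 0" "D c d p \<noteq> 0" using p w cd by (intro gsetD[OF g]; simp add: ne2_sym)+
    then show ?thesis by simp
  qed auto
  then have ok: "generic_point c d w p" if "p \<in> set cs" for p using that by (auto simp: generic_point_def)
  have E: "edges 1 (c # d # cs) = steps (c # d # cs @ [c])" by (simp add: edges_def)
  have pcs: "steps cs \<subseteq> edges 1 (c # d # cs)" unfolding E using pe_sub[of cs "[c,d]" "[c]"] by simp
  have C: "(crossing_parity c d cs \<noteq> (crossing_parity d w cs \<noteq> crossing_parity c w cs)) = (in_triangle c d w (hd cs) \<noteq> in_triangle c d w (last cs))"
  proof (rule path_cocycle)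
    fix p q assume pq: "(p,q) \<in> steps cs"
    have m: "p \<in> set cs" "q \<in> set cs" using pe_set[OF pq] by auto
    have "ne2 p q" using pe_distinct[OF _ pq] sd by simp
    show "(Y c d p q \<noteq> (Y d w p q \<noteq> Y c w p q)) = (in_triangle c d w p \<noteq> in_triangle c d w q)"
    proof (rule cocycle[OF W ok[OF m(1)] ok[OF m(2)]])
      show "p = - d \<or> p = - w \<or> q = - d \<or> q = - w \<or> D c p q \<noteq> 0 \<and> D d p q \<noteq> 0 \<and> D w p q \<noteq> 0"
      proof (cases "p = - w \<or> q = - w")
        case False
        then have "ne2 p w" "ne2 q w" using n2 m by auto
        then have "D c p q \<noteq> 0" "D d p q \<noteq> 0" "D w p q \<noteq> 0" using \<open>ne2 p q\<close> n2(2,3)[OF m(1)] n2(2,3)[OF m(2)] m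
          by (intro gsetD[OF g]; simp add: ne2_sym)+
        then show ?thesis by blast
      qed blast
    qed
  qed (use cs in simp)
  have "\<not> crossing_parity c d cs"
  proof (rule crp_False)
    fix p q assume "(p,q) \<in> steps cs"
    then have "\<not> X c d p q" using noXD[OF sim[unfolded simple_def], of c d p q] pcs by (auto simp: E)
    then show "\<not> Y c d p q" using Y_imp_X by blast
  qed
  then have C': "(crossing_parity d w cs \<noteq> crossing_parity c w cs) = (in_triangle c d w x \<noteq> in_triangle c d w y)" using C by (simp add: y_def cs(1))
  have S: "left_sector c d x w = ((D c d w > 0) \<noteq> (in_triangle c d w x \<noteq> Y c w d x))" "left_sector y c d w = ((D c d w > 0) \<noteq> (in_triangle c d w y \<noteq> Y d w y c))"
    using sector_next[OF W gen[OF xy(1)]] sector_prev[OF W gen[OF xy(2)]] by auto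
  have 1: "inside (c # d # cs) w = ((Y c w d x \<noteq> crossing_parity c w cs) \<noteq> left_sector y c d w)"
    by (simp add: inside_def y_def cs)
  have 2: "inside (d # cs @ [c]) w = ((crossing_parity d w cs \<noteq> Y d w y c) \<noteq> left_sector c d x w)"
    using crp_snoc[of cs d w c] by (simp add: inside_def y_def cs)
  show ?thesis unfolding 1 2 S using C' by (smt (verit))
qed

subsection \<open>The side of the antipodal polygon\<close>

definition in_hemisphere :: "(real^3) list \<Rightarrow> bool" where
  "in_hemisphere ps \<longleftrightarrow> (\<exists>h. \<forall>x\<in>set ps. h \<bullet> x > 0)"

text \<open>A simple C does not meet -C, which therefore lies on one side. By
  \<open>side_target\<close> and \<open>side_rot\<close> neither the choice of the last vertex nor
  that of the base matters.\<close>

definition antipodal_side :: "(real^3) list \<Rightarrow> bool" where "antipodal_side C = inside C (- last C)"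

lemma sdist_pair: "pairwise_ne2 xs \<Longrightarrow> x \<in> set xs \<Longrightarrow> y \<in> set xs \<Longrightarrow> x = y \<or> ne2 x y"
  by (induction xs) (auto simp: ne2_sym)

lemma gp_nonzero: assumes "gen_pos C" "p \<in> set C" shows "p \<noteq> 0"
proof
  assume p: "p = 0"
  obtain a b M l where C: "C = a # b # M @ [l]" using gp_list[OF assms(1)] .
  have n: "ne2 a b" "ne2 b l" "ne2 a l" using assms(1) by (auto simp: gen_pos_def C)
  have "D a b l \<noteq> 0" using n by (intro gp_D[OF assms(1)]) (auto simp: C)
  have "p = a \<or> ne2 p a" "p = b \<or> ne2 p b"
    using sdist_pair[of C p a] sdist_pair[of C p b] assms by (auto simp: gen_pos_def C)
  then consider "ne2 p a" "ne2 p b" | "p = a" | "p = b" by blast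
  then show False
  proof cases
    case 1 then have "D p a b \<noteq> 0" using assms n by (intro gp_D[OF assms(1)]) (auto simp: C)
    then show False using p by simp
  qed (use \<open>D a b l \<noteq> 0\<close> p in auto)
qed

lemma neg_notin: assumes "gen_pos C" "p \<in> set C" shows "- p \<notin> set C"
proof
  assume "- p \<in> set C"
  then have "- p = p \<or> ne2 (- p) p" using assms sdist_pair unfolding gen_pos_def by blast
  then have "- p = p" by simp
  then have "2 *\<^sub>R p = 0" by (metis add.right_inverse scaleR_2)
  then show False using gp_nonzero[OF assms] by simp
qed

lemma path_const: "(\<And>p q. (p,q) \<in> steps xs \<Longrightarrow> f p = f q) \<Longrightarrow> x \<in> set xs \<Longrightarrow> y \<in> set xs \<Longrightarrow> f x = f y"
proof -
  have "(\<And>p q. (p,q) \<in> steps xs \<Longrightarrow> f p = f q) \<Longrightarrow> x \<in> set xs \<Longrightarrow> f x = f (hd xs)" for x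
  proof (induction xs arbitrary: x rule: steps.induct)
    case (1 y z zs)
    have "f y = f z" using 1(2)[of y z] by simp
    moreover have "f x = f z" if "x \<in> set (z # zs)" using 1(1)[of x] 1(2) that by auto
    ultimately show ?case using 1(3) by auto
  qed auto
  then show "(\<And>p q. (p,q) \<in> steps xs \<Longrightarrow> f p = f q) \<Longrightarrow> x \<in> set xs \<Longrightarrow> y \<in> set xs \<Longrightarrow> f x = f y" by metis
qed

lemma gset_gp_neg: "gen_pos C \<Longrightarrow> S \<subseteq> set C \<union> uminus ` set C \<Longrightarrow> generic S"
  using gset_mono[OF gset_neg] unfolding gen_pos_def by blast

lemma side_target:
  assumes gen_pos: "gen_pos (c # cs)" and s: "simple 1 (c # cs)" and x: "x \<in> set cs"
  shows "inside (c # cs) (- x) = antipodal_side (c # cs)"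
proof -
  have "cs \<noteq> []" using x by auto
  have "inside (c # cs) (- x) = inside (c # cs) (- last cs)"
  proof (rule path_const[of cs "\<lambda>x. inside (c # cs) (- x)", OF _ x])
    fix p q assume pq: "(p,q) \<in> steps cs"
    then have m: "p \<in> set cs" "q \<in> set cs" using pe_set[of p q cs] by auto
    have sd: "pairwise_ne2 (c # cs)" using gen_pos by (simp add: gen_pos_def)
    have n: "ne2 p q" using pe_distinct[OF _ pq] sd by simp
    have pq': "(p,q) \<in> edges 1 (c # cs)" using pq pe_sub[of cs "[c]" "[c]"] by (auto simp: edges_def)
    show "inside (c # cs) (- p) = inside (c # cs) (- q)"
    proof (rule target_move[OF gen_pos])
      show "generic ({- p, - q} \<union> set (c # cs))" by (rule gset_gp_neg[OF gen_pos]) (use m in auto)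
      show "- p \<notin> set (c # cs)" "- q \<notin> set (c # cs)" using neg_notin[OF gen_pos] m by auto
      show "ne2 c (- p)" "ne2 c (- q)" "ne2 (- p) (- q)" using sd m n by auto
      show "\<not> Y (- p) (- q) r t" if "(r,t) \<in> edges 1 (c # cs)" for r t
        using noXD[OF s[unfolded simple_def] pq' that] Y_imp_X[of "-p" "-q" r t] by auto
    qed
  qed (use \<open>cs \<noteq> []\<close> in simp)
  then show ?thesis using \<open>cs \<noteq> []\<close> by (simp add: antipodal_side_def)
qed

lemma side_rot: assumes gen_pos: "gen_pos C" and s: "simple 1 C" shows "antipodal_side (rot1 1 C) = antipodal_side C"
proof -
  obtain c d M l where C: "C = c # d # M @ [l]" using gp_list[OF gen_pos] .
  have sd: "pairwise_ne2 C" using gen_pos by (simp add: gen_pos_def)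
  have l: "l \<in> set C" by (simp add: C)
  have "inside (c # d # M @ [l]) (- l) = inside (d # (M @ [l]) @ [c]) (- l)"
  proof (rule base_move)
    show "gen_pos (c # d # M @ [l])" "simple 1 (c # d # M @ [l])" using gen_pos s C by auto
    show "generic (insert (- l) (set (c # d # M @ [l])))" by (rule gset_gp_neg[OF gen_pos]) (auto simp: C)
    show "- l \<notin> set (c # d # M @ [l])" using neg_notin[OF gen_pos l] by (simp add: C)
    show "ne2 c (- l)" "ne2 d (- l)" using sd by (auto simp: C)
  qed
  moreover have "inside (d # (M @ [l]) @ [c]) (- l) = antipodal_side (d # (M @ [l]) @ [c])"
    using rot1_gp[OF gen_pos, of 1] rot1_simple[of 1 C] s gen_pos by (intro side_target) (auto simp: C rot1_def)
  ultimately show ?thesis by (simp add: C rot1_def antipodal_side_def)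
qed

lemma side_rot_pow: assumes gen_pos: "gen_pos C" and s: "simple 1 C" shows "antipodal_side ((rot1 1 ^^ k) C) = antipodal_side C"
proof (induction k)
  case (Suc k)
  then show ?case using side_rot[of "(rot1 1 ^^ k) C"] rot1_pow[OF gen_pos, of 1 k] s by simp
qed simp

lemma side_split:
  assumes gen_pos: "gen_pos (us @ vs)" and s: "simple 1 (us @ vs)"
  shows "gen_pos (vs @ us)" "simple 1 (vs @ us)" "antipodal_side (vs @ us) = antipodal_side (us @ vs)"
  using rot1_pow[OF gen_pos, of 1 "length us"] side_rot_pow[OF gen_pos s, of "length us"] s rot1_pow_append[where e=1 and us=us and vs=vs] by simp_all

lemma crp_uminus: "crossing_parity (- c) (- w) (map uminus xs) = crossing_parity c w xs"
proof -
  have "Y (- c) (- w) (- p) (- q) = Y c w p q" for p q unfolding Y_def by auto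
  then show ?thesis by (induction xs rule: steps.induct) auto
qed

text \<open>The antipodal map preserves \<open>Y\<close> but reverses the sign of determinants, and
  so exchanges left and right.\<close>

lemma side_uminus: assumes gen_pos: "gen_pos C" shows "antipodal_side (map uminus C) = (\<not> antipodal_side C)"
proof -
  obtain c d M l where C: "C = c # d # M @ [l]" using gp_list[OF gen_pos] .
  have "D l c d \<noteq> 0" using nzt_cyc[OF gen_pos, of 1] by (simp add: C)
  moreover have "D c d l = D l c d" by (rule D_cyc)
  ultimately have "left_sector (- l) (- c) (- d) l = (\<not> left_sector l c d (- l))" by (auto simp: left_sector_def)
  then show ?thesis using crp_uminus[of c "- l" "d # M @ [l]"] by (simp add: antipodal_side_def inside_def C)
qed

text \<open>The open arc from q to w runs where h is negative, the edge rs where h is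
  positive.\<close>

lemma no_Y_hemi:
  assumes "\<And>x. x \<in> S \<Longrightarrow> h \<bullet> x > 0" "h \<bullet> q \<le> 0" "h \<bullet> w < 0" "r \<in> S" "s \<in> S"
  shows "\<not> Y q w r s"
proof
  assume "Y q w r s"
  then obtain \<alpha> \<beta> \<gamma> \<delta> where h: "\<alpha> > 0" "\<beta> > 0" "\<gamma> > 0" "\<delta> > 0" "\<alpha> *\<^sub>R q + \<beta> *\<^sub>R w = \<gamma> *\<^sub>R r + \<delta> *\<^sub>R s" by (rule Y_combo)
  have "h \<bullet> (\<alpha> *\<^sub>R q + \<beta> *\<^sub>R w) < 0" using h(1,2) assms(2,3) by (simp add: inner_add_right add_nonpos_neg mult_nonneg_nonpos mult_pos_neg)
  moreover have "h \<bullet> (\<gamma> *\<^sub>R r + \<delta> *\<^sub>R s) > 0" using h(3,4) assms(1,4,5) by (simp add: inner_add_right add_pos_pos)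
  ultimately show False using h(5) by simp
qed

text \<open>Suppose h is positive on all vertices except a. Then the arc from a to -m meets no edge
  between b and l, so -m, being on the left of the polygon, lies in the left sector at a. This
  position forces the edges la and bm to cross.\<close>

lemma delete_keeps_nonhemi:
  assumes gen_pos: "gen_pos (a # b # M @ [l])" and s: "simple 1 (a # b # M @ [l])" and M: "M \<noteq> []"
    and D: "D l a b > 0" and antipodal_side: "antipodal_side (a # b # M @ [l])" and nh: "\<not> in_hemisphere (a # b # M @ [l])"
  shows "\<not> in_hemisphere (b # M @ [l])"
proof
  assume "in_hemisphere (b # M @ [l])"
  then obtain h where h: "\<And>x. x \<in> set (b # M @ [l]) \<Longrightarrow> h \<bullet> x > 0" unfolding in_hemisphere_def by blast
  have ha: "h \<bullet> a \<le> 0" using nh h unfolding in_hemisphere_def by (metis not_le set_ConsD)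
  obtain m M' where m: "M = m # M'" using M by (cases M) auto
  have "inside (a # b # M @ [l]) (- m)" using side_target[OF gen_pos s, of m] antipodal_side m by simp
  moreover have "\<not> crossing_parity a (- m) (b # M @ [l])"
  proof (rule crp_False)
    fix p q assume "(p,q) \<in> steps (b # M @ [l])"
    then have "p \<in> set (b # M @ [l])" "q \<in> set (b # M @ [l])" using pe_set[of p q "b # M @ [l]"] by blast+
    moreover have "h \<bullet> (- m) < 0" using h[of m] m by simp
    ultimately show "\<not> Y a (- m) p q" using h ha by (intro no_Y_hemi[of "set (b # M @ [l])" h]) auto
  qed
  ultimately have "left_sector l a b (- m)" by (simp add: inside_def)
  then have 1: "D l a m < 0" "D a b m < 0" using D by (auto simp: left_sector_def)
  have e: "D m a b = D a b m" "D l b m = - D l m b" by (simp_all add: D_coord algebra_simps)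
  \<comment> \<open>Two of the three terms are negative and the sum is positive, which fixes the
    sign of the third.\<close>
  have "D l a b * (h \<bullet> m) = D m a b * (h \<bullet> l) + D l m b * (h \<bullet> a) + D l a m * (h \<bullet> b)"
    using arg_cong[OF cramer[of l a b m], of "\<lambda>v. h \<bullet> v"] by (simp add: inner_add_right)
  moreover have "D l a b * (h \<bullet> m) > 0" using D h[of m] m by simp
  moreover have "D m a b * (h \<bullet> l) < 0" "D l a m * (h \<bullet> b) < 0" using 1 h[of l] h[of b] e by (simp_all add: mult_neg_pos)
  ultimately have "D l m b * (h \<bullet> a) > 0" by linarith
  then have 2: "D l m b < 0" using ha by (simp add: zero_less_mult_iff)
  have "X l a b m" unfolding X_def using 1 2 D e by (simp add: mult_less_0_iff zero_less_mult_iff)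
  moreover have "(l, a) \<in> edges 1 (a # b # M @ [l])" using pe_append[of "a # b # M" l "[a]"] by (simp add: edges_def)
  moreover have "(b, m) \<in> edges 1 (a # b # M @ [l])" by (simp add: edges_def m)
  ultimately show False using noXD[OF s[unfolded simple_def]] by blast
qed

section \<open>Turning direction at an antipodal obstacle\<close>

context slide2 begin

lemma X_extra: "\<not> X c z a b" "\<not> X a b c z" "\<not> X z c i2 b"
proof -
  show "\<not> X c z a b" using D zk by (simp add: X_def mult_less_0_iff)
  then show "\<not> X a b c z" using X_sym by blast
  have "D z i2 b > 0" "D c i2 b > 0" using zk D by (simp_all add: i2)
  then show "\<not> X z c i2 b" by (simp add: X_def mult_less_0_iff)
qed

lemma zi_free_l: assumes y: "y \<in> set Y'" "(y, l) \<in> E0" shows "\<not> X z i2 y l"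
proof
  assume "X z i2 y l"
  have cl: "c = l \<or> c = - l" using e by (auto simp: c_def)
  obtain \<alpha> \<beta> \<gamma> \<delta> \<epsilon> where h: "\<alpha> > 0" "\<beta> > 0" "\<gamma> > 0" "\<delta> > 0" "\<epsilon> = 1 \<or> \<epsilon> = (-1::real)"
    "\<alpha> *\<^sub>R z + \<beta> *\<^sub>R i2 = \<epsilon> *\<^sub>R (\<gamma> *\<^sub>R y + \<delta> *\<^sub>R l)" using X_combo[OF \<open>X z i2 y l\<close>] by metis
  define P where "P = \<alpha> *\<^sub>R z + \<beta> *\<^sub>R i2"
  define r where "r = \<epsilon> *\<^sub>R y"
  have P: "P = \<gamma> *\<^sub>R r + (\<epsilon> * \<delta>) *\<^sub>R l" using h(6) by (simp add: P_def r_def algebra_simps)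
  have l0: "D c l b = 0" "D c a l = 0" "D c z l = 0" using cl by auto
  have i2v: "D c i2 b > 0" "D c a i2 > 0" using D rho by (simp_all add: inR)
  have "D c P b > 0" "D c a P > 0" "D c z P < 0" unfolding P_def using h(1,2) zk i2v i2c
    by (simp_all add: add_pos_pos mult_pos_neg)
  then have "\<gamma> * D c r b > 0" "\<gamma> * D c a r > 0" "\<gamma> * D c z r < 0" unfolding P D_lin l0 by simp_all
  then have k: "D c r b > 0" "D c a r > 0" "D c z r < 0" using h by (auto simp: zero_less_mult_iff mult_less_0_iff)
  have "\<not> in_swept c a b z r" using free y h(5) by (auto simp: swept_free_def r_def)
  then have "\<not> D r a b > 0" using k by (auto simp: in_swept_def)
  moreover have "D r a b \<noteq> 0" using nzXY[of y] y h(5) by (auto simp: r_def)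
  ultimately have "D r a b < 0" by linarith
  moreover have "D a r c = D c a r" "D b r c = - D c r b" "D a b r = D r a b" "D a b c = D c a b"
    by (simp_all add: D_coord algebra_simps)
  ultimately have "X a b r c" unfolding X_def using k D by (simp add: mult_less_0_iff)
  moreover have "\<epsilon> = e"
  proof (rule ccontr)
    assume "\<epsilon> \<noteq> e"
    then have "\<epsilon> * D l a b < 0" using e h(5) D by (auto simp: c_def)
    then have "\<delta> * (\<epsilon> * D l a b) < 0" using h(4) by (simp add: mult_pos_neg)
    moreover have "D P a b > 0" unfolding P_def using h(1,2) zk by (simp add: inR)
    then have "\<gamma> * D r a b + \<delta> * (\<epsilon> * D l a b) > 0" unfolding P by (simp add: algebra_simps)
    moreover have "\<gamma> * D r a b < 0" using \<open>D r a b < 0\<close> h(3) by (simp add: mult_pos_neg)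
    ultimately show False by linarith
  qed
  then have "X a b r c = X a b y l" using e X_neg(2)[of a b y l] by (auto simp: r_def c_def)
  ultimately show False using nab[OF y(2)] by simp
qed

lemma rotated:
  assumes e1: "e = 1"
  shows "gen_pos (u # Y' @ [l, a, b] @ X')" "simple 1 (u # Y' @ [l, a, b] @ X')"
    "antipodal_side (u # Y' @ [l, a, b] @ X') = antipodal_side (a # b # X' @ u # Y' @ [l])"
    "gen_pos (l # a # b # X' @ u # Y')" "simple 1 (l # a # b # X' @ u # Y')"
    "antipodal_side (l # a # b # X' @ u # Y') = antipodal_side (a # b # X' @ u # Y' @ [l])"
  using side_split[of "a # b # X'" "u # Y' @ [l]"] side_split[of "a # b # X' @ u # Y'" "[l]"] gen_pos sim e1 by simp_all

lemma pe_prefix: "steps xs \<subseteq> steps (xs @ ys)" "steps xs \<subseteq> steps (ys @ xs)"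
  using pe_sub[of xs "[]" ys] pe_sub[of xs ys "[]"] by auto

text \<open>\<open>antipodal_side\<close> is evaluated from base l with target -u and from base u
  with target -l. The two connecting arcs are antipodal to each other and meet no edge, so only the
  sectors count: the one at l gives True, the one at u would give False if the polygon turned left
  there.\<close>

lemma antipodal_turn:
  assumes e1: "e = 1" and k1: "\<kappa> = -1"
  shows "\<not> dj"
proof
  assume dj: "dj"
  have cl: "c = l" using e1 by (simp add: c_def)
  have zu: "z = - u" by (simp add: z_def k1)
  obtain Y'' y where Yy: "Y' = Y'' @ [y]" using Yne by (metis append_butlast_last_id)
  have yin: "y \<in> set Y'" by (simp add: Yy)
  have yl: "(y, l) \<in> E0" using pe_append[of "b # X' @ u # Y''" y "[l]"] unfolding E0_def using Yy by auto
  have "\<not> crossing_parity c z (a # b # X' @ u # Y')"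
  proof (rule crp_False)
    fix p q assume "(p,q) \<in> steps (a # b # X' @ u # Y')"
    moreover have "steps (b # X' @ u # Y') \<subseteq> E0" using pe_prefix(1)[of "b # X' @ u # Y'" "[l]"] by (simp add: E0_def)
    ultimately have "(p,q) = (a,b) \<or> (p,q) \<in> E0" by auto
    then have "\<not> X c z p q" using X_extra cz_free by auto
    then show "\<not> Y c z p q" using Y_imp_X by blast
  qed
  moreover have "left_sector y c a z"
  proof -
    have "\<not> X a b y c" using nab[OF yl] by (simp add: cl)
    moreover have "\<not> in_swept c a b z y" using free yin by (auto simp: swept_free_def)
    ultimately have "D y c a > 0 \<longrightarrow> D y c z > 0" using corner_prev[OF D _ zk(3)] zk nzXY[of y] yin by auto
    then show ?thesis using zk by (auto simp: left_sector_def)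
  qed
  ultimately have "inside (c # a # b # X' @ u # Y') z" by (simp add: inside_def Yy)
  then have s1: "antipodal_side (a # b # X' @ u # Y' @ [l])"
    using side_target[of l "a # b # X' @ u # Y'" u] rotated[OF e1] by (simp add: cl zu)
  have "\<not> crossing_parity u (- c) (Y' @ [l, a, b] @ X')"
  proof (rule crp_False)
    fix p q assume pq: "(p,q) \<in> steps (Y' @ [l, a, b] @ X')"
    have "steps (Y' @ [l, a, b] @ X') = steps (Y' @ [l]) \<union> {(l,a)} \<union> {(a,b)} \<union> steps (b # X')"
      using pe_append[of Y' l "[a,b] @ X'"] by auto
    moreover have "steps (Y' @ [l]) \<subseteq> E0" using pe_prefix(2)[of "Y' @ [l]" "b # X' @ [u]"] by (simp add: E0_def)
    moreover have "steps (b # X') \<subseteq> E0" using pe_prefix(1)[of "b # X'" "u # Y' @ [l]"] by (simp add: E0_def)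
    ultimately have "(p,q) = (l,a) \<or> (p,q) = (a,b) \<or> (p,q) \<in> E0" using pq by auto
    then have "\<not> X c z p q" using X_extra cz_free by (auto simp: cl)
    then have "\<not> X u (- c) p q" using X_neg(1)[of z c p q] X_swap(1)[of z c p q] by (simp add: zu)
    then show "\<not> Y u (- c) p q" using Y_imp_X by blast
  qed
  moreover have "\<not> left_sector prev u nxt (- c)"
  proof -
    have "D u nxt (- c) = - D c z (\<kappa> *\<^sub>R nxt)" by (simp add: zu k1 D_coord algebra_simps)
    then show ?thesis using dj nxt_pos[OF Yne] by (simp add: left_sector_def dj_def)
  qed
  moreover have "last (u # Y' @ [l, a, b] @ X') = prev" "hd (Y' @ [l, a, b] @ X') = nxt"
    using Yne unfolding prev_def nxt_def by (auto simp: hd_append)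
  ultimately have "\<not> inside (u # Y' @ [l, a, b] @ X') (- c)" by (simp add: inside_def)
  moreover have "inside (u # Y' @ [l, a, b] @ X') (- c) = antipodal_side (u # Y' @ [l, a, b] @ X')"
    by (rule side_target) (use rotated[OF e1] cl in auto)
  ultimately show False using s1 rotated[OF e1] by simp
qed

end

section \<open>An obstacle that is a vertex: two closed loops\<close>

context slide2 begin

context assumes e1: "e = 1" and k1: "\<kappa> = 1"
begin

lemma cz1: "c = l" "z = u" using e1 k1 by (simp_all add: c_def z_def)

lemma setA: "set AA = insert u (insert i2 (set (b # X')))"
  unfolding AA_def by (simp add: cz1)

lemma ne2_blocks: "x \<in> set (b # X') \<Longrightarrow> y \<in> set (u # Y' @ [l]) \<Longrightarrow> ne2 x y"
proof -
  have "pairwise_ne2 ((b # X') @ (u # Y' @ [l]))" using sd by simp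
  then show "x \<in> set (b # X') \<Longrightarrow> y \<in> set (u # Y' @ [l]) \<Longrightarrow> ne2 x y" unfolding sdist_append by blast
qed

lemma AAu: "AA = u # i2 # b # X'"
  unfolding AA_def by (simp add: cz1)

lemma edgA1: "edges 1 AA = {(z,i2)} \<union> {(i2,b)} \<union> GA"
  using edgA k1 by simp

lemma edgB1: "edges 1 BB = GB \<union> {(l, u)}"
  using edgB k1 e1 cz1 by simp

lemma in_E0: "GA \<subseteq> E0" "GB \<subseteq> E0" "steps (Y' @ [l]) \<subseteq> E0" "steps (b # X') \<subseteq> GA"
proof -
  show "GA \<subseteq> E0" "GB \<subseteq> E0" using E0_split by auto
  show "steps (Y' @ [l]) \<subseteq> E0" using pe_prefix(2)[of "Y' @ [l]" "b # X' @ [u]"] by (simp add: E0_def)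
  show "steps (b # X') \<subseteq> GA" using pe_prefix(1)[of "b # X'" "[u]"] by (simp add: GA_def)
qed

lemma Yl_edge_free: assumes pq: "(p,q) \<in> steps (Y' @ [l])" shows "\<not> X z i2 p q"
proof -
  have E: "(p,q) \<in> E0" using pq in_E0 by blast
  have m: "p \<in> set (Y' @ [l])" "q \<in> set (Y' @ [l])" using pe_set[OF pq] by auto
  have "p \<noteq> l"
  proof
    assume "p = l"
    have "pairwise_ne2 (Y' @ [l])" using sd by (simp add: sdist_append)
    moreover have "pairwise_ne2 (xs @ [l]) \<Longrightarrow> (l, q) \<notin> steps (xs @ [l])" for xs
      by (induction xs rule: steps.induct) (auto simp: sdist_append)
    ultimately show False using pq \<open>p = l\<close> by blast
  qed
  then have p: "p \<in> set Y'" using m by auto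
  show ?thesis
  proof (cases "q = l")
    case True then show ?thesis using zi_free_l[OF p] E by simp
  next
    case False
    then have "q \<in> set Y'" using m by auto
    then show ?thesis using D zk rho i2c p
      by (intro region_free[OF _ _ _ _ _ _ _ _ _ _ _ E]) (auto simp: inR)
  qed
qed

lemma gsetA: "S \<subseteq> insert i2 (set (b # X' @ u # Y' @ [l]) \<union> uminus ` set (b # X' @ u # Y' @ [l])) \<Longrightarrow> generic S"
  by (rule gset_mono[OF gset_neg[OF gsetW]]) auto

lemma i2_notin: assumes "p \<in> set (b # X' @ u # Y' @ [l])" shows "i2 \<noteq> p" "i2 \<noteq> - p"
  using ne_i2[OF assms] by (auto simp: ne2_def)

lemma neg_notin': "p \<in> set (b # X' @ u # Y' @ [l]) \<Longrightarrow> - p \<notin> set (b # X' @ u # Y' @ [l])"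
  using neg_notin[OF gen_pos, of p] by auto

text \<open>The path from Y' to l does not meet AA, so it suffices to look at l. The arc from z to l
  meets no edge of AA and starts outside the left sector at z.\<close>

lemma outside_A: assumes w: "w \<in> set (Y' @ [l])" shows "\<not> inside AA w"
proof -
  have notin: "p \<notin> set AA" "ne2 z p" if "p \<in> set (Y' @ [l])" for p
  proof -
    have "p \<notin> set (b # X')" using ne2_blocks[of p p] that by auto
    moreover have "ne2 u p" using that ne_ab ne_XY[of p] by auto
    then have "p \<noteq> u" by auto
    ultimately show "p \<notin> set AA" using that i2_notin[of p] unfolding setA by auto
    show "ne2 z p" using that ne_ab ne_XY[of p] by (auto simp: cz1)
  qed
  have "inside AA w = inside AA l"
  proof (rule path_const[of "Y' @ [l]" "inside AA", OF _ w])
    fix p q assume pq: "(p,q) \<in> steps (Y' @ [l])"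
    then have m: "p \<in> set (Y' @ [l])" "q \<in> set (Y' @ [l])" using pe_set[of p q "Y' @ [l]"] by auto
    have E: "(p,q) \<in> E0" using pq in_E0 by blast
    show "inside AA p = inside AA q" unfolding AA_def
    proof (rule target_move)
      show "gen_pos (z # i2 # b # X')" using gpA by (simp add: AA_def)
      show "generic ({p, q} \<union> set (z # i2 # b # X'))" using m by (intro gsetA) (auto simp: cz1)
      show "p \<notin> set (z # i2 # b # X')" "q \<notin> set (z # i2 # b # X')" using notin(1)[OF m(1)] notin(1)[OF m(2)] by (simp_all add: AA_def)
      show "ne2 z p" "ne2 z q" using notin(2) m by auto
      show "ne2 p q" using E0_mem[OF E] by simp
      fix r s assume "(r,s) \<in> edges 1 (z # i2 # b # X')"
      then have "(r,s) = (z,i2) \<or> (r,s) = (i2,b) \<or> (r,s) \<in> E0" using edgA1 in_E0 by (auto simp: AA_def)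
      then have "\<not> X p q r s" using Yl_edge_free[OF pq] ib_free[OF E] noXD[OF nE0 E, of r s] X_sym[of p q i2 b] X_sym[of p q z i2] by auto
      then show "\<not> Y p q r s" using Y_imp_X by blast
    qed
  qed auto
  moreover have "\<not> crossing_parity z l (i2 # b # X')"
  proof (rule crp_False)
    fix p q assume "(p,q) \<in> steps (i2 # b # X')"
    then have "(p,q) = (i2,b) \<or> (p,q) \<in> E0" using in_E0 by auto
    then have "\<not> X z l p q" using X_extra cz_free[of p q] X_swap by (auto simp: cz1)
    then show "\<not> Y z l p q" using Y_imp_X by blast
  qed
  moreover have "\<not> left_sector prev z i2 l"
  proof -
    have "D prev z l = - D c z prev" unfolding cz1 by (rule D_swap)
    then show ?thesis using prev_pos i2p by (simp add: left_sector_def k1)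
  qed
  moreover have "last AA = prev" by (simp add: AA_def prev_def)
  ultimately show ?thesis by (simp add: inside_def AA_def)
qed

text \<open>After a left turn at u the edge to nxt would start inside AA, against
  \<open>outside_A\<close>.\<close>

lemma touch_turn: "\<not> dj"
proof
  assume dj: "dj"
  have nin: "nxt \<in> set (Y' @ [l])" using Yne by (simp add: nxt_def)
  have "\<not> crossing_parity z nxt (i2 # b # X')"
  proof (rule crp_False)
    fix p q assume "(p,q) \<in> steps (i2 # b # X')"
    then have "(p,q) = (i2,b) \<or> (p,q) \<in> E0" using in_E0 by auto
    then have "\<not> X z nxt p q" using ib_free[OF nxt_edge] noXD[OF nE0 nxt_edge] X_sym by (auto simp: cz1)
    then show "\<not> Y z nxt p q" using Y_imp_X by blast
  qed
  moreover have "left_sector prev z i2 nxt" using i2p i2n dj by (simp add: left_sector_def k1 dj_def cz1)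
  moreover have "last AA = prev" by (simp add: AA_def prev_def)
  ultimately have "inside AA nxt" by (simp add: inside_def AA_def)
  then show False using outside_A[OF nin] by simp
qed

lemma prev_in: "prev \<in> set (b # X')" unfolding prev_def by (rule last_in_set) simp

text \<open>As for AA, but the last vertex before u is now seen from u along its own edge; by
  \<open>touch_turn\<close> this edge is not in the left sector of BB.\<close>

lemma outside_B: assumes w: "w \<in> set (b # X')" shows "\<not> inside BB w"
proof -
  have notin: "p \<notin> set BB" "ne2 u p" if "p \<in> set (b # X')" for p
  proof -
    show "p \<notin> set BB" using that ne2_blocks[of p p] unfolding BB_def by auto
    show "ne2 u p" using that ne_ab ne_XY[of p] ne2_sym[of u b] by auto
  qed
  have Bfree: "\<not> X p q r s" if E: "(p,q) \<in> E0" and rs: "(r,s) \<in> edges 1 BB" for p q r s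
  proof -
    from rs have "(r,s) \<in> E0 \<or> (r,s) = (l,u)" using edgB1 in_E0 by auto
    then show ?thesis using noXD[OF nE0 E] cz_free[OF E] X_sym[of p q l u] by (auto simp: cz1)
  qed
  have "inside BB w = inside BB prev"
  proof (rule path_const[of "b # X'" "inside BB", OF _ w prev_in])
    fix p q assume pq: "(p,q) \<in> steps (b # X')"
    then have m: "p \<in> set (b # X')" "q \<in> set (b # X')" using pe_set[of p q "b # X'"] by auto
    have E: "(p,q) \<in> E0" using pq in_E0 by blast
    show "inside BB p = inside BB q" unfolding BB_def
    proof (rule target_move)
      show "gen_pos (u # Y' @ [l])" using gpB by (simp add: BB_def)
      show "generic ({p, q} \<union> set (u # Y' @ [l]))" using m by (intro gsetA) auto
      show "p \<notin> set (u # Y' @ [l])" "q \<notin> set (u # Y' @ [l])" using notin(1)[OF m(1)] notin(1)[OF m(2)] by (simp_all add: BB_def)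
      show "ne2 u p" "ne2 u q" using notin(2) m by auto
      show "ne2 p q" using E0_mem[OF E] by simp
      fix r s assume "(r,s) \<in> edges 1 (u # Y' @ [l])"
      then have "(r,s) \<in> edges 1 BB" by (simp add: BB_def)
      then show "\<not> Y p q r s" using Bfree[OF E] Y_imp_X by blast
    qed
  qed
  moreover have "\<not> crossing_parity u prev (Y' @ [l])"
  proof (rule crp_False)
    fix p q assume "(p,q) \<in> steps (Y' @ [l])"
    then have "(p,q) \<in> E0" using in_E0 by blast
    then have "\<not> X u prev p q" using noXD[OF nE0 prev_edge] by (simp add: X_swap)
    then show "\<not> Y u prev p q" using Y_imp_X by blast
  qed
  moreover have "\<not> left_sector l u nxt prev"
  proof -
    have "D l u nxt > 0" using nxt_pos[OF Yne] by (simp add: cz1 k1)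
    moreover have "D u nxt prev = D prev u nxt" by (rule D_cyc)
    then have "\<not> D u nxt prev > 0" using touch_turn by (simp add: dj_def)
    ultimately show ?thesis by (simp add: left_sector_def)
  qed
  moreover have "last BB = l" "hd (Y' @ [l]) = nxt" by (simp_all add: BB_def nxt_def)
  ultimately show ?thesis by (simp add: inside_def BB_def)
qed

text \<open>If both loops lay in open hemispheres, -b would be outside both of them, by moves that
  stay in the complementary half spaces or follow antipodes of edges. Counting crossings along the
  arc from u to -b then puts -b on the wrong side of the whole polygon.\<close>

lemma loop_nonhemi:
  assumes antipodal_side: "antipodal_side (a # b # X' @ u # Y' @ [l])" and nh: "\<not> in_hemisphere (a # b # X' @ u # Y' @ [l])"
  shows "\<not> in_hemisphere AA \<or> \<not> in_hemisphere BB"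
proof (rule ccontr)
  assume "\<not> ?thesis"
  then obtain hA hB where hA: "\<And>x. x \<in> set AA \<Longrightarrow> hA \<bullet> x > 0" and hB: "\<And>x. x \<in> set BB \<Longrightarrow> hB \<bullet> x > 0"
    unfolding in_hemisphere_def by blast
  \<comment> \<open>The vertex a is on neither loop; deleting it first ensures that each hemisphere
    misses a vertex of the other loop.\<close>
  have nr: "\<not> in_hemisphere (b # (X' @ u # Y') @ [l])"
    by (rule delete_keeps_nonhemi[of a]) (use gen_pos sim D antipodal_side nh in \<open>auto simp: cz1 e1\<close>)
  obtain q where q: "q \<in> set (Y' @ [l])" "hA \<bullet> q \<le> 0"
  proof -
    obtain q where "q \<in> set (b # (X' @ u # Y') @ [l])" "\<not> hA \<bullet> q > 0" using nr unfolding in_hemisphere_def by blast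
    moreover then have "q \<notin> set AA" using hA by blast
    ultimately show ?thesis using that[of q] unfolding setA by auto
  qed
  obtain x where x: "x \<in> set (b # X')" "hB \<bullet> x \<le> 0"
  proof -
    obtain q where "q \<in> set (b # (X' @ u # Y') @ [l])" "\<not> hB \<bullet> q > 0" using nr unfolding in_hemisphere_def by blast
    moreover then have "q \<notin> set BB" using hB by blast
    ultimately show ?thesis using that[of q] by (auto simp: BB_def)
  qed
  let ?V = "set (b # X' @ u # Y' @ [l])"
  have bA: "b \<in> set AA" and lB: "l \<in> set BB" by (simp_all add: AA_def BB_def)
  have neb: "ne2 u b" "ne2 u l" "ne2 u a" using ne_ab ne2_sym by auto
  \<comment> \<open>Here hA is not positive on the arc from q to -b, so the arc does not meet
    AA.\<close>
  have "inside AA q = inside AA (- b)" unfolding AA_def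
  proof (rule target_move)
    show "gen_pos (z # i2 # b # X')" using gpA by (simp add: AA_def)
    show "generic ({q, - b} \<union> set (z # i2 # b # X'))" using q by (intro gsetA) (auto simp: cz1)
    show "q \<notin> set (z # i2 # b # X')" using q hA[of q] by (fastforce simp: AA_def)
    show "- b \<notin> set (z # i2 # b # X')" using neg_notin'[of b] i2_notin(2)[of b] by (auto simp: cz1)
    show "ne2 z q" using q ne_ab ne_XY[of q] by (auto simp: cz1)
    show "ne2 z (- b)" using neb by (simp add: cz1)
    have "ne2 b q" using q ne_ab ne_XY[of q] by auto
    then show "ne2 q (- b)" using ne2_sym by simp
    fix r s assume rs: "(r,s) \<in> edges 1 (z # i2 # b # X')"
    have "r \<in> set AA" "s \<in> set AA" using pe_set[of r s "(z # i2 # b # X') @ [z]"] rs by (auto simp: edges_def AA_def)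
    then show "\<not> Y q (- b) r s" using q hA hA[OF bA] by (intro no_Y_hemi[of "set AA" hA]) auto
  qed
  then have PA: "\<not> inside AA (- b)" using outside_A[OF q(1)] by simp
  have nlB: "- l \<notin> set BB" using neg_notin'[of l] by (auto simp: BB_def)
  have naB: "- a \<notin> set BB" using neg_notin[OF gen_pos, of a] by (auto simp: BB_def)
  have nbB: "- b \<notin> set BB" using neg_notin'[of b] by (auto simp: BB_def)
  have gB: "generic S" if "S \<subseteq> set (a # b # X' @ u # Y' @ [l]) \<union> uminus ` set (a # b # X' @ u # Y' @ [l])" for S
    by (rule gset_gp_neg[OF gen_pos that])
  have gpB': "gen_pos (u # Y' @ [l])" using gpB by (simp add: BB_def)
  have "inside BB x = inside BB (- l)" unfolding BB_def
  proof (rule target_move[OF gpB'])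
    show "generic ({x, - l} \<union> set (u # Y' @ [l]))" using x by (intro gB) auto
    show "x \<notin> set (u # Y' @ [l])" using x hB[of x] by (fastforce simp: BB_def)
    show "- l \<notin> set (u # Y' @ [l])" using nlB by (simp add: BB_def)
    show "ne2 u x" using x neb ne_XY[of x] by auto
    show "ne2 u (- l)" using neb by simp
    have "ne2 l x" using x ne_ab ne_XY[of x] ne2_sym[of l b] by auto
    then show "ne2 x (- l)" using ne2_sym by simp
    fix r s assume rs: "(r,s) \<in> edges 1 (u # Y' @ [l])"
    have "r \<in> set BB" "s \<in> set BB" using pe_set[of r s "(u # Y' @ [l]) @ [u]"] rs by (auto simp: edges_def BB_def)
    then show "\<not> Y x (- l) r s" using x hB hB[OF lB] by (intro no_Y_hemi[of "set BB" hB]) auto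
  qed
  \<comment> \<open>From -l the target follows the antipodes of the edges la and ab, which cross no
    edge of BB.\<close>
  also have "inside BB (- l) = inside BB (- a)" unfolding BB_def
  proof (rule target_move[OF gpB'])
    show "generic ({- l, - a} \<union> set (u # Y' @ [l]))" by (intro gB) auto
    show "- l \<notin> set (u # Y' @ [l])" "- a \<notin> set (u # Y' @ [l])" using nlB naB by (simp_all add: BB_def)
    show "ne2 u (- l)" "ne2 u (- a)" "ne2 (- l) (- a)" using neb ne_ab ne2_sym[of l a] by simp_all
    fix r s assume "(r,s) \<in> edges 1 (u # Y' @ [l])"
    then have "(r,s) \<in> E0 \<or> (r,s) = (l,u)" using edgB1 in_E0 by (auto simp: BB_def)
    then have "\<not> X (- l) (- a) r s" using nca by (auto simp: cz1)
    then show "\<not> Y (- l) (- a) r s" using Y_imp_X by blast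
  qed
  also have "inside BB (- a) = inside BB (- b)" unfolding BB_def
  proof (rule target_move[OF gpB'])
    show "generic ({- a, - b} \<union> set (u # Y' @ [l]))" by (intro gB) auto
    show "- a \<notin> set (u # Y' @ [l])" "- b \<notin> set (u # Y' @ [l])" using nbB naB by (simp_all add: BB_def)
    show "ne2 u (- a)" "ne2 u (- b)" "ne2 (- a) (- b)" using neb ne_ab by simp_all
    fix r s assume "(r,s) \<in> edges 1 (u # Y' @ [l])"
    then have "(r,s) \<in> E0 \<or> (r,s) = (l,u)" using edgB1 in_E0 by (auto simp: BB_def)
    then have "\<not> X (- a) (- b) r s" using nab X_extra(2) by (auto simp: cz1)
    then show "\<not> Y (- a) (- b) r s" using Y_imp_X by blast
  qed
  finally have PB: "\<not> inside BB (- b)" using outside_B[OF x(1)] by simp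
  have uz: "u = z" by (simp add: cz1)
  have "\<not> left_sector prev u i2 (- b)"
  proof -
    have "D u i2 (- b) < 0" using zk by (simp add: uz i2)
    then show ?thesis using i2p by (simp add: left_sector_def k1 uz)
  qed
  moreover have "last (u # i2 # b # X') = prev" by (simp add: prev_def)
  ultimately have cA: "\<not> crossing_parity u (- b) (b # X')" using PA unfolding AAu by (simp add: inside_def)
  have "\<not> left_sector l u nxt (- b)"
  proof -
    have "D l u nxt > 0" using nxt_pos[OF Yne] by (simp add: cz1 k1)
    moreover have "D l u (- b) < 0" using zk D_swap(2)[of l u b] by (simp add: cz1)
    ultimately show ?thesis by (simp add: left_sector_def)
  qed
  then have cB: "\<not> crossing_parity u (- b) (Y' @ [l])" using PB by (simp add: inside_def BB_def nxt_def)
  \<comment> \<open>On the whole polygon the arc from u to -b meets, besides edges already counted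
    for the loops, only la; the edge ab ends at b and cannot be counted.\<close>
  have Yla: "Y u (- b) l a"
  proof -
    have "D l a (-b) < 0" "D u l a > 0" "D u (-b) a > 0" "D u (-b) l < 0"
      using zk D by (simp_all add: cz1 D_coord algebra_simps)
    moreover have "D (- b) l a = D l a (- b)" by (rule D_cyc)
    ultimately show ?thesis unfolding Y_def by simp
  qed
  have "crossing_parity u (- b) (Y' @ [l, a, b] @ X')"
  proof -
    have "crossing_parity u (- b) (Y' @ [l, a, b] @ X') = (crossing_parity u (- b) (Y' @ [l]) \<noteq> crossing_parity u (- b) (l # a # b # X'))"
      using crp_append[of u "- b" Y' l "a # b # X'"] by simp
    then show ?thesis using cA cB Yla by simp
  qed
  moreover have "left_sector prev u nxt (- b)"
  proof -
    have "D prev u nxt \<noteq> 0"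
    proof -
      have "ne2 prev u" "ne2 u nxt" using E0_mem[OF prev_edge] E0_mem[OF nxt_edge] by auto
      moreover have nin: "nxt \<in> set Y'" using Yne by (simp add: nxt_def)
      moreover have "ne2 prev nxt" using prev_in nin sd ne_XY[OF UnI2[OF nin]] by (auto simp: sdist_append)
      ultimately show ?thesis using prev_in by (intro gnz) auto
    qed
    then have dneg: "D prev u nxt < 0" using touch_turn by (simp add: dj_def)
    \<comment> \<open>The polygon turns right at u, so the left sector is the union of two half
      planes. A Pluecker relation shows that -b cannot be outside both.\<close>
    have "D prev u (- b) > 0 \<or> D u nxt (- b) > 0"
    proof (rule ccontr)
      assume "\<not> ?thesis"
      then have 1: "D prev u b \<ge> 0" "D u nxt b \<ge> 0" by auto
      have 2: "D l u prev > 0" "D l u nxt > 0" using prev_pos nxt_pos[OF Yne] by (simp_all add: cz1 k1)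
      have 3: "D l u b > 0" using zk by (simp add: cz1)
      have "D prev u nxt * D l u b = D l u prev * D u nxt b + D prev u b * D l u nxt"
        by (simp add: D_coord algebra_simps)
      moreover have "\<dots> \<ge> 0" using 1 2 by simp
      moreover have "D prev u nxt * D l u b < 0" using dneg 3 by (simp add: mult_neg_pos)
      ultimately show False by linarith
    qed
    then show ?thesis using dneg by (auto simp: left_sector_def)
  qed
  moreover have "last (u # Y' @ [l, a, b] @ X') = prev" "hd (Y' @ [l, a, b] @ X') = nxt"
    using Yne unfolding prev_def nxt_def by (auto simp: hd_append)
  ultimately have "\<not> inside (u # Y' @ [l, a, b] @ X') (- b)" by (simp add: inside_def)
  moreover have "inside (u # Y' @ [l, a, b] @ X') (- b) = antipodal_side (u # Y' @ [l, a, b] @ X')"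
    by (rule side_target) (use rotated[OF e1] in auto)
  ultimately show False using antipodal_side rotated[OF e1] by simp
qed

end

end

subsection \<open>Simple polygons outside every hemisphere\<close>

lemma rot_sgl: assumes "gen_pos ps" shows "turn_signs 1 ((rot1 1 ^^ k) ps) = rotate k (turn_signs 1 ps)"
proof (induction k)
  case (Suc k)
  have g: "gen_pos ((rot1 1 ^^ k) ps)" using rot1_pow[OF assms, of 1 k] by simp
  have ne: "turn_signs 1 ((rot1 1 ^^ k) ps) \<noteq> []" using length_sgl[of 1 "(rot1 1 ^^ k) ps"] g by (auto simp: gen_pos_def)
  have "rotate1 xs = tl xs @ [hd xs]" if "xs \<noteq> []" for xs :: "bool list" using that by (cases xs) auto
  then show ?case using rot1_sgl[OF g, of 1] Suc ne by simp
qed simp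

lemma set_tri_sub: "set (tri xs) \<subseteq> set (tri (us @ xs @ vs))"
proof -
  have a: "set (tri xs) \<subseteq> set (tri (xs @ vs))" for xs vs
  proof (induction xs rule: tri.induct)
    case (1 x y z r) then show ?case by auto
  qed auto
  have b: "set (tri ys) \<subseteq> set (tri (us @ ys))" for us ys
  proof (induction us)
    case (Cons u us)
    have "set (tri zs) \<subseteq> set (tri (u # zs))" for zs
    proof -
      consider "zs = []" | x where "zs = [x]" | x y r where "zs = x # y # r" by (metis list.exhaust)
      then show ?thesis by cases auto
    qed
    then show ?case using Cons by fastforce
  qed simp
  show ?thesis using a[of xs vs] b[of "xs @ vs" us] by auto
qed

lemma ch_0: "changes xs = 0 \<Longrightarrow> x \<in> set xs \<Longrightarrow> x = hd xs"
  by (induction xs rule: changes.induct) (auto split: if_splits)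

definition allpos :: "(real^3) list \<Rightarrow> bool" where "allpos ps \<longleftrightarrow> False \<notin> set (turn_signs 1 ps)"

lemma allpos_infl: assumes "gen_pos ps" "allpos ps" shows "inflections 1 ps = 0"
proof -
  have 1: "False \<notin> set xs \<Longrightarrow> changes xs = 0" for xs by (induction xs rule: changes.induct) auto
  have "turn_signs 1 ps \<noteq> []" using length_sgl[of 1 ps] assms by (auto simp: gen_pos_def)
  then have "hd (turn_signs 1 ps) \<in> set (turn_signs 1 ps)" by simp
  then have "hd (turn_signs 1 ps)" using assms(2) unfolding allpos_def by (metis (full_types))
  then show ?thesis using assms(2) unfolding inflections_def allpos_def by (intro 1) simp
qed

lemma infl_0_allpos: assumes "inflections 1 ps = 0" "True \<in> set (turn_signs 1 ps)" shows "allpos ps"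
proof -
  have "x = hd (turn_signs 1 ps @ [flip_sign 1 (hd (turn_signs 1 ps))])" if "x \<in> set (turn_signs 1 ps)" for x
    using ch_0[of "turn_signs 1 ps @ [flip_sign 1 (hd (turn_signs 1 ps))]" x] assms(1) that by (simp add: inflections_def)
  from this[of True] this[of False] show ?thesis using assms(2) unfolding allpos_def by blast
qed

definition convex_cycle :: "(real^3) list \<Rightarrow> bool" where
  "convex_cycle ps \<longleftrightarrow> (\<forall>A x B y C z E. ps = A @ x # B @ y # C @ z # E \<longrightarrow> D x y z > 0)"

text \<open>A first obstacle forces a right turn at u: by \<open>touch_turn\<close> or
  \<open>antipodal_turn\<close>, and by \<open>prev_pos\<close> if u is adjacent to l.\<close>

lemma slide_not_allpos:
  assumes "slide 1 \<kappa> a b u l X' Y' l (\<kappa> *\<^sub>R u)" shows "\<not> allpos (a # b # X' @ u # Y' @ [l])"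
proof
  assume ap: "allpos (a # b # X' @ u # Y' @ [l])"
  interpret slide 1 \<kappa> a b u l X' Y' l "\<kappa> *\<^sub>R u" by fact
  obtain W where W: "b # X' = W @ [prev]" unfolding prev_def by (metis append_butlast_last_id list.distinct(1))
  obtain Q where Q: "Y' @ [l] = nxt # Q" unfolding nxt_def by (metis list.collapse snoc_eq_iff_butlast)
  have E: "(l # a # b # X' @ u # Y' @ [l]) @ [a] = (l # a # W) @ [prev, u, nxt] @ (Q @ [a])"
    using W Q by (metis append.assoc append_Cons append_Nil)
  have S: "turn_signs 1 (a # b # X' @ u # Y' @ [l]) = tri ((l # a # b # X' @ u # Y' @ [l]) @ [a])"
    by (simp add: turn_signs_def)
  have "set (tri [prev, u, nxt]) \<subseteq> set (turn_signs 1 (a # b # X' @ u # Y' @ [l]))"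
    unfolding S E by (rule set_tri_sub)
  then have pos: "D prev u nxt > 0" using ap by (simp add: allpos_def) (metis (full_types))
  show False
  proof (cases "Y' = []")
    case True
    have k1: "\<kappa> = 1" using degenerate(1)[OF True] by simp
    have "nxt = l" unfolding nxt_def using True by simp
    moreover have "D l u prev > 0" using prev_pos by (simp add: k1)
    moreover have "D prev u l = - D l u prev" by (rule D_swap)
    ultimately show ?thesis using pos by simp
  next
    case False
    obtain \<rho> i2 where "slide2 1 \<kappa> a b u l X' Y' l (\<kappa> *\<^sub>R u) \<rho> i2" using slide2_exists[OF False] .
    then interpret slide2 1 \<kappa> a b u l X' Y' l "\<kappa> *\<^sub>R u" \<rho> i2 .
    have "\<not> dj" using k touch_turn antipodal_turn by auto
    then show ?thesis using pos by (simp add: dj_def)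
  qed
qed

text \<open>There can be no obstacle, so \<open>delete_vertex\<close> applies and leaves no sign
  change. A triple not involving a keeps its positive sign, which determines all the others.\<close>

lemma allpos_delete:
  assumes gen_pos: "gen_pos (a # b # M @ [l])" and s: "simple 1 (a # b # M @ [l])" and ap: "allpos (a # b # M @ [l])" and M: "M \<noteq> []"
  shows "gen_pos (b # M @ [l])" "simple 1 (b # M @ [l])" "allpos (b # M @ [l])"
proof -
  have D: "D (1 *\<^sub>R l) a b > 0" using ap by (simp add: allpos_def turn_signs_def)
  have free: "swept_free (1 *\<^sub>R l) a b b (set M)"
  proof (rule ccontr)
    assume nf: "\<not> swept_free (1 *\<^sub>R l) a b b (set M)"
    obtain X' u Y' \<kappa> where "M = X' @ u # Y'" "slide 1 \<kappa> a b u l X' Y' (1 *\<^sub>R l) (\<kappa> *\<^sub>R u)"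
      using obstacle[OF gen_pos _ s D nf] by blast
    then show False using slide_not_allpos ap by simp
  qed
  note d = delete_vertex[OF gen_pos M _ s D free]
  show "gen_pos (b # M @ [l])" "simple 1 (b # M @ [l])" using d by auto
  have "inflections 1 (b # M @ [l]) = 0" using d(3) allpos_infl[OF gen_pos ap] by simp
  moreover have "True \<in> set (turn_signs 1 (b # M @ [l]))"
  proof -
    have "tri (b # M @ [l]) \<noteq> []" using length_tri[of "b # M @ [l]"] M by auto
    then obtain t where t: "t \<in> set (tri (b # M @ [l]))" by (metis last_in_set)
    then have "t \<in> set (turn_signs 1 (a # b # M @ [l]))" using set_tri_sub[of "b # M @ [l]" "[l, a]" "[a]"] by (auto simp: turn_signs_def)
    then have "t = True" using ap unfolding allpos_def by (metis (full_types))
    then show ?thesis using t set_tri_sub[of "b # M @ [l]" "[l]" "[b]"] by (auto simp: turn_signs_def)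
  qed
  ultimately show "allpos (b # M @ [l])" by (rule infl_0_allpos)
qed

text \<open>Any vertex other than x, y, z can be rotated to the head and deleted, until only the
  triangle x, y, z is left.\<close>

lemma allpos_cvx: "gen_pos ps \<Longrightarrow> simple 1 ps \<Longrightarrow> allpos ps \<Longrightarrow> convex_cycle ps"
proof (induction "length ps" arbitrary: ps rule: less_induct)
  case less
  have del: "convex_cycle (vs @ us)" if ps: "ps = us @ v # vs" and n: "length ps \<ge> 4" for us v vs
  proof -
    let ?qs = "v # vs @ us"
    have q: "gen_pos ?qs" "simple 1 ?qs" using side_split[of us "v # vs"] less(2,3) ps by simp_all
    have "?qs = (rot1 1 ^^ length us) ps" using rot1_pow_append[where e=1 and us=us and vs="v#vs"] by (simp add: ps)
    then have "turn_signs 1 ?qs = rotate (length us) (turn_signs 1 ps)" using rot_sgl[OF less(2)] by simp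
    then have ap: "allpos ?qs" using less(4) by (simp add: allpos_def)
    obtain a b M l where L: "?qs = a # b # M @ [l]" using gp_list[OF q(1)] .
    have lenq: "length ?qs = length ps" by (simp add: ps)
    have M: "M \<noteq> []" using n lenq by (auto simp: L)
    have r: "vs @ us = b # M @ [l]" using L by simp
    note d = allpos_delete[OF q(1)[unfolded L] q(2)[unfolded L] ap[unfolded L] M]
    have "length (vs @ us) < length ps" by (simp add: ps)
    then show ?thesis using less(1)[of "vs @ us"] d unfolding r by blast
  qed
  show ?case unfolding convex_cycle_def
  proof (intro allI impI)
    fix A x B y C z E assume ps: "ps = A @ x # B @ y # C @ z # E"
    show "D x y z > 0"
    proof (cases "A = [] \<and> B = [] \<and> C = [] \<and> E = []")
      case True
      then show ?thesis using less(4) by (auto simp: ps allpos_def turn_signs_def)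
    next
      case False
      then have n: "length ps \<ge> 4" by (auto simp: ps Suc_le_eq)
      consider A' v where "A = A' @ [v]" | v B' where "B = v # B'" | v C' where "C = v # C'" | v E' where "E = v # E'"
        using False by (metis append_butlast_last_id list.exhaust)
      then show ?thesis
      proof cases
        case 1
        have "convex_cycle ((x # B @ y # C @ z # E) @ A')" using del[of A' v "x # B @ y # C @ z # E"] n 1 ps by simp
        moreover have "(x # B @ y # C @ z # E) @ A' = [] @ x # B @ y # C @ z # (E @ A')" by simp
        ultimately show ?thesis unfolding convex_cycle_def by blast
      next
        case 2
        have "convex_cycle ((B' @ y # C @ z # E) @ (A @ [x]))" using del[of "A @ [x]" v "B' @ y # C @ z # E"] n 2 ps by simp
        moreover have "(B' @ y # C @ z # E) @ (A @ [x]) = B' @ y # C @ z # (E @ A) @ x # []" by simp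
        ultimately have "D y z x > 0" unfolding convex_cycle_def by blast
        then show ?thesis using D_cyc(1)[of y z x] by simp
      next
        case 3
        have "convex_cycle ((C' @ z # E) @ (A @ x # B @ [y]))" using del[of "A @ x # B @ [y]" v "C' @ z # E"] n 3 ps by simp
        moreover have "(C' @ z # E) @ (A @ x # B @ [y]) = C' @ z # (E @ A) @ x # B @ y # []" by simp
        ultimately have "D z x y > 0" unfolding convex_cycle_def by blast
        then show ?thesis using D_cyc(2)[of z x y] by simp
      next
        case 4
        have "convex_cycle (E' @ (A @ x # B @ y # C @ [z]))" using del[of "A @ x # B @ y # C @ [z]" v "E'"] n 4 ps by simp
        moreover have "E' @ (A @ x # B @ y # C @ [z]) = (E' @ A) @ x # B @ y # C @ z # []" by simp
        ultimately show ?thesis unfolding convex_cycle_def by blast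
      qed
    qed
  qed
qed

text \<open>Each cross product in h is nonnegative on all vertices by convexity, and every vertex is
  off at least one of the three edges l x0, x0 x1, x1 x2.\<close>

lemma cvx_hemi: assumes c: "convex_cycle ps" and n: "length ps \<ge> 3" shows "in_hemisphere ps"
proof -
  obtain x0 x1 x2 R where ps: "ps = x0 # x1 # x2 # R"
    using n by (metis One_nat_def Suc_le_length_iff numeral_3_eq_3)
  define l where "l = last (x2 # R)"
  have P0: "D x0 x1 y > 0" if yin: "y \<in> set (x2 # R)" for y
  proof -
    obtain C E where "x2 # R = C @ y # E" using split_list[OF yin] by blast
    then have "ps = [] @ x0 # [] @ x1 # C @ y # E" by (simp add: ps)
    then show ?thesis using c unfolding convex_cycle_def by blast
  qed
  have P1: "D x1 x2 y > 0" if yin: "y \<in> set R" for y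
  proof -
    obtain C E where "R = C @ y # E" using split_list[OF yin] by blast
    then have "ps = [x0] @ x1 # [] @ x2 # C @ y # E" by (simp add: ps)
    then show ?thesis using c unfolding convex_cycle_def by blast
  qed
  have P2: "D x0 y l \<ge> 0" if yin: "y \<in> set (x2 # R)" for y
  proof -
    obtain C E where CE: "x2 # R = C @ y # E" using split_list[OF yin] by blast
    show ?thesis
    proof (cases E rule: rev_cases)
      case Nil
      then have "y = l" unfolding l_def CE by simp
      then show ?thesis by simp
    next
      case (snoc E' m)
      then have "m = l" unfolding l_def CE by simp
      then have "ps = [] @ x0 # (x1 # C) @ y # E' @ l # []" using CE snoc by (simp add: ps)
      then have "D x0 y l > 0" using c unfolding convex_cycle_def by blast
      then show ?thesis by simp
    qed
  qed
  have lin: "l \<in> set (x2 # R)" unfolding l_def by (rule last_in_set) simp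
  define h where "h = cross3 l x0 + cross3 x0 x1 + cross3 x1 x2"
  have h: "h \<bullet> y = D l x0 y + D x0 x1 y + D x1 x2 y" for y
    unfolding h_def D_coord by (simp add: cross3_def inner_vec_def sum_3 algebra_simps)
  have e: "D l x0 y = D x0 y l" for y by (rule D_cyc)
  have e2: "D x0 x1 x2 > 0" using P0 by simp
  have "h \<bullet> y > 0" if yin: "y \<in> set ps" for y
  proof -
    consider "y = x0" | "y = x1" | "y = x2" | "y \<in> set R" using yin by (auto simp: ps)
    then show ?thesis
    proof cases
      case 1 then show ?thesis using e2 D_cyc(1)[of x1 x2 x0] by (simp add: h)
    next
      case 2 then show ?thesis using P0[OF lin] e[of x1] by (simp add: h)
    next
      case 3 then show ?thesis using P2[of x2] e2 e[of x2] by (simp add: h)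
    next
      case 4
      then have m: "y \<in> set (x2 # R)" by simp
      show ?thesis using P2[OF m] P0[OF m] P1[OF 4] e[of y] by (simp add: h)
    qed
  qed
  then show ?thesis unfolding in_hemisphere_def by blast
qed

lemma hemi_uminus: "in_hemisphere (map uminus ps) = in_hemisphere ps"
proof -
  have "in_hemisphere (map uminus ps) \<Longrightarrow> in_hemisphere ps" for ps
  proof -
    assume "in_hemisphere (map uminus ps)"
    then obtain h where "\<forall>x\<in>set ps. h \<bullet> (- x) > 0" by (auto simp: in_hemisphere_def)
    then show ?thesis unfolding in_hemisphere_def by (intro exI[of _ "- h"]) simp
  qed
  from this[of ps] this[of "map uminus ps"] show ?thesis by (auto simp: o_def)
qed

text \<open>With \<open>antipodal_side\<close> true and a left turn at a, the turn at the obstacle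
  is always to the right, whatever \<kappa> is.\<close>

theorem simple_nonhemi: "gen_pos ps \<Longrightarrow> simple 1 ps \<Longrightarrow> \<not> in_hemisphere ps \<Longrightarrow> 6 \<le> inflections 1 ps"
proof (induction "length ps" arbitrary: ps rule: less_induct)
  case less
  have u1: "unit_sign 1" by simp
  have main: "6 \<le> inflections 1 ps" if gen_pos: "gen_pos ps" and s: "simple 1 ps" and nh: "\<not> in_hemisphere ps" and sp: "antipodal_side ps"
      and ps: "ps = a # b # M @ [l]" and D: "D (1 *\<^sub>R l) a b > 0"
      and IH: "\<And>qs. length qs < length ps \<Longrightarrow> gen_pos qs \<Longrightarrow> simple 1 qs \<Longrightarrow> \<not> in_hemisphere qs \<Longrightarrow> 6 \<le> inflections 1 qs" for ps a b M l
  proof (cases "M = []")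
    case True
    have "D a b l = D l a b" "D b l a = D l a b" by (rule D_cyc)+
    then have "allpos ps" using D by (simp add: allpos_def turn_signs_def ps True)
    then have "in_hemisphere ps" using allpos_cvx[OF gen_pos s] cvx_hemi gen_pos unfolding gen_pos_def by blast
    then show ?thesis using nh by blast
  next
    case M: False
    show ?thesis
    proof (cases "swept_free (1 *\<^sub>R l) a b b (set M)")
      case True
      note d = delete_vertex[OF gen_pos[unfolded ps] M u1 s[unfolded ps] D True]
      have "\<not> in_hemisphere (b # M @ [l])"
        by (rule delete_keeps_nonhemi[of a]) (use gen_pos s M D sp nh in \<open>auto simp: ps\<close>)
      then show ?thesis using d IH[of "b # M @ [l]"] unfolding ps by fastforce
    next
      case False
      obtain X' u Y' \<kappa> where MX: "M = X' @ u # Y'" and sl: "slide 1 \<kappa> a b u l X' Y' (1 *\<^sub>R l) (\<kappa> *\<^sub>R u)"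
        using obstacle[OF gen_pos[unfolded ps] u1 s[unfolded ps] D False] by blast
      interpret slide 1 \<kappa> a b u l X' Y' "1 *\<^sub>R l" "\<kappa> *\<^sub>R u" by (rule sl)
      show ?thesis
      proof (cases "Y' = []")
        case True
        define L where "L = 1 *\<^sub>R l # a # (b # X') @ [u]"
        note d = degenerate_delete[OF True, folded L_def]
        have e: "ps = a # b # X' @ u # Y' @ [l]" by (simp add: ps MX)
        have "antipodal_side L" using side_rot[OF d(1,2)] d(4) sp unfolding e by simp
        moreover have "\<not> in_hemisphere L" using nh unfolding in_hemisphere_def e L_def using True by auto
        ultimately have "\<not> in_hemisphere (a # (b # X') @ [u])"
          by (intro delete_keeps_nonhemi[of "1 *\<^sub>R l"]) (use d in \<open>auto simp: L_def\<close>)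
        moreover have "gen_pos (a # (b # X') @ [u])" "simple 1 (a # (b # X') @ [u])" "inflections 1 (a # (b # X') @ [u]) \<le> inflections 1 L"
          using delete_vertex[OF d(1)[unfolded L_def] _ u1 d(2)[unfolded L_def] d(5,6)] by (auto simp: L_def)
        ultimately show ?thesis using IH[of "a # (b # X') @ [u]"] d(3) e True by fastforce
      next
        case Y: False
        obtain \<rho> i2 where "slide2 1 \<kappa> a b u l X' Y' (1 *\<^sub>R l) (\<kappa> *\<^sub>R u) \<rho> i2" using slide2_exists[OF Y] .
        then interpret slide2 1 \<kappa> a b u l X' Y' "1 *\<^sub>R l" "\<kappa> *\<^sub>R u" \<rho> i2 .
        have e: "ps = a # b # X' @ u # Y' @ [l]" by (simp add: ps MX)
        show ?thesis using k
        proof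
          assume k1: "\<kappa> = 1"
          \<comment> \<open>The turn at u disagrees with that of the loops; as \<kappa> = e = 1,
            neither loop has more inflections than the polygon.\<close>
          have nd: "dj \<noteq> flip_sign \<kappa> True" using touch_turn k1 by simp
          have F: "inflections \<kappa> AA \<le> inflections 1 ps" "inflections (1 * \<kappa>) BB \<le> inflections 1 ps" using infl_opp[OF nd] k1 e by simp_all
          have lenA: "length AA < length ps" unfolding e AA_def by simp
          have lenB: "length BB < length ps" unfolding e BB_def by simp
          have "\<not> in_hemisphere AA \<or> \<not> in_hemisphere BB" using loop_nonhemi[OF _ k1] sp nh e by simp
          then show ?thesis
          proof
            assume "\<not> in_hemisphere AA"
            then have "6 \<le> inflections \<kappa> AA" using IH[OF lenA gpA] simpleA by (simp add: k1)
            then show ?thesis using F by linarith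
          next
            assume "\<not> in_hemisphere BB"
            then have "6 \<le> inflections (1 * \<kappa>) BB" using IH[OF lenB gpB] simpleB by (simp add: k1)
            then show ?thesis using F by linarith
          qed
        next
          assume k1: "\<kappa> = -1"
          \<comment> \<open>The turn at u agrees with that of BB, so the inflections of the two
            antipodally closing loops add up, giving 3 + 3.\<close>
          have "dj = flip_sign \<kappa> True" using antipodal_turn k1 by simp
          then have F: "inflections \<kappa> AA + inflections (1 * \<kappa>) BB \<le> inflections 1 ps" using infl_same e by simp
          have "3 \<le> inflections \<kappa> AA" using moebius[OF gpA] simpleA by (simp add: k1)
          moreover have "3 \<le> inflections (1 * \<kappa>) BB" using moebius[OF gpB] simpleB by (simp add: k1)
          ultimately show ?thesis using F by linarith
        qed
      qed
    qed
  qed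
  have main2: "6 \<le> inflections 1 ps" if gen_pos: "gen_pos ps" and s: "simple 1 ps" and nh: "\<not> in_hemisphere ps" and sp: "antipodal_side ps"
      and IH: "\<And>qs. length qs < length ps \<Longrightarrow> gen_pos qs \<Longrightarrow> simple 1 qs \<Longrightarrow> \<not> in_hemisphere qs \<Longrightarrow> 6 \<le> inflections 1 qs" for ps
  proof -
    \<comment> \<open>If all turns were to the right, the antipodal polygon would be convex and lie
      in a hemisphere. So some rotation starts with a left turn.\<close>
    have "True \<in> set (turn_signs 1 ps)"
    proof (rule ccontr)
      assume "True \<notin> set (turn_signs 1 ps)"
      then have ap: "allpos (map uminus ps)" unfolding allpos_def sgl_uminus[OF gen_pos u1] by auto
      have "ps \<noteq> []" using gen_pos by (auto simp: gen_pos_def)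
      have "convex_cycle (map uminus ps)" by (rule allpos_cvx[OF gp_uminus[OF gen_pos] _ ap]) (use s simple_uminus \<open>ps \<noteq> []\<close> in auto)
      then have "in_hemisphere (map uminus ps)" using cvx_hemi gp_uminus[OF gen_pos] unfolding gen_pos_def by blast
      then show False using nh hemi_uminus by blast
    qed
    then obtain k where k: "k < length (turn_signs 1 ps)" "turn_signs 1 ps ! k" by (metis in_set_conv_nth)
    define qs where "qs = (rot1 1 ^^ k) ps"
    have q: "gen_pos qs" "simple 1 qs" "inflections 1 qs = inflections 1 ps" "length qs = length ps" "antipodal_side qs"
      using rot1_pow[OF gen_pos u1, of k] s side_rot_pow[OF gen_pos s, of k] sp by (simp_all add: qs_def)
    have "set ((rot1 1 ^^ k) ps) = set ps"
    proof (induction k)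
      case (Suc k)
      have "(rot1 1 ^^ k) ps \<noteq> []" using rot1_pow[OF gen_pos u1, of k] by (auto simp: gen_pos_def)
      then have "set (rot1 1 ((rot1 1 ^^ k) ps)) = set ((rot1 1 ^^ k) ps)" by (cases "(rot1 1 ^^ k) ps") (auto simp: rot1_def)
      then show ?case using Suc by simp
    qed simp
    then have "\<not> in_hemisphere qs" using nh by (simp add: in_hemisphere_def qs_def)
    obtain a b M l where L: "qs = a # b # M @ [l]" using gp_list[OF q(1)] .
    have "turn_signs 1 ps \<noteq> []" using k(1) by auto
    then have "hd (turn_signs 1 qs) = turn_signs 1 ps ! k" using rot_sgl[OF gen_pos, of k] k(1) hd_rotate_conv_nth[of "turn_signs 1 ps" k] by (auto simp: qs_def)
    then have "D (1 *\<^sub>R l) a b > 0" using k(2) by (simp add: L turn_signs_def)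
    then show ?thesis using main[OF q(1,2) \<open>\<not> in_hemisphere qs\<close> q(5) L] IH q by simp
  qed
  show ?case
  proof (cases "antipodal_side ps")
    case True then show ?thesis using main2[OF less(2-4)] less(1) by blast
  next
    case False
    have "ps \<noteq> []" using less(2) by (auto simp: gen_pos_def)
    \<comment> \<open>Passing to the antipodal polygon exchanges the sides, by
      \<open>side_uminus\<close>.\<close>
    have "6 \<le> inflections 1 (map uminus ps)"
      by (rule main2) (use less gp_uminus simple_uminus hemi_uminus side_uminus False \<open>ps \<noteq> []\<close> in auto)
    then show ?thesis using infl_uminus[OF less(2) u1] by simp
  qed
qed

subsection \<open>Perturbations and counting of crossings\<close>

text \<open>T stands in for t: it avoids the planes spanned by two points of S, and is on the same
  side as t of those that avoid t.\<close>

definition near :: "(real^3) set \<Rightarrow> real^3 \<Rightarrow> real^3 \<Rightarrow> bool" where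
  "near S t T \<longleftrightarrow> (\<forall>x\<in>S. \<forall>y\<in>S. ((\<exists>z. D x y z \<noteq> 0) \<longrightarrow> D x y T \<noteq> 0) \<and> (D x y t \<noteq> 0 \<longrightarrow> D x y t * D x y T > 0))"

text \<open>The linear form \<open>D x y\<close> is determined by its values on the basis a, b, t;
  if it vanishes there, it vanishes everywhere.\<close>

lemma D_expand: "D x y z * D a b t = D x y a * D z b t + D x y b * D a z t + D x y t * D a b z"
  by (simp add: D_coord algebra_simps)

lemma quadratic_eventually:
  fixes c0 c1 c2 :: real
  assumes "c0 \<noteq> 0 \<or> c1 \<noteq> 0 \<or> c2 \<noteq> 0"
  shows "\<forall>\<^sub>F e in at_right 0. c0 + e * c1 + e * (e * c2) \<noteq> 0 \<and> (c0 \<noteq> 0 \<longrightarrow> c0 * (c0 + e * c1 + e * (e * c2)) > 0)"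
proof -
  have pos: "\<forall>\<^sub>F e::real in at_right 0. e > 0" by (simp add: eventually_at_right_less)
  have lin: "\<forall>\<^sub>F e in at_right 0. c * (c + e * d + e * (e * f)) > 0" if "c \<noteq> 0" for c d f :: real
  proof -
    have "((\<lambda>e. c * (c + e * d + e * (e * f))) \<longlongrightarrow> c * (c + 0 * d + 0 * (0 * f))) (at_right 0)"
      by (intro tendsto_intros)
    then show ?thesis by (rule order_tendstoD) (use that in \<open>auto simp: zero_less_mult_iff\<close>)
  qed
  consider "c0 \<noteq> 0" | "c0 = 0" "c1 \<noteq> 0" | "c0 = 0" "c1 = 0" "c2 \<noteq> 0" using assms by blast
  then show ?thesis
  proof cases
    case 1
    then show ?thesis using lin[of c0 c1 c2] by (auto elim!: eventually_mono)
  next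
    case 2
    show ?thesis using eventually_conj[OF pos lin[OF 2(2), of c2 0]]
      by (rule eventually_mono) (auto simp: 2 ring_distribs simp flip: distrib_left)
  next
    case 3
    then show ?thesis using pos by (auto elim!: eventually_mono)
  qed
qed

text \<open>Along this quadratic curve every determinant with two points of S is a polynomial, which vanishes
  identically only if the two points are parallel.\<close>

lemma perturb:
  assumes "finite S" "D a b t \<noteq> 0"
  obtains e where "0 < e" "e < 1" "near S t (t + e *\<^sub>R a + (e * e) *\<^sub>R b)"
proof -
  have "\<forall>\<^sub>F e in at_right 0. \<forall>x\<in>S. \<forall>y\<in>S. ((\<exists>z. D x y z \<noteq> 0) \<longrightarrow> D x y (t + e *\<^sub>R a + (e * e) *\<^sub>R b) \<noteq> 0) \<and>
     (D x y t \<noteq> 0 \<longrightarrow> D x y t * D x y (t + e *\<^sub>R a + (e * e) *\<^sub>R b) > 0)"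
  proof (intro eventually_ball_finite ballI assms(1))
    fix x y
    have E: "D x y (t + e *\<^sub>R a + (e * e) *\<^sub>R b) = D x y t + e * D x y a + e * (e * D x y b)" for e by simp
    show "\<forall>\<^sub>F e in at_right 0. ((\<exists>z. D x y z \<noteq> 0) \<longrightarrow> D x y (t + e *\<^sub>R a + (e * e) *\<^sub>R b) \<noteq> 0) \<and>
     (D x y t \<noteq> 0 \<longrightarrow> D x y t * D x y (t + e *\<^sub>R a + (e * e) *\<^sub>R b) > 0)"
    proof (cases "\<exists>z. D x y z \<noteq> 0")
      case True
      then have "D x y t \<noteq> 0 \<or> D x y a \<noteq> 0 \<or> D x y b \<noteq> 0"
        using D_expand[of x y _ a b t] assms(2) by (metis add_0 mult_eq_0_iff mult_zero_left)
      then show ?thesis unfolding E by (rule eventually_mono[OF quadratic_eventually]) auto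
    next
      case False
      then show ?thesis by simp
    qed
  qed
  moreover have "\<forall>\<^sub>F e::real in at_right 0. 0 < e \<and> e < 1"
    unfolding eventually_at_right_field by (intro exI[of _ 1]) auto
  ultimately have "\<forall>\<^sub>F e in at_right 0. (0 < e \<and> e < 1) \<and> near S t (t + e *\<^sub>R a + (e * e) *\<^sub>R b)"
    unfolding near_def by (auto elim: eventually_elim2)
  then have "\<exists>e. (0 < e \<and> e < 1) \<and> near S t (t + e *\<^sub>R a + (e * e) *\<^sub>R b)"
    by (rule eventually_happens'[rotated]) simp
  then show ?thesis using that by blast
qed

lemma nearD: "near S t T \<Longrightarrow> x \<in> S \<Longrightarrow> y \<in> S \<Longrightarrow> D x y t \<noteq> 0 \<Longrightarrow> D x y t * D x y T > 0"
  unfolding near_def by blast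

lemma near_pos: assumes "near S t T" "x \<in> S" "y \<in> S" "D x y t \<noteq> 0" shows "(D x y T > 0) = (D x y t > 0)"
  using nearD[OF assms] by (auto simp: zero_less_mult_iff)

lemma near_nz: "near S t T \<Longrightarrow> x \<in> S \<Longrightarrow> y \<in> S \<Longrightarrow> D x y z \<noteq> 0 \<Longrightarrow> D x y T \<noteq> 0"
  unfolding near_def by blast

lemma near_mono: "near S t T \<Longrightarrow> S' \<subseteq> S \<Longrightarrow> near S' t T"
  unfolding near_def by blast

section \<open>Crossings under perturbation\<close>

lemma same_sign_mult: "a * b > 0 \<Longrightarrow> c * d > 0 \<Longrightarrow> (b * d < 0) = (a * c < (0::real))"
  by (auto simp: zero_less_mult_iff mult_less_0_iff)

text \<open>Signs pass from T to t, and from t to s because t is a positive combination of r and s.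
  If t lies in the plane xy itself, then r and s are on opposite sides of it anyway.\<close>

lemma near_cross:
  assumes n: "near S t T" and S: "x \<in> S" "y \<in> S" "r \<in> S" and t: "t = g *\<^sub>R r + d *\<^sub>R s" "g > 0" "d > 0"
    and nz: "D r s x \<noteq> 0" "D r s y \<noteq> 0" "D r x y \<noteq> 0" and X: "X r T x y"
  shows "X r s x y"
proof -
  have X': "D x y r * D x y T < 0" "D r x T * D r y T < 0"
    using X D_cyc(1)[of x y r] D_cyc(1)[of x y T] D_swap(2)[of r T x] D_swap(2)[of r T y] unfolding X_def by simp_all
  have "D r x t = - (d * D r s x)" "D r y t = - (d * D r s y)" using D_swap(2)[of r s] by (simp_all add: t)
  then have "D r x t \<noteq> 0" "D r y t \<noteq> 0" using nz t by auto
  then have "D r x t * D r y t < 0" using X'(2) nearD[OF n S(3) S(1)] nearD[OF n S(3) S(2)] same_sign_mult by blast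
  then have "d * d * (D r s x * D r s y) < 0" using \<open>D r x t = _\<close> \<open>D r y t = _\<close> by (simp add: mult_ac)
  then have 1: "D r s x * D r s y < 0" using t(3) by (simp add: mult_less_0_iff)
  have "D x y r * D x y t \<le> 0"
  proof (cases "D x y t = 0")
    case False
    then have "D x y t * D x y T > 0" using nearD[OF n S(1,2)] by blast
    then show ?thesis using X'(1) by (auto simp: zero_less_mult_iff mult_less_0_iff mult_le_0_iff)
  qed simp
  then have "g * (D x y r * D x y r) + d * (D x y r * D x y s) \<le> 0" by (simp add: t algebra_simps)
  moreover have "D x y r \<noteq> 0" using nz(3) D_cyc(1)[of x y r] by simp
  then have "g * (D x y r * D x y r) > 0" using t(2) by (auto simp: zero_less_mult_iff)
  ultimately have "d * (D x y r * D x y s) < 0" by linarith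
  then have "D x y r * D x y s < 0" using t(3) by (simp add: mult_less_0_iff)
  then show ?thesis using 1 D_cyc(1)[of x y r] D_cyc(1)[of x y s] unfolding X_def by simp
qed

lemma near_cross_end:
  assumes n: "near S t T" and S: "y \<in> S" "s \<in> S" and t: "t = g *\<^sub>R r + d *\<^sub>R s" "g > 0" and nz: "D r s y \<noteq> 0"
  shows "\<not> X r T s y"
proof -
  have "D s y t = g * D r s y" using D_cyc(1)[of s y r] by (simp add: t)
  then have "g * (D r s y * D s y T) > 0" using nearD[OF n S(2,1)] nz t(2) by (simp add: mult_ac)
  then have "D r s y * D s y T > 0" using t(2) by (simp add: zero_less_mult_iff)
  then show ?thesis using D_cyc(1)[of s y T] unfolding X_def by simp
qed

lemma near_gset:
  assumes g: "gen_pos ps" "near (set ps) t T"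
  shows "generic (insert T (set ps))" "x \<in> set ps \<Longrightarrow> ne2 x T"
proof -
  have third: "\<exists>z\<in>set ps. ne2 x z \<and> ne2 y z" if xy: "x \<in> set ps" "y \<in> set ps" for x y
  proof -
    obtain a b c R where ps: "ps = a # b # c # R"
      using g(1) unfolding gen_pos_def by (metis One_nat_def Suc_le_length_iff numeral_3_eq_3)
    have d: "pairwise_ne2 ps" using g(1) by (simp add: gen_pos_def)
    have "ne2 u w" if "u \<in> set ps" "w \<in> set ps" "u \<noteq> w" for u w
      using sdist_pair d that by blast
    moreover have "a \<noteq> b" "b \<noteq> c" "a \<noteq> c" using d by (auto simp: ps)
    moreover have "a \<in> set ps" "b \<in> set ps" "c \<in> set ps" by (auto simp: ps)
    ultimately show ?thesis using xy by metis
  qed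
  have nz: "D x y T \<noteq> 0" if xy: "x \<in> set ps" "y \<in> set ps" "ne2 x y" for x y
  proof -
    obtain z where "z \<in> set ps" "ne2 x z" "ne2 y z" using third xy by blast
    then have "D x y z \<noteq> 0" using gp_D[OF g(1)] xy by blast
    then show ?thesis using near_nz[OF g(2)] xy by blast
  qed
  show "generic (insert T (set ps))" using gset_insert[of "set ps" T] nz D_cyc(1)[of _ _ T] g(1) by (simp add: gen_pos_def)
  show "ne2 x T" if x: "x \<in> set ps"
  proof -
    obtain z where "z \<in> set ps" "ne2 x z" using third x by blast
    then have "D x z T \<noteq> 0" using nz x by blast
    then show ?thesis unfolding ne2_def by auto
  qed
qed

text \<open>Edges as unordered pairs, since reconnecting reverses part of the polygon.\<close>

definition XS :: "(real^3) set \<Rightarrow> (real^3) set \<Rightarrow> bool" where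
  "XS g h \<longleftrightarrow> (\<exists>p q r s. g = {p, q} \<and> h = {r, s} \<and> X p q r s)"

lemma XS_iff [simp]: "XS {p, q} {r, s} = X p q r s"
  unfolding XS_def by (auto simp: doubleton_eq_iff X_swap)

lemma XS_sym: "XS g h = XS h g"
  unfolding XS_def using X_sym by metis

definition undirected_steps :: "'a list \<Rightarrow> 'a set set" where "undirected_steps xs = (\<lambda>(x, y). {x, y}) ` steps xs"

lemma ue_simps [simp]: "undirected_steps [] = {}" "undirected_steps [x] = {}" "undirected_steps (x # y # zs) = insert {x, y} (undirected_steps (y # zs))"
  by (auto simp: undirected_steps_def)

lemma ue_append: "undirected_steps (xs @ u # ys) = undirected_steps (xs @ [u]) \<union> undirected_steps (u # ys)"
  unfolding undirected_steps_def by (subst pe_append) auto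

lemma ue_rev: "undirected_steps (rev xs) = undirected_steps xs"
proof (induction xs rule: steps.induct)
  case (1 x y zs)
  have "undirected_steps (rev (x # y # zs)) = undirected_steps (rev (y # zs)) \<union> {{y, x}}"
    using ue_append[of "rev zs" y "[x]"] by simp
  then show ?case using 1 by (auto simp: insert_commute)
qed auto

lemma finite_pe: "finite (steps xs)"
  by (induction xs rule: steps.induct) auto

lemma finite_ue: "finite (undirected_steps xs)"
  by (simp add: undirected_steps_def finite_pe)

lemma ue_set: "h \<in> undirected_steps xs \<Longrightarrow> h \<subseteq> set xs"
  unfolding undirected_steps_def using pe_set by fastforce

text \<open>Ordered pairs, so that every crossing weighs two, as in 2T.\<close>

definition num_crossings :: "(real^3) list \<Rightarrow> nat" where
  "num_crossings ps = card {(g, h). g \<in> undirected_steps (ps @ [hd ps]) \<and> h \<in> undirected_steps (ps @ [hd ps]) \<and> XS g h}"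

lemma finite_NC: "finite A \<Longrightarrow> finite B \<Longrightarrow> finite {(g, h). g \<in> A \<and> h \<in> B \<and> XS g h}"
  by (rule finite_subset[of _ "A \<times> B"]) auto

lemma noX_ue: "(\<forall>g\<in>undirected_steps xs. \<forall>h\<in>undirected_steps ys. \<not> XS g h) \<Longrightarrow> noX (steps xs) (steps ys)"
  unfolding noX_def undirected_steps_def by fastforce

lemma NC_0: assumes "num_crossings ps = 0" shows "simple 1 ps"
proof -
  have "{(g, h). g \<in> undirected_steps (ps @ [hd ps]) \<and> h \<in> undirected_steps (ps @ [hd ps]) \<and> XS g h} = {}"
    using assms finite_NC[OF finite_ue finite_ue] by (simp add: num_crossings_def)
  then show ?thesis unfolding simple_def edges_def by (intro noX_ue) auto
qed

text \<open>The map \<phi> sends each half to the edge it comes from. It is injective on crossing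
  pairs, since no edge of Z crosses both halves of one edge, and the pairs (e, f) and (f, e) are not
  hit, since the new edges do not cross each other.\<close>

lemma card_replace:
  fixes R :: "'a \<Rightarrow> 'a \<Rightarrow> bool"
  assumes fin: "finite Z" and sym: "\<And>g h. R g h = R h g"
    and ef: "R e f" "e \<noteq> f" "e \<notin> Z" "f \<notin> Z" and irr: "\<not> R e e" "\<not> R f f"
    and new: "f1 \<notin> Z" "f2 \<notin> Z" "e1 \<notin> Z" "e2 \<notin> Z" and dist: "{f1, f2} \<inter> {e1, e2} = {}"
    and nn: "\<And>g h. g \<in> {f1, f2, e1, e2} \<Longrightarrow> h \<in> {f1, f2, e1, e2} \<Longrightarrow> \<not> R g h"
    and f: "\<And>h. h \<in> Z \<Longrightarrow> R f1 h \<or> R f2 h \<Longrightarrow> R f h" "\<And>h. h \<in> Z \<Longrightarrow> \<not> (R f1 h \<and> R f2 h)"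
    and e: "\<And>h. h \<in> Z \<Longrightarrow> R e1 h \<or> R e2 h \<Longrightarrow> R e h" "\<And>h. h \<in> Z \<Longrightarrow> \<not> (R e1 h \<and> R e2 h)"
    and E: "E = insert e (insert f Z)" "E' = {f1, f2, e1, e2} \<union> Z"
  shows "card {(g, h). g \<in> E' \<and> h \<in> E' \<and> R g h} + 2 \<le> card {(g, h). g \<in> E \<and> h \<in> E \<and> R g h}"
proof -
  define \<phi> where "\<phi> g = (if g \<in> {f1, f2} then f else if g \<in> {e1, e2} then e else g)" for g
  let ?C' = "{(g, h). g \<in> E' \<and> h \<in> E' \<and> R g h}" and ?C = "{(g, h). g \<in> E \<and> h \<in> E \<and> R g h}"
  have \<phi>: "\<phi> f1 = f" "\<phi> f2 = f" "\<phi> e1 = e" "\<phi> e2 = e" "\<And>g. g \<in> Z \<Longrightarrow> \<phi> g = g"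
    using dist new by (auto simp: \<phi>_def)
  have one: "g = g'" if "g \<in> E'" "g' \<in> E'" "\<phi> g = \<phi> g'" "h \<in> E'" "h' \<in> E'" "\<phi> h = \<phi> h'" "R g h" "R g' h'" for g g' h h'
  proof (rule ccontr)
    assume ne: "g \<noteq> g'"
    have gg: "{g, g'} = {f1, f2} \<or> {g, g'} = {e1, e2}"
      using that(1-3) ne \<phi> ef unfolding E(2) by fastforce
    then have "h \<in> Z" "h' \<in> Z" using that(4,5,7,8) nn unfolding E(2) by blast+
    then have "h = h'" using that(6) \<phi>(5) by simp
    then show False using gg that(7,8) f(2) e(2) \<open>h \<in> Z\<close> by (metis doubleton_eq_iff)
  qed
  have inj: "inj_on (map_prod \<phi> \<phi>) ?C'"
  proof (rule inj_onI)
    fix x y assume a: "x \<in> ?C'" "y \<in> ?C'" "map_prod \<phi> \<phi> x = map_prod \<phi> \<phi> y"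
    obtain g h g' h' where xy: "x = (g, h)" "y = (g', h')" by (metis surj_pair)
    show "x = y" using a one[of g g' h h'] one[of h h' g g'] sym unfolding xy by auto
  qed
  have sub: "map_prod \<phi> \<phi> ` ?C' \<subseteq> ?C - {(e, f), (f, e)}"
  proof
    fix z assume "z \<in> map_prod \<phi> \<phi> ` ?C'"
    then obtain g h where gh: "z = (\<phi> g, \<phi> h)" "g \<in> E'" "h \<in> E'" "R g h" by auto
    consider "g \<in> Z" | "h \<in> Z" using gh nn unfolding E(2) by blast
    then show "z \<in> ?C - {(e, f), (f, e)}"
    proof cases
      case 1
      then have "\<phi> g = g" "g \<noteq> e" "g \<noteq> f" "g \<in> E" using \<phi> ef E by auto
      moreover have "R g (\<phi> h)" "\<phi> h \<in> E" using gh(3,4) 1 f(1)[of g] e(1)[of g] \<phi> sym unfolding E by auto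
      ultimately show ?thesis by (simp add: gh)
    next
      case 2
      then have "\<phi> h = h" "h \<noteq> e" "h \<noteq> f" "h \<in> E" using \<phi> ef E by auto
      moreover have "R (\<phi> g) h" "\<phi> g \<in> E" using gh(2,4) 2 f(1)[of h] e(1)[of h] \<phi> unfolding E by auto
      ultimately show ?thesis by (simp add: gh)
    qed
  qed
  have finC: "finite ?C" by (rule finite_subset[of _ "E \<times> E"]) (use fin in \<open>auto simp: E\<close>)
  have "card ?C' = card (map_prod \<phi> \<phi> ` ?C')" using inj by (simp add: card_image)
  also have "\<dots> \<le> card (?C - {(e, f), (f, e)})" using sub finC by (intro card_mono) auto
  also have "\<dots> = card ?C - 2" using ef sym[of e f] finC by (subst card_Diff_subset) (auto simp: E)
  finally have "card ?C' \<le> card ?C - 2" .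
  moreover have "card {(e, f), (f, e)} \<le> card ?C" using ef sym[of e f] finC by (intro card_mono) (auto simp: E)
  then have "2 \<le> card ?C" using ef by simp
  ultimately show ?thesis by linarith
qed

lemma tri_ends:
  assumes "\<And>h. h \<in> set (M @ [z]) \<Longrightarrow> (D x' y h > 0) = (D x y h > 0)"
    "\<And>h. h \<in> set (y # M) \<Longrightarrow> (D h z w' > 0) = (D h z w > 0)"
  shows "tri (x' # y # M @ [z, w']) = tri (x # y # M @ [z, w])"
proof -
  obtain N m where N: "y # M = N @ [m]" by (metis append_butlast_last_id list.distinct(1))
  have E: "y # M @ L = N @ m # L" for L using arg_cong[OF N, of "\<lambda>k. k @ L"] by simp
  have T: "tri (x # y # M @ [z, w]) = tri (x # y # M @ [z]) @ [D m z w > 0]" for x w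
    using tri_append[of "x # N" m z "[w]"] by (simp add: E)
  obtain k K where K: "M @ [z] = k # K" by (metis list.exhaust snoc_eq_iff_butlast)
  have "tri (x' # y # M @ [z]) = tri (x # y # M @ [z])" using assms(1)[of k] by (simp add: K)
  moreover have "m \<in> set (y # M)" by (simp add: N)
  then have "(D m z w' > 0) = (D m z w > 0)" by (rule assms(2))
  ultimately show ?thesis unfolding T by simp
qed

lemma tri_rev: "nzt xs \<Longrightarrow> tri (rev xs) = map Not (rev (tri xs))"
proof (induction xs rule: tri.induct)
  case (1 x y z r)
  have "tri (rev (x # y # z # r)) = tri (rev (y # z # r)) @ [D z y x > 0]"
    using tri_append[of "rev r" z y "[x]"] by simp
  moreover have "(D z y x > 0) = (\<not> D x y z > 0)" using 1 D_swap(3)[of z y x] by auto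
  ultimately show ?case using 1 by simp
qed auto

subsection \<open>Removing a crossing\<close>

lemma gp_rot: assumes "gen_pos (us @ vs)" shows "gen_pos (vs @ us)" "inflections 1 (vs @ us) = inflections 1 (us @ vs)"
  using rot1_pow[OF assms, where e=1 and k="length us"] rot1_pow_append[where e=1 and us=us and vs=vs] by simp_all

text \<open>The polygon is read from q, so that pq is the closing edge and the two crossing edges
  separate the paths \<open>L\<close> from q to r and \<open>M\<close> from s to p.\<close>

locale crossing =
  fixes q r s p :: "real^3" and X0 Y0 :: "(real^3) list"
  assumes gen_pos: "gen_pos (q # X0 @ r # s # Y0 @ [p])" and cr: "X p q r s"
begin

abbreviation "L \<equiv> q # X0 @ [r]"
abbreviation "M \<equiv> s # Y0 @ [p]"
abbreviation "ps \<equiv> q # X0 @ r # s # Y0 @ [p]"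

definition "dX = tri (p # q # X0 @ [r, s])"
definition "dY = tri (r # s # Y0 @ [p, q])"
definition "E0 = undirected_steps L \<union> undirected_steps M"

lemma sd: "pairwise_ne2 ps" using gen_pos by (simp add: gen_pos_def)

lemma nz: "x \<in> set ps \<Longrightarrow> y \<in> set ps \<Longrightarrow> z \<in> set ps \<Longrightarrow> ne2 x y \<Longrightarrow> ne2 y z \<Longrightarrow> ne2 x z \<Longrightarrow> D x y z \<noteq> 0"
  by (rule gp_D[OF gen_pos])

lemma ne:
  "ne2 q r" "ne2 q s" "ne2 q p" "ne2 r s" "ne2 r p" "ne2 s p"
  "ne2 r q" "ne2 s q" "ne2 p q" "ne2 s r" "ne2 p r" "ne2 p s"
  "x \<in> set X0 \<Longrightarrow> ne2 q x" "x \<in> set X0 \<Longrightarrow> ne2 x r" "x \<in> set X0 \<Longrightarrow> ne2 x s" "x \<in> set X0 \<Longrightarrow> ne2 x p"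
  "y \<in> set Y0 \<Longrightarrow> ne2 q y" "y \<in> set Y0 \<Longrightarrow> ne2 r y" "y \<in> set Y0 \<Longrightarrow> ne2 s y" "y \<in> set Y0 \<Longrightarrow> ne2 y p"
  "x \<in> set X0 \<Longrightarrow> ne2 x q" "x \<in> set X0 \<Longrightarrow> ne2 r x" "x \<in> set X0 \<Longrightarrow> ne2 s x" "x \<in> set X0 \<Longrightarrow> ne2 p x"
  "y \<in> set Y0 \<Longrightarrow> ne2 y q" "y \<in> set Y0 \<Longrightarrow> ne2 y r" "y \<in> set Y0 \<Longrightarrow> ne2 y s" "y \<in> set Y0 \<Longrightarrow> ne2 p y"
  "x \<in> set X0 \<Longrightarrow> y \<in> set Y0 \<Longrightarrow> ne2 x y" "x \<in> set X0 \<Longrightarrow> y \<in> set Y0 \<Longrightarrow> ne2 y x"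
  using sd by (auto simp: sdist_append ne2_sym)

lemma sdL: "pairwise_ne2 L" and sdM: "pairwise_ne2 M" and disj: "set L \<inter> set M = {}"
proof -
  have "pairwise_ne2 (L @ M)" using sd by simp
  then have "pairwise_ne2 L" "pairwise_ne2 M" "\<forall>x\<in>set L. \<forall>y\<in>set M. ne2 x y" unfolding sdist_append by blast+
  then show "pairwise_ne2 L" "pairwise_ne2 M" "set L \<inter> set M = {}" using ne2_irrefl by blast+
qed

lemma sgl_ps: "turn_signs 1 ps = dX @ dY"
  using tri_append[of "p # q # X0" r s "Y0 @ [p, q]"] by (simp add: turn_signs_def dX_def dY_def)

lemma dX_ne: "dX \<noteq> []" "dY \<noteq> []"
  using length_tri[of "p # q # X0 @ [r, s]"] length_tri[of "r # s # Y0 @ [p, q]"] by (auto simp: dX_def dY_def)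

lemma infl_ps: "inflections 1 ps = changes (dX @ dY @ [hd dX])"
  unfolding inflections_def sgl_ps using dX_ne by simp

lemma ue_ps: "undirected_steps (ps @ [hd ps]) = insert {p, q} (insert {r, s} E0)"
proof -
  have "undirected_steps (ps @ [q]) = undirected_steps L \<union> (insert {r, s} (undirected_steps (M @ [q])))"
    using ue_append[of "q # X0" r "s # Y0 @ [p, q]"] by simp
  moreover have "undirected_steps (M @ [q]) = undirected_steps M \<union> {{p, q}}" using ue_append[of "s # Y0" p "[q]"] by simp
  ultimately show ?thesis by (auto simp: E0_def)
qed

text \<open>Up to a perturbation, the new vertex is the intersection point of rs with the antipode of pq.\<close>

lemma loop:
  assumes t: "\<alpha> *\<^sub>R p + \<beta> *\<^sub>R q = - (\<gamma> *\<^sub>R r + \<delta> *\<^sub>R s)" and pos: "\<alpha> > 0" "\<beta> > 0" "\<gamma> > 0" "\<delta> > 0"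
  obtains A where "gen_pos A" "inflections (-1) A = changes (dX @ [\<not> D r s q > 0, \<not> hd dX])"
    "simple (-1) A \<or> (\<exists>g \<in> undirected_steps L. \<exists>h \<in> undirected_steps L \<union> {{p, q}, {r, s}}. XS g h)"
proof -
  define t where "t = \<gamma> *\<^sub>R r + \<delta> *\<^sub>R s"
  have t1: "t = \<gamma> *\<^sub>R r + \<delta> *\<^sub>R s" by (rule t_def)
  have "t = - (\<alpha> *\<^sub>R p + \<beta> *\<^sub>R q)" unfolding t t_def by simp
  then have t2: "t = \<beta> *\<^sub>R (- q) + \<alpha> *\<^sub>R (- p)" by simp
  let ?S = "set ps \<union> uminus ` set ps"
  have "D r p s \<noteq> 0" by (rule nz) (auto simp: ne)
  then have "D r p t \<noteq> 0" using pos by (simp add: t1)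
  then obtain e where nr: "near ?S t (t + e *\<^sub>R r + (e * e) *\<^sub>R p)" using perturb[of ?S r p t] by auto
  define T where "T = t + e *\<^sub>R r + (e * e) *\<^sub>R p"
  have nr: "near ?S t T" using nr by (simp add: T_def)
  have nr': "near (set ps) t T" using nr by (rule near_mono) auto
  note g = near_gset[OF gen_pos nr']
  define A where "A = q # X0 @ [r, T]"
  have neT: "ne2 q T" "ne2 r T" "\<And>x. x \<in> set X0 \<Longrightarrow> ne2 x T" using g(2) by auto
  have gpA: "gen_pos A" unfolding gen_pos_def
  proof (intro conjI)
    show "3 \<le> length A" by (simp add: A_def)
    show "pairwise_ne2 A" using neT by (simp add: A_def sdist_append ne) (use sd in \<open>simp add: sdist_append\<close>)
    show "generic (set A)" using g(1) by (rule gset_mono) (auto simp: A_def)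
  qed
  have inf: "inflections (-1) A = changes (dX @ [\<not> D r s q > 0, \<not> hd dX])"
  proof -
    \<comment> \<open>Seen from r, the point t is in the direction of s; seen from q, the point -t
      is in the direction of p. So no turn along \<open>L\<close> changes.\<close>
    have "tri ((- T) # q # X0 @ [r, T]) = tri (p # q # X0 @ [r, s])"
    proof (rule tri_ends)
      fix h assume h: "h \<in> set (X0 @ [r])"
      have n0: "D q h p \<noteq> 0" by (rule nz) (use h in \<open>auto simp: ne\<close>)
      have tt: "D q h t = - (\<alpha> * D q h p)" by (simp add: t2)
      have "D q h t \<noteq> 0" using n0 pos by (simp add: tt)
      then have "(D q h T > 0) = (D q h t > 0)" by (intro near_pos[OF nr']) (use h in auto)
      moreover have "D q h T \<noteq> 0" using near_nz[OF nr' _ _ n0] h by auto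
      moreover have "D (- T) q h = - D q h T" using D_cyc(1)[of q h T] by simp
      moreover have "D p q h = D q h p" using D_cyc(1)[of q h p] by simp
      ultimately show "(D (- T) q h > 0) = (D p q h > 0)" using n0 pos
        by (auto simp: tt zero_less_mult_iff mult_less_0_iff)
    next
      fix h assume h: "h \<in> set (q # X0)"
      have n0: "D h r s \<noteq> 0" by (rule nz) (use h in \<open>auto simp: ne\<close>)
      have tt: "D h r t = \<delta> * D h r s" by (simp add: t1)
      have "(D h r T > 0) = (D h r t > 0)" by (intro near_pos[OF nr']) (use h n0 pos in \<open>auto simp: tt\<close>)
      then show "(D h r T > 0) = (D h r s > 0)" using pos by (simp add: tt zero_less_mult_iff)
    qed
    then have 1: "tri ((- T) # A) = dX" by (simp add: A_def dX_def)
    have n0: "D q r s \<noteq> 0" by (rule nz) (auto simp: ne)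
    have tt: "D q r t = \<delta> * D q r s" by (simp add: t1)
    have "(D q r T > 0) = (D q r t > 0)" by (intro near_pos[OF nr']) (use n0 pos in \<open>auto simp: tt\<close>)
    moreover have "D q r T \<noteq> 0" using near_nz[OF nr' _ _ n0] by auto
    moreover have "D r T (- q) = - D q r T" using D_cyc(1)[of r T q] by simp
    moreover have "D r s q = D q r s" by (rule D_cyc)
    ultimately have 2: "(D r T (- q) > 0) = (\<not> D r s q > 0)" using pos by (auto simp: tt zero_less_mult_iff)
    have "turn_signs (-1) A = dX @ [\<not> D r s q > 0]"
      using tri_append[of "(- T) # q # X0" r T "[- q]"] 1 2 by (simp add: turn_signs_def A_def)
    then show ?thesis using dX_ne by (simp add: inflections_def)
  qed
  have "simple (-1) A" if no: "\<not> (\<exists>g \<in> undirected_steps L. \<exists>h \<in> undirected_steps L \<union> {{p, q}, {r, s}}. XS g h)"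
  proof -
    have E: "edges (-1) A = insert (r, T) (insert (T, - q) (steps L))"
      using pe_append[of "q # X0" r "[T, - q]"] by (auto simp: edges_def A_def)
    have LL: "noX (steps L) (steps L)" using no by (intro noX_ue) blast
    have new: "\<not> X r T x y \<and> \<not> X T (- q) x y" if xy: "(x, y) \<in> steps L" for x y
    proof -
      have xyL: "x \<in> set L" "y \<in> set L" "ne2 x y" using pe_set[OF xy] pe_distinct[OF sdL xy] by auto
      have mem: "{x, y} \<in> undirected_steps L" using xy by (force simp: undirected_steps_def)
      have n: "\<not> X p q x y" "\<not> X r s x y" using no mem XS_sym XS_iff by blast+
      have d: "u = v \<or> ne2 u v" if "u \<in> set ps" "v \<in> set ps" for u v using sdist_pair[OF sd] that by blast
      have xs: "ne2 s x" "ne2 s y" "ne2 p x" "ne2 p y" using xyL(1,2) by (auto simp: ne)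
      have xyP: "x \<in> set ps" "y \<in> set ps" "q \<in> set ps" "r \<in> set ps" "s \<in> set ps" "p \<in> set ps" using xyL by auto
      have "\<not> X r T x y"
      proof
        assume X: "X r T x y"
        then have "x \<noteq> r" "y \<noteq> r" by auto
        then have "ne2 r x" "ne2 r y" using d xyL(1,2) by auto
        then have "D r s x \<noteq> 0" "D r s y \<noteq> 0" "D r x y \<noteq> 0" using nz xyP xyL(3) xs ne by simp_all
        then have "X r s x y"
          by (intro near_cross[OF nr _ _ _ t1 _ _ _ _ _ X]) (use xyL pos in auto)
        then show False using n by blast
      qed
      moreover have "\<not> X (- q) T x y"
      proof
        assume X: "X (- q) T x y"
        then have "x \<noteq> q" "y \<noteq> q" by auto
        then have "ne2 q x" "ne2 q y" using d xyL(1,2) by auto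
        then have "D q p x \<noteq> 0" "D q p y \<noteq> 0" "D q x y \<noteq> 0" using nz xyP xyL(3) xs ne by simp_all
        then have "X (- q) (- p) x y"
          by (intro near_cross[OF nr _ _ _ t2 _ _ _ _ _ X]) (use xyL pos in auto)
        then show False using n X_swap by simp
      qed
      ultimately show ?thesis using X_swap(1) by blast
    qed
    have self: "\<not> X r T r T" "\<not> X r T T (- q)" "\<not> X T (- q) T (- q)" "\<not> X T (- q) r T" by auto
    show ?thesis unfolding simple_def E noX_def
    proof (intro allI impI)
      fix a b c d assume ab: "(a, b) \<in> insert (r, T) (insert (T, - q) (steps L))" "(c, d) \<in> insert (r, T) (insert (T, - q) (steps L))"
      show "\<not> X a b c d" using ab self new noXD[OF LL] X_sym by (elim insertE) (auto, (metis X_sym)+)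
    qed
  qed
  then show ?thesis using that gpA inf by blast
qed

end

lemma XS_irrefl [simp]: "\<not> XS g g"
proof
  assume "XS g g"
  then obtain p q r s where a: "g = {p, q}" "g = {r, s}" "X p q r s" unfolding XS_def by blast
  then have "(r = p \<and> s = q) \<or> (r = q \<and> s = p)" by (auto simp: doubleton_eq_iff)
  then show False using a(3) by auto
qed

section \<open>Resolving a crossing of two edges\<close>

lemma X_scale: assumes "c > 0" shows "X (c *\<^sub>R p) q r s = X p q r s" "X p q (c *\<^sub>R r) s = X p q r s"
proof -
  have c: "c * a * b < 0 \<longleftrightarrow> a * b < 0" "a * (c * b) < 0 \<longleftrightarrow> a * b < 0" "c * a * (c * b) < 0 \<longleftrightarrow> a * b < 0" for a b :: real
    using assms by (simp_all add: mult_less_0_iff zero_less_mult_iff)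
  show 1: "X (c *\<^sub>R p) q r s = X p q r s" for p q r s unfolding X_def by (simp add: c)
  show "X p q (c *\<^sub>R r) s = X p q r s" using 1[of r s p q] X_sym by blast
qed

text \<open>Here t - R and t - P are positive multiples of s and q, and the perturbed points are T1
  and T2. In the basis R, P, t the first factor pair of \<open>X\<close> is explicit and has a
  positive product.\<close>

lemma reconnect_disjoint:
  assumes ab: "0 < a" "0 < b" "0 < a'" "0 < b'" "a' < 1" "b' < 1" and D: "D R P t \<noteq> 0"
  shows "\<not> X R (t + a *\<^sub>R R + b *\<^sub>R P) (t - R) (t - a' *\<^sub>R R - b' *\<^sub>R P)"
    "\<not> X R (t + a *\<^sub>R R + b *\<^sub>R P) (t - P) (t - a' *\<^sub>R R - b' *\<^sub>R P)"
proof -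
  define d where "d = D R P t"
  have c: "D R P t = d" "D R t P = - d" "D P R t = - d" "D P t R = d" "D t R P = d" "D t P R = - d"
    unfolding d_def using D_cyc D_swap by metis+
  have dd: "d * d > 0" using D by (auto simp: d_def zero_less_mult_iff)
  have 1: "D R (t - R) (t - a' *\<^sub>R R - b' *\<^sub>R P) = d * b'"
    "D (t + a *\<^sub>R R + b *\<^sub>R P) (t - R) (t - a' *\<^sub>R R - b' *\<^sub>R P) = d * (a * b' + b * (1 - a') + b')"
    "D R (t - P) (t - a' *\<^sub>R R - b' *\<^sub>R P) = - d * (1 - b')"
    "D (t + a *\<^sub>R R + b *\<^sub>R P) (t - P) (t - a' *\<^sub>R R - b' *\<^sub>R P) = - d * (a * (1 - b') + b * a' + a')"
    by (simp_all add: c algebra_simps)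
  have "a * b' > 0" "b * (1 - a') > 0" "a * (1 - b') > 0" "b * a' > 0" using ab by simp_all
  then have "b' * (a * b' + b * (1 - a') + b') > 0" "(1 - b') * (a * (1 - b') + b * a' + a') > 0"
    using ab by (intro mult_pos_pos; linarith)+
  then have "(d * d) * (b' * (a * b' + b * (1 - a') + b')) > 0" "(d * d) * ((1 - b') * (a * (1 - b') + b * a' + a')) > 0"
    using dd by simp_all
  then show "\<not> X R (t + a *\<^sub>R R + b *\<^sub>R P) (t - R) (t - a' *\<^sub>R R - b' *\<^sub>R P)"
    "\<not> X R (t + a *\<^sub>R R + b *\<^sub>R P) (t - P) (t - a' *\<^sub>R R - b' *\<^sub>R P)"
    unfolding X_def 1 by (simp_all add: mult_ac)
qed

text \<open>If t were off the plane xy, then T and T' would be on its side, and r and s both on the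
  other side, although t is a positive combination of them.\<close>

lemma both_halves:
  assumes n: "near S t T" "near S t T'" and S: "x \<in> S" "y \<in> S"
    and t: "t = g *\<^sub>R r + d *\<^sub>R s" "g > 0" "d > 0" and X: "X r T x y" "X s T' x y"
  shows "D x y t = 0"
proof (rule ccontr)
  assume nz: "D x y t \<noteq> 0"
  have a: "D x y r * D x y T < 0" "D x y s * D x y T' < 0"
    using X D_cyc(1)[of x y r] D_cyc(1)[of x y T] D_cyc(1)[of x y s] D_cyc(1)[of x y T'] unfolding X_def by simp_all
  have "D x y t * D x y T > 0" "D x y t * D x y T' > 0" using nearD[OF n(1) S nz] nearD[OF n(2) S nz] .
  then have "D x y r * D x y t < 0" "D x y s * D x y t < 0"
    using a by (auto simp: mult_less_0_iff zero_less_mult_iff)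
  then have "g * (D x y r * D x y t) + d * (D x y s * D x y t) < 0" using t(2,3) by (intro add_neg_neg) (simp_all add: mult_pos_neg)
  moreover have "g * (D x y r * D x y t) + d * (D x y s * D x y t) = D x y t * D x y t"
    by (simp add: t(1) algebra_simps)
  ultimately show False by (metis not_square_less_zero)
qed

text \<open>Since t lies in the plane xy and strictly between p and q, that plane separates p from
  q. As xy crosses rs in the line of t, which is also in the plane pq, the latter separates x from
  y.\<close>

lemma triple_point:
  assumes t: "t = g *\<^sub>R r + d *\<^sub>R s" "t = a *\<^sub>R p + b *\<^sub>R q" and pos: "g > 0" "d > 0" "a > 0" "b > 0"
    and z: "D x y t = 0" and X: "X r s x y" and nz: "D p x y \<noteq> 0" "D p q x \<noteq> 0" "D p q y \<noteq> 0"
  shows "X p q x y"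
proof -
  have "a * D x y p + b * D x y q = 0" using z by (simp add: t(2))
  then have "a * D p x y + b * D q x y = 0" using D_cyc(1)[of x y p] D_cyc(1)[of x y q] by simp
  then have "D p x y * (a * D p x y + b * D q x y) = 0" by simp
  then have "b * (D p x y * D q x y) = - (a * (D p x y * D p x y))" by (simp add: algebra_simps)
  moreover have "a * (D p x y * D p x y) > 0" using nz(1) pos by (auto simp: zero_less_mult_iff)
  ultimately have "b * (D p x y * D q x y) < 0" by linarith
  then have 1: "D p x y * D q x y < 0" using pos by (simp add: mult_less_0_iff)
  have "g * D x y r + d * D x y s = 0" using z by (simp add: t(1))
  then have e: "d * D s x y = - (g * D r x y)" using D_cyc(1)[of x y r] D_cyc(1)[of x y s] by simp
  have rel: "D s x y *\<^sub>R r - D r x y *\<^sub>R s = D r s x *\<^sub>R y - D r s y *\<^sub>R x"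
    using D_relation[of s x y r] by (simp add: algebra_simps)
  have "d *\<^sub>R (D s x y *\<^sub>R r - D r x y *\<^sub>R s) = (d * D s x y) *\<^sub>R r - (d * D r x y) *\<^sub>R s" by (simp add: algebra_simps)
  also have "\<dots> = - (D r x y *\<^sub>R t)" unfolding e by (simp add: t(1) algebra_simps)
  finally have "D p q (d *\<^sub>R (D r s x *\<^sub>R y - D r s y *\<^sub>R x)) = D p q (- (D r x y *\<^sub>R t))" unfolding rel by simp
  also have "\<dots> = 0" by (simp add: t(2))
  finally have f: "D r s x * D p q y = D r s y * D p q x" using pos by simp
  have "D r s x * D r s y < 0" using X by (simp add: X_def)
  moreover have "(D r s x * D r s y) * (D p q x * D p q y) = (D r s x * D p q y) * (D r s x * D p q y)"
    using f by (simp add: mult_ac)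
  then have "(D r s x * D r s y) * (D p q x * D p q y) \<ge> 0" by (simp only: zero_le_square)
  ultimately have "D p q x * D p q y \<le> 0" by (meson mult_neg_pos not_less)
  moreover have "D p q x * D p q y \<noteq> 0" using nz by simp
  ultimately have "D p q x * D p q y < 0" by linarith
  then show ?thesis using 1 unfolding X_def by simp
qed

lemma sdist_rev: "pairwise_ne2 (rev xs) = pairwise_ne2 xs"
  by (induction xs) (auto simp: sdist_append ne2_sym)

context crossing begin

lemma E0_no: "{p, q} \<notin> E0" "{r, s} \<notin> E0" "{p, q} \<noteq> {r, s}" "undirected_steps L \<inter> undirected_steps M = {}"
proof -
  have c: "q \<in> set L" "r \<in> set L" "s \<in> set M" "p \<in> set M" by auto
  show "{p, q} \<notin> E0" "{r, s} \<notin> E0" using ue_set[of _ L] ue_set[of _ M] disj c unfolding E0_def by blast+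
  have "p \<noteq> r" "p \<noteq> s" using disj c sd by (auto simp: sdist_append)
  then show "{p, q} \<noteq> {r, s}" by (auto simp: doubleton_eq_iff)
  have "g \<noteq> {}" if "g \<in> undirected_steps xs" for g and xs :: "(real^3) list" using that by (auto simp: undirected_steps_def)
  then show "undirected_steps L \<inter> undirected_steps M = {}" using ue_set[of _ L] ue_set[of _ M] disj by blast
qed

lemma NC_ge:
  assumes "finite C" "\<And>g h. (g, h) \<in> C \<Longrightarrow> g \<in> insert {p, q} (insert {r, s} E0) \<and> h \<in> insert {p, q} (insert {r, s} E0) \<and> XS g h"
  shows "card C \<le> num_crossings ps"
proof -
  let ?E = "insert {p, q} (insert {r, s} E0)"
  have "finite ?E" by (simp add: E0_def finite_ue)
  then show ?thesis unfolding num_crossings_def ue_ps by (intro card_mono finite_NC) (use assms(2) in auto)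
qed

lemma XS_ef: "XS {p, q} {r, s}" "XS {r, s} {p, q}" using cr X_sym[of p q r s] by simp_all

text \<open>Both loops have an odd number of inflections, at least 3 if simple. A loop with
  crossings supplies two ordered pairs besides the given two, and those of the two loops are
  different. According to the number of non-simple loops the bound is 2 + 4, 4 + 2 or 6 + 0.\<close>

lemma odd_case:
  assumes t: "\<alpha> *\<^sub>R p + \<beta> *\<^sub>R q = - (\<gamma> *\<^sub>R r + \<delta> *\<^sub>R s)" and pos: "\<alpha> > 0" "\<beta> > 0" "\<gamma> > 0" "\<delta> > 0"
  shows "6 \<le> num_crossings ps + inflections 1 ps"
proof -
  let ?e = "{p, q}" and ?f = "{r, s}"
  obtain A where A: "gen_pos A" "inflections (-1) A = changes (dX @ [\<not> D r s q > 0, \<not> hd dX])"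
    "simple (-1) A \<or> (\<exists>g \<in> undirected_steps L. \<exists>h \<in> undirected_steps L \<union> {?e, ?f}. XS g h)" using loop[OF t pos] .
  interpret R: crossing s p q r Y0 X0
  proof
    show "gen_pos (s # Y0 @ p # q # X0 @ [r])" using gp_rot(1)[of "q # X0 @ [r]" "s # Y0 @ [p]"] gen_pos by simp
    show "X r s p q" using cr X_sym by blast
  qed
  have t': "\<gamma> *\<^sub>R r + \<delta> *\<^sub>R s = - (\<alpha> *\<^sub>R p + \<beta> *\<^sub>R q)" unfolding t by simp
  obtain B where B: "gen_pos B" "inflections (-1) B = changes (R.dX @ [\<not> D p q s > 0, \<not> hd R.dX])"
    "simple (-1) B \<or> (\<exists>g \<in> undirected_steps M. \<exists>h \<in> undirected_steps M \<union> {?f, ?e}. XS g h)" using R.loop[OF t' pos(3,4,1,2)] .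
  have dd: "R.dX = dY" by (simp add: R.dX_def dY_def)
  have "\<alpha> * D p q s = D (\<alpha> *\<^sub>R p + \<beta> *\<^sub>R q) q s" by simp
  also have "\<dots> = \<gamma> * D r s q" unfolding t using D_swap(2)[of r s q] by simp
  finally have sg: "(D p q s > 0) = (D r s q > 0)" using pos by (metis zero_less_mult_pos mult_pos_pos)
  obtain a dX' where X1: "dX = a # dX'" using dX_ne by (cases dX) auto
  obtain b dY' where Y1: "dY = b # dY'" using dX_ne by (cases dY) auto
  have chX: "changes (dX @ c # cs) = changes dX + changes [last dX, c] + changes (c # cs)" for c cs
  proof -
    have "changes (dX @ [c]) = changes dX + changes [last dX, c]"
      using ch_append[of "butlast dX" "last dX" "[c]"] dX_ne by (metis append.assoc append_Cons append_Nil append_butlast_last_id)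
    then show ?thesis using ch_append[of dX c cs] by simp
  qed
  have chY: "changes (dY @ c # cs) = changes dY + changes [last dY, c] + changes (c # cs)" for c cs
  proof -
    have "changes (dY @ [c]) = changes dY + changes [last dY, c]"
      using ch_append[of "butlast dY" "last dY" "[c]"] dX_ne by (metis append.assoc append_Cons append_Nil append_butlast_last_id)
    then show ?thesis using ch_append[of dY c cs] by simp
  qed
  \<comment> \<open>Both loops have the same sign at their new vertices. Inserting it between
    \<open>last dX\<close> and the negated head of \<open>dY\<close> costs at most one change more
    than the old junction, and likewise at the other junction.\<close>
  have F: "inflections (-1) A + inflections (-1) B \<le> inflections 1 ps + 2"
  proof -
    have "inflections 1 ps = changes dX + changes [last dX, b] + changes dY + changes [last dY, a]"
      unfolding infl_ps using chX[of b "dY' @ [hd dX]"] chY[of "hd dX" "[]"] by (simp add: X1 Y1)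
    moreover have "inflections (-1) A = changes dX + changes [last dX, \<not> D r s q > 0] + changes [\<not> D r s q > 0, \<not> a]" unfolding A chX by (simp add: X1)
    moreover have "inflections (-1) B = changes dY + changes [last dY, \<not> D r s q > 0] + changes [\<not> D r s q > 0, \<not> b]" unfolding B dd chY sg by (simp add: Y1)
    ultimately show ?thesis by auto
  qed
  have oA: "odd (inflections (-1) A)" and oB: "odd (inflections (-1) B)" using even_infl[OF A(1)] even_infl[OF B(1)] by simp_all
  then have A1: "1 \<le> inflections (-1) A" "1 \<le> inflections (-1) B" by (auto intro: Suc_leI odd_pos)
  have two: "card {(x, y), (y, x)} = 2" if "x \<noteq> y" for x y :: "(real^3) set"
    using that by simp
  have four: "card {(x, y), (y, x), (u, v), (v, u)} = 4"
    if "x \<noteq> y" "u \<noteq> x" "u \<noteq> y" "u \<noteq> v" for x y u v :: "(real^3) set" using that by simp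
  have six: "card {(x, y), (y, x), (g, h), (h, g), (u, v), (v, u)} = 6"
    if "x \<noteq> y" "g \<noteq> x" "g \<noteq> y" "g \<noteq> h" "u \<noteq> x" "u \<noteq> y" "u \<noteq> v" "u \<noteq> g" "u \<noteq> h" "g \<noteq> v"
    for x y g h u v :: "(real^3) set" using that by simp
  have base: "2 \<le> num_crossings ps"
  proof -
    have "card {(?e, ?f), (?f, ?e)} \<le> num_crossings ps" by (rule NC_ge) (use XS_ef in auto)
    then show ?thesis using two E0_no by metis
  qed
  show ?thesis
  proof (cases "simple (-1) A")
    case sA: True
    then have 3: "3 \<le> inflections (-1) A" using moebius A by blast
    show ?thesis
    proof (cases "simple (-1) B")
      case True
      then have "3 \<le> inflections (-1) B" using moebius B by blast
      then show ?thesis using 3 F base by linarith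
    next
      case False
      then obtain g h where g: "g \<in> undirected_steps M" "h \<in> undirected_steps M \<union> {?f, ?e}" "XS g h" using B by blast
      have g': "g \<noteq> ?e" "g \<noteq> ?f" "g \<noteq> h" using g E0_no XS_irrefl by (auto simp: E0_def)
      have "card {(?e, ?f), (?f, ?e), (g, h), (h, g)} = 4" by (rule four[OF E0_no(3) g'])
      moreover have "card {(?e, ?f), (?f, ?e), (g, h), (h, g)} \<le> num_crossings ps"
        by (rule NC_ge) (use g XS_ef XS_sym[of g h] in \<open>auto simp: E0_def\<close>)
      ultimately show ?thesis using 3 A1 F by linarith
    qed
  next
    case False
    then obtain g h where g: "g \<in> undirected_steps L" "h \<in> undirected_steps L \<union> {?e, ?f}" "XS g h" using A by blast
    have g': "g \<noteq> ?e" "g \<noteq> ?f" "g \<noteq> h" using g E0_no XS_irrefl by (auto simp: E0_def)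
    show ?thesis
    proof (cases "simple (-1) B")
      case True
      then have 3: "3 \<le> inflections (-1) B" using moebius B by blast
      have "card {(?e, ?f), (?f, ?e), (g, h), (h, g)} = 4" by (rule four[OF E0_no(3) g'])
      moreover have "card {(?e, ?f), (?f, ?e), (g, h), (h, g)} \<le> num_crossings ps"
        by (rule NC_ge) (use g XS_ef XS_sym[of g h] in \<open>auto simp: E0_def\<close>)
      ultimately show ?thesis using 3 A1 F by linarith
    next
      case False
      then obtain u v where u: "u \<in> undirected_steps M" "v \<in> undirected_steps M \<union> {?f, ?e}" "XS u v" using B by blast
      have u': "u \<noteq> ?e" "u \<noteq> ?f" "u \<noteq> v" "u \<noteq> g" "u \<noteq> h" "g \<noteq> v" using u g E0_no XS_irrefl by (auto simp: E0_def)
      have "card {(?e, ?f), (?f, ?e), (g, h), (h, g), (u, v), (v, u)} = 6" by (rule six[OF E0_no(3) g' u'])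
      moreover have "card {(?e, ?f), (?f, ?e), (g, h), (h, g), (u, v), (v, u)} \<le> num_crossings ps"
        by (rule NC_ge) (use g u XS_ef XS_sym[of g h] XS_sym[of u v] in \<open>auto simp: E0_def\<close>)
      ultimately show ?thesis by linarith
    qed
  qed
qed

end

lemma pe_split: "(p, q) \<in> steps xs \<Longrightarrow> \<exists>A B. xs = A @ p # q # B"
proof (induction xs rule: steps.induct)
  case (1 x y zs)
  show ?case
  proof (cases "p = x \<and> q = y")
    case True
    then have "x # y # zs = [] @ p # q # zs" by simp
    then show ?thesis by blast
  next
    case False
    then obtain A B where "y # zs = A @ p # q # B" using 1 by auto
    then have "x # y # zs = (x # A) @ p # q # B" by simp
    then show ?thesis by blast
  qed
qed auto

lemma gp_snoc_near: assumes "gen_pos ps" "near (set ps) t T" shows "gen_pos (ps @ [T])"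
  unfolding gen_pos_def
proof (intro conjI)
  note g = near_gset[OF assms]
  show "3 \<le> length (ps @ [T])" using assms(1) by (simp add: gen_pos_def)
  show "pairwise_ne2 (ps @ [T])" unfolding sdist_append using assms(1) g(2) by (simp add: gen_pos_def)
  show "generic (set (ps @ [T]))" using g(1) by simp
qed

context crossing begin

lemma half_cross:
  assumes n: "near (set ps) t T" and xy: "x \<in> set ps" "y \<in> set ps" "ne2 x y" and uv: "u \<in> set ps" "v \<in> set ps" "ne2 u v"
    and t: "t = a *\<^sub>R u + b *\<^sub>R v" "a > 0" "b > 0" and X: "X u T x y"
  shows "X u v x y"
proof -
  have d: "u' = v' \<or> ne2 u' v'" if "u' \<in> set ps" "v' \<in> set ps" for u' v' using sdist_pair[OF sd] that by blast
  have X': "X u T y x" using X X_swap by blast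
  have "x \<noteq> u" "y \<noteq> u" using X by auto
  then have ux: "ne2 u x" "ne2 u y" using d uv xy by blast+
  have "x \<noteq> v"
  proof
    assume "x = v"
    then have "D u v y \<noteq> 0" using nz[of u v y] uv xy ux by simp
    then show False using near_cross_end[OF n xy(2) uv(2) t(1,2)] X \<open>x = v\<close> by blast
  qed
  moreover have "y \<noteq> v"
  proof
    assume "y = v"
    then have "D u v x \<noteq> 0" using nz[of u v x] uv xy ux ne2_sym by simp
    then show False using near_cross_end[OF n xy(1) uv(2) t(1,2)] X' \<open>y = v\<close> by blast
  qed
  ultimately have vx: "ne2 v x" "ne2 v y" using d uv xy by blast+
  have "D u v x \<noteq> 0" "D u v y \<noteq> 0" "D u x y \<noteq> 0" using nz uv xy ux vx by simp_all
  then show ?thesis by (intro near_cross[OF n _ _ _ t _ _ _ X]) (use uv xy in auto)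
qed

end

text \<open>T1 and T2 are perturbations of the crossing point t into opposite sectors: T1 towards r and p,
  T2 towards s and q.\<close>

locale reconnection = crossing +
  fixes \<alpha> \<beta> \<gamma> \<delta> e1 e2 :: real and t R P T1 T2 :: "real^3"
  assumes t_pq: "t = \<alpha> *\<^sub>R p + \<beta> *\<^sub>R q" and t_rs: "t = \<gamma> *\<^sub>R r + \<delta> *\<^sub>R s"
    and pos: "\<alpha> > 0" "\<beta> > 0" "\<gamma> > 0" "\<delta> > 0"
    and R_def: "R = \<gamma> *\<^sub>R r" and P_def: "P = \<alpha> *\<^sub>R p"
    and e1: "0 < e1" "e1 < 1" and T1_def: "T1 = t + e1 *\<^sub>R R + (e1 * e1) *\<^sub>R P" and n1: "near (set ps) t T1"
    and e2: "0 < e2" "e2 < 1" and T2_def: "T2 = t + e2 *\<^sub>R (- R) + (e2 * e2) *\<^sub>R (- P)"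
    and n2': "near (set (ps @ [T1])) t T2"
begin

text \<open>The path \<open>M\<close> is run backwards between T1 and T2. All old vertices are kept,
  so the new polygon lies in no hemisphere either.\<close>

definition "qs = L @ T1 # rev M @ [T2]"

lemma t1: "t = \<gamma> *\<^sub>R r + \<delta> *\<^sub>R s" "t = \<delta> *\<^sub>R s + \<gamma> *\<^sub>R r"
  using t_rs by simp_all

lemma t2: "t = \<alpha> *\<^sub>R p + \<beta> *\<^sub>R q" "t = \<beta> *\<^sub>R q + \<alpha> *\<^sub>R p"
  using t_pq by simp_all

lemma DR: "D R P t \<noteq> 0"
proof -
  have "D r p s \<noteq> 0" by (rule nz) (auto simp: ne)
  then show ?thesis using pos by (simp add: t1 R_def P_def)
qed

lemma n2: "near (set ps) t T2"
  using n2' by (rule near_mono) auto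

lemmas g1 = near_gset[OF gen_pos n1]

lemma gp1: "gen_pos (ps @ [T1])"
  by (rule gp_snoc_near[OF gen_pos n1])

lemmas g2 = near_gset[OF gp1 n2']

lemma T1: "T1 \<notin> set ps" using g1(2) ne2_irrefl by blast

lemma T2: "T2 \<notin> set ps" "T1 \<noteq> T2"
  using g2(2)[of T2] g2(2)[of T1] ne2_irrefl[of T2] by auto

lemma set_qs: "set qs = insert T2 (set (ps @ [T1]))" by (auto simp: qs_def)

lemma gp_qs: "gen_pos qs" unfolding gen_pos_def
proof (intro conjI)
  show "generic (set qs)" using g2(1) set_qs by simp
  have LM: "\<And>x y. x \<in> set L \<Longrightarrow> y \<in> set M \<Longrightarrow> ne2 x y"
  proof -
    have "pairwise_ne2 (L @ M)" using sd by simp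
    then show "\<And>x y. x \<in> set L \<Longrightarrow> y \<in> set M \<Longrightarrow> ne2 x y" unfolding sdist_append by blast
  qed
  have a: "ne2 x T1" "ne2 T1 x" if "x \<in> set L \<union> set M" for x using g1(2)[of x] that ne2_sym[of x T1] by auto
  have b: "ne2 x T2" if "x \<in> insert T1 (set L \<union> set M)" for x using g2(2)[of x] that by auto
  have 1: "pairwise_ne2 (rev M @ [T2])" unfolding sdist_append sdist_rev using sdM b by simp
  have 2: "pairwise_ne2 (T1 # rev M @ [T2])" using 1 a b by simp
  show "pairwise_ne2 qs" unfolding qs_def sdist_append using 2 sdL LM a b by simp
qed (simp add: qs_def)

lemma nonhemi_qs: "\<not> in_hemisphere ps \<Longrightarrow> \<not> in_hemisphere qs"
  using set_qs unfolding in_hemisphere_def by auto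

text \<open>The signs along \<open>L\<close> stay, those along the reversed \<open>M\<close> are all
  negated, and T1 and T2 have a common sign \<sigma>. Pairing the four new junctions with the two
  old ones shows that each old junction grows by at most one change.\<close>

lemma infl_qs: "inflections 1 qs \<le> inflections 1 ps + 2"
proof -
  have np: "(D x y T > 0) = (D x y t > 0) \<and> D x y t \<noteq> 0" if "T = T1 \<or> T = T2" "x \<in> set ps" "y \<in> set ps" "D x y t \<noteq> 0" for x y T
    using that near_pos[OF n1] near_pos[OF n2] by blast
  have sgn1: "(c * x > 0) = (x > 0)" if "c > 0" for c x :: real using that by (simp add: zero_less_mult_iff)
  have c1: "tri (T2 # q # X0 @ [r, T1]) = dX" unfolding dX_def
  proof (rule tri_ends)
    fix h assume h: "h \<in> set (X0 @ [r])"
    have n0: "D q h p \<noteq> 0" by (rule nz) (use h in \<open>auto simp: ne\<close>)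
    have tt: "D q h t = \<alpha> * D q h p" by (simp add: t2)
    have "(D q h T2 > 0) = (D q h t > 0)" using np[of T2 q h] h n0 pos tt by auto
    then show "(D T2 q h > 0) = (D p q h > 0)" using sgn1 pos D_cyc(1)[of q h p] D_cyc(1)[of q h T2] by (simp add: tt)
  next
    fix h assume h: "h \<in> set (q # X0)"
    have n0: "D h r s \<noteq> 0" by (rule nz) (use h in \<open>auto simp: ne\<close>)
    have tt: "D h r t = \<delta> * D h r s" by (simp add: t1)
    have "(D h r T1 > 0) = (D h r t > 0)" using np[of T1 h r] h n0 pos tt by auto
    then show "(D h r T1 > 0) = (D h r s > 0)" using sgn1 pos by (simp add: tt)
  qed
  have "tri (T1 # p # rev Y0 @ [s, T2]) = tri (q # p # rev Y0 @ [s, r])"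
  proof (rule tri_ends)
    fix h assume h: "h \<in> set (rev Y0 @ [s])"
    have n0: "D p h q \<noteq> 0" by (rule nz) (use h in \<open>auto simp: ne\<close>)
    have tt: "D p h t = \<beta> * D p h q" by (simp add: t2)
    have "(D p h T1 > 0) = (D p h t > 0)" using np[of T1 p h] h n0 pos tt by auto
    then show "(D T1 p h > 0) = (D q p h > 0)" using sgn1 pos D_cyc(1)[of p h q] D_cyc(1)[of p h T1] by (simp add: tt)
  next
    fix h assume h: "h \<in> set (p # rev Y0)"
    have n0: "D h s r \<noteq> 0" by (rule nz) (use h in \<open>auto simp: ne\<close>)
    have tt: "D h s t = \<gamma> * D h s r" by (simp add: t1)
    have "(D h s T2 > 0) = (D h s t > 0)" using np[of T2 h s] h n0 pos tt by auto
    then show "(D h s T2 > 0) = (D h s r > 0)" using sgn1 pos by (simp add: tt)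
  qed
  also have "\<dots> = map Not (rev dY)"
  proof -
    have "nzt (p # ps @ [q])" using nzt_cyc[OF gen_pos, of 1] by simp
    then have "nzt (r # s # Y0 @ [p, q])" using nzt_append[of "p # q # X0" r s "Y0 @ [p, q]"] by simp
    then show ?thesis using tri_rev[of "r # s # Y0 @ [p, q]"] by (simp add: dY_def)
  qed
  finally have c2: "tri (T1 # p # rev Y0 @ [s, T2]) = map Not (rev dY)" .
  define \<sigma> where "\<sigma> \<longleftrightarrow> D r T1 p > 0"
  have c3: "(D s T2 q > 0) = \<sigma>"
  proof -
    have n0: "D p r s \<noteq> 0" "D q s p \<noteq> 0" by (rule nz; auto simp: ne)+
    have tt: "D p r t = \<delta> * D p r s" "D q s t = \<alpha> * D q s p" by (simp add: t1(1), simp add: t2(1))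
    \<comment> \<open>Expressing q and s through p, r and t relates the turns at T2 and T1.\<close>
    have "(\<beta> * \<delta>) * D q s t = D (\<beta> *\<^sub>R q) (\<delta> *\<^sub>R s) t" by simp
    also have "\<dots> = D (t - \<alpha> *\<^sub>R p) (t - \<gamma> *\<^sub>R r) t"
    proof -
      have "\<beta> *\<^sub>R q = t - \<alpha> *\<^sub>R p" "\<delta> *\<^sub>R s = t - \<gamma> *\<^sub>R r" by (simp add: t2(1), simp add: t1(1))
      then show ?thesis by simp
    qed
    also have "\<dots> = (\<alpha> * \<gamma>) * D p r t" by simp
    finally have "(\<beta> * \<delta>) * D q s t = (\<alpha> * \<gamma>) * D p r t" .
    then have "(D q s t > 0) = (D p r t > 0)"
      using sgn1[of "\<beta> * \<delta>" "D q s t"] sgn1[of "\<alpha> * \<gamma>" "D p r t"] pos by (metis mult_pos_pos)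
    moreover have "(D p r T1 > 0) = (D p r t > 0)" using np[of T1 p r] n0 pos tt by auto
    moreover have "(D q s T2 > 0) = (D q s t > 0)" using np[of T2 q s] n0 pos tt by auto
    ultimately show ?thesis using D_cyc(1)[of r T1 p] D_cyc(1)[of s T2 q] by (simp add: \<sigma>_def)
  qed
  have "turn_signs 1 qs = tri ((T2 # q # X0) @ r # T1 # (p # rev Y0 @ [s, T2, q]))" by (simp add: turn_signs_def qs_def)
  also have "\<dots> = dX @ tri (r # T1 # p # rev Y0 @ [s, T2, q])" by (subst tri_append) (use c1 in simp)
  also have "tri (r # T1 # p # rev Y0 @ [s, T2, q]) = \<sigma> # tri ((T1 # p # rev Y0) @ s # T2 # [q])" by (simp add: \<sigma>_def)
  also have "tri ((T1 # p # rev Y0) @ s # T2 # [q]) = map Not (rev dY) @ [\<sigma>]"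
    by (subst tri_append) (use c2 c3 in simp)
  finally have S: "turn_signs 1 qs = dX @ \<sigma> # map Not (rev dY) @ [\<sigma>]" .
  obtain a dX' where X1: "dX = a # dX'" using dX_ne by (cases dX) auto
  obtain b dY' where Y1: "dY = b # dY'" using dX_ne by (cases dY) auto
  have chs: "changes (cs @ c # ds) = changes cs + changes [last cs, c] + changes (c # ds)" if "cs \<noteq> []" for cs c ds
  proof -
    have "changes (cs @ [c]) = changes cs + changes [last cs, c]"
      using ch_append[of "butlast cs" "last cs" "[c]"] that by (metis append.assoc append_Cons append_Nil append_butlast_last_id)
    then show ?thesis using ch_append[of cs c ds] by simp
  qed
  define b' where "b' = last dY"
  have lst: "last (map Not (rev dY)) = (\<not> b)" by (simp add: Y1)
  have rv: "map Not (rev dY) = (\<not> b') # tl (map Not (rev dY))" using dX_ne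
    by (cases dY rule: rev_cases) (auto simp: b'_def)
  have m: "changes (\<sigma> # map Not (rev dY) @ [\<sigma>, a]) = changes [\<sigma>, \<not> b'] + changes (map Not (rev dY)) + changes [\<not> b, \<sigma>] + changes [\<sigma>, a]"
  proof -
    have "changes (\<sigma> # map Not (rev dY) @ [\<sigma>, a]) = changes [\<sigma>, \<not> b'] + changes (map Not (rev dY) @ [\<sigma>, a])"
      by (subst (1 2) rv) simp
    also have "changes (map Not (rev dY) @ [\<sigma>, a]) = changes (map Not (rev dY)) + changes [\<not> b, \<sigma>] + changes [\<sigma>, a]"
      using chs[of "map Not (rev dY)" \<sigma> "[a]"] dX_ne lst by simp
    finally show ?thesis by simp
  qed
  have "inflections 1 qs = changes dX + changes [last dX, \<sigma>] + (changes [\<sigma>, \<not> b'] + changes dY + changes [\<not> b, \<sigma>] + changes [\<sigma>, a])"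
    unfolding inflections_def S using chs[OF dX_ne(1), of \<sigma> "map Not (rev dY) @ [\<sigma>, a]"] m by (simp add: X1 del: changes.simps)
  moreover have "inflections 1 ps = changes dX + changes [last dX, b] + changes dY + changes [b', a]"
    unfolding infl_ps using chs[OF dX_ne(1), of b "dY' @ [hd dX]"] chs[OF dX_ne(2), of "hd dX" "[]"] by (simp add: X1 Y1 b'_def)
  ultimately show ?thesis by auto
qed

text \<open>An edge crossing both halves of pq or of rs would pass through t by
  \<open>both_halves\<close>, and cross the other edge too by \<open>triple_point\<close>. Three
  pairwise crossing edges make six ordered pairs, which N excludes.\<close>

lemma NC_qs: assumes N: "num_crossings ps < 6" shows "num_crossings qs + 2 \<le> num_crossings ps"
proof -
  have T2': "T2 = t - e2 *\<^sub>R R - (e2 * e2) *\<^sub>R P" by (simp add: T2_def)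
  have sq: "0 < e1 * e1" "0 < e2 * e2" "e2 * e2 < 1" using e1 e2 mult_strict_mono[of e2 1 e2 1] by simp_all
  have SQ: "\<delta> *\<^sub>R s = t - R" "\<beta> *\<^sub>R q = t - P" by (simp add: t1(1) R_def, simp add: t2(1) P_def)
  have DP: "D P R t \<noteq> 0" using DR D_swap(1)[of P R t] by simp
  have T1c: "T1 = t + (e1 * e1) *\<^sub>R P + e1 *\<^sub>R R" "T2 = t - (e2 * e2) *\<^sub>R P - e2 *\<^sub>R R" by (simp_all add: T1_def T2_def)
  have sc: "X u T1 w T2 = X (a *\<^sub>R u) T1 (b *\<^sub>R w) T2" if "a > 0" "b > 0" for a b u w
    using X_scale[OF that(1)] X_scale[OF that(2)] by simp
  note scR = sc[OF pos(3,4), of r s] sc[OF pos(3,2), of r q] and scP = sc[OF pos(1,2), of p q] sc[OF pos(1,4), of p s]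
  have d1: "\<not> X r T1 s T2" "\<not> X r T1 q T2"
    using reconnect_disjoint[OF e1(1) sq(1) e2(1) sq(2) e2(2) sq(3) DR]
    unfolding scR[unfolded SQ, folded R_def] unfolding T1_def T2' by fast+
  have d2: "\<not> X p T1 q T2" "\<not> X p T1 s T2"
    using reconnect_disjoint[OF sq(1) e1(1) sq(2) e2(1) sq(3) e2(2) DP]
    unfolding scP[unfolded SQ, folded P_def] unfolding T1c by fast+
  have E: "undirected_steps (qs @ [hd qs]) = {{r, T1}, {s, T2}, {p, T1}, {q, T2}} \<union> E0"
  proof -
    have "undirected_steps (qs @ [hd qs]) = undirected_steps ((q # X0) @ r # T1 # p # rev Y0 @ [s, T2, q])" by (simp add: qs_def)
    also have "\<dots> = undirected_steps L \<union> ({{r, T1}, {T1, p}} \<union> undirected_steps ((p # rev Y0) @ s # [T2, q]))"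
      by (subst ue_append) auto
    also have "undirected_steps ((p # rev Y0) @ s # [T2, q]) = undirected_steps (rev M) \<union> {{s, T2}, {T2, q}}"
      by (subst ue_append) auto
    finally show ?thesis unfolding ue_rev E0_def by (auto simp: insert_commute)
  qed
  have mem: "\<exists>x y. h = {x, y} \<and> x \<in> set ps \<and> y \<in> set ps \<and> ne2 x y" if h: "h \<in> E0" for h
  proof -
    obtain x y where "h = {x, y}" "(x, y) \<in> steps L \<or> (x, y) \<in> steps M" using h by (auto simp: E0_def undirected_steps_def)
    moreover have "x \<in> set ps \<and> y \<in> set ps \<and> ne2 x y" if "(x, y) \<in> steps L \<or> (x, y) \<in> steps M" for x y
      using that pe_set[of x y L] pe_set[of x y M] pe_distinct[OF sdL, of x y] pe_distinct[OF sdM, of x y] by auto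
    ultimately show ?thesis by blast
  qed
  have in_ps: "q \<in> set ps" "r \<in> set ps" "s \<in> set ps" "p \<in> set ps" by auto
  have one: "XS {u, v} h" if "h \<in> E0" "XS {u, T} h" "T = T1 \<or> T = T2" "u \<in> set ps" "v \<in> set ps" "ne2 u v"
     "t = a *\<^sub>R u + b *\<^sub>R v" "a > 0" "b > 0" for u v T h a b
    using mem[OF that(1)] half_cross[OF _ _ _ _ that(4-9)] n1 n2 that(2,3) by (metis XS_iff)
  have triple: "\<not> (XS {p, q} h \<and> XS {r, s} h)" if h: "h \<in> E0" for h
  proof
    assume a: "XS {p, q} h \<and> XS {r, s} h"
    let ?e = "{p, q}" and ?f = "{r, s}"
    have six: "card {(x, y), (y, x), (x, z), (z, x), (y, z), (z, y)} = 6" if "x \<noteq> y" "z \<noteq> x" "z \<noteq> y" for x y z :: "(real^3) set"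
      using that by auto
    have "card {(?e, ?f), (?f, ?e), (?e, h), (h, ?e), (?f, h), (h, ?f)} = 6" by (rule six) (use E0_no h in blast)+
    moreover have "card {(?e, ?f), (?f, ?e), (?e, h), (h, ?e), (?f, h), (h, ?f)} \<le> num_crossings ps"
      by (rule NC_ge) (use a h XS_ef XS_sym[of h] in auto)
    ultimately show False using N by simp
  qed
  have two: "\<not> (XS {u, T1} h \<and> XS {v, T2} h)"
    if h: "h \<in> E0" and uv: "u \<in> set ps" "v \<in> set ps" "ne2 u v" "t = a *\<^sub>R u + b *\<^sub>R v" "a > 0" "b > 0"
    and uv': "u' \<in> set ps" "v' \<in> set ps" "ne2 u' v'" "t = a' *\<^sub>R u' + b' *\<^sub>R v'" "a' > 0" "b' > 0"
    and new: "{u', v'} \<notin> E0" and ef: "\<not> (XS {u, v} h \<and> XS {u', v'} h)"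
    for u v h a b u' v' a' b'
  proof
    assume a: "XS {u, T1} h \<and> XS {v, T2} h"
    obtain x y where xy: "h = {x, y}" "x \<in> set ps" "y \<in> set ps" "ne2 x y" using mem[OF h] by blast
    have X: "X u T1 x y" "X v T2 x y" using a xy by simp_all
    have z: "D x y t = 0" using both_halves[OF n1 n2 xy(2,3) uv(4-6) X] .
    have Xuv: "X u v x y" using half_cross[OF n1 xy(2-4) uv X(1)] .
    have d: "w = w' \<or> ne2 w w'" if "w \<in> set ps" "w' \<in> set ps" for w w' using sdist_pair[OF sd] that by blast
    \<comment> \<open>The edge h passes through t. If one of its ends were u' or v', then
      \<open>D w z t = 0\<close> would reduce to a vanishing determinant of three different
      vertices.\<close>
    have off: "w \<noteq> u' \<and> w \<noteq> v'"
      if w: "w \<in> set ps" "z \<in> set ps" "ne2 w z" "{w, z} = h" "D w z t = 0" for w z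
    proof (intro conjI notI)
      assume e: "w = u'"
      then have "z \<noteq> v'" using w(4) h new by auto
      then have "D u' z v' \<noteq> 0" using nz[of u' z v'] w uv' d e by blast
      then show False using w(5) uv'(4-6) e by simp
    next
      assume e: "w = v'"
      then have "z \<noteq> u'" using w(4) h new by (auto simp: insert_commute)
      then have "D v' z u' \<noteq> 0" using nz[of v' z u'] w uv' d e ne2_sym by blast
      then show False using w(5) uv'(4-6) e by simp
    qed
    have "x \<noteq> u' \<and> x \<noteq> v'" using off[of x y] xy z by simp
    moreover have "D y x t = 0" using z D_swap(1)[of y x t] by simp
    then have "y \<noteq> u' \<and> y \<noteq> v'" using off[of y x] xy ne2_sym by (simp add: insert_commute)
    ultimately have "ne2 u' x" "ne2 u' y" "ne2 v' x" "ne2 v' y" using d xy uv' by blast+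
    then have "D u' x y \<noteq> 0" "D u' v' x \<noteq> 0" "D u' v' y \<noteq> 0" using nz xy uv' by simp_all
    then have "X u' v' x y" by (rule triple_point[OF uv(4) uv'(4) uv(5,6) uv'(5,6) z Xuv])
    then show False using ef Xuv xy(1) by simp
  qed
  have T: "p \<noteq> T1" "r \<noteq> T1" "q \<noteq> T2" "s \<noteq> T2" using T1 T2 by auto
  have notE: "{u, T1} \<notin> E0" "{u, T2} \<notin> E0" for u
    using mem T1 T2(1) by (metis doubleton_eq_iff)+
  have pr: "p \<noteq> r" "q \<noteq> s" using ne by auto
  show ?thesis unfolding num_crossings_def ue_ps
  proof (rule card_replace[where R = XS and Z = E0 and e = "{p, q}" and f = "{r, s}" and ?f1.0 = "{r, T1}" and ?f2.0 = "{s, T2}"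
        and ?e1.0 = "{p, T1}" and ?e2.0 = "{q, T2}"])
    show "finite E0" by (simp add: E0_def finite_ue)
    show "{{r, T1}, {s, T2}} \<inter> {{p, T1}, {q, T2}} = {}"
      using pr T T1 T2 in_ps by (auto simp: doubleton_eq_iff)
    show "\<not> XS g h" if "g \<in> {{r, T1}, {s, T2}, {p, T1}, {q, T2}}" "h \<in> {{r, T1}, {s, T2}, {p, T1}, {q, T2}}" for g h
    proof -
      have "\<not> X s T2 r T1" "\<not> X q T2 r T1" "\<not> X q T2 p T1" "\<not> X s T2 p T1" using d1 d2 X_sym by blast+
      then show ?thesis using that d1 d2 by auto
    qed
    fix h assume h: "h \<in> E0"
    show "XS {r, T1} h \<or> XS {s, T2} h \<Longrightarrow> XS {r, s} h"
      using one[OF h, where T = T1, OF _ _ in_ps(2,3) ne(4) t1(1) pos(3,4)]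
        one[OF h, where T = T2, OF _ _ in_ps(3,2) ne(10) t1(2) pos(4,3)] insert_commute[of r s "{}"] by auto
    show "XS {p, T1} h \<or> XS {q, T2} h \<Longrightarrow> XS {p, q} h"
      using one[OF h, where T = T1, OF _ _ in_ps(4,1) ne(9) t2(1) pos(1,2)]
        one[OF h, where T = T2, OF _ _ in_ps(1,4) ne(3) t2(2) pos(2,1)] insert_commute[of p q "{}"] by auto
    show "\<not> (XS {r, T1} h \<and> XS {s, T2} h)"
      by (rule two[OF h in_ps(2,3) ne(4) t1(1) pos(3,4) in_ps(4,1) ne(9) t2(1) pos(1,2)]) (use E0_no triple h in blast)+
    show "\<not> (XS {p, T1} h \<and> XS {q, T2} h)"
      by (rule two[OF h in_ps(4,1) ne(9) t2(1) pos(1,2) in_ps(2,3) ne(4) t1(1) pos(3,4)]) (use E0_no triple h in blast)+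
  qed (use XS_sym XS_ef E0_no notE E in auto)
qed

end

context crossing begin

lemma even_case:
  assumes t: "\<alpha> *\<^sub>R p + \<beta> *\<^sub>R q = \<gamma> *\<^sub>R r + \<delta> *\<^sub>R s" and pos: "\<alpha> > 0" "\<beta> > 0" "\<gamma> > 0" "\<delta> > 0"
    and nh: "\<not> in_hemisphere ps" and N: "num_crossings ps < 6"
  obtains qs where "gen_pos qs" "\<not> in_hemisphere qs" "num_crossings qs + 2 \<le> num_crossings ps" "inflections 1 qs \<le> inflections 1 ps + 2"
proof -
  define t where "t = \<gamma> *\<^sub>R r + \<delta> *\<^sub>R s"
  define R where "R = \<gamma> *\<^sub>R r"
  define P where "P = \<alpha> *\<^sub>R p"
  have "D r p s \<noteq> 0" by (rule nz) (auto simp: ne)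
  then have DR: "D R P t \<noteq> 0" using pos by (simp add: t_def R_def P_def)
  obtain e1 where e1: "0 < e1" "e1 < 1" "near (set ps) t (t + e1 *\<^sub>R R + (e1 * e1) *\<^sub>R P)" using perturb[OF _ DR] by blast
  define T1 where "T1 = t + e1 *\<^sub>R R + (e1 * e1) *\<^sub>R P"
  have "D (- R) (- P) t \<noteq> 0" using DR by simp
  then obtain e2 where e2: "0 < e2" "e2 < 1" "near (set (ps @ [T1])) t (t + e2 *\<^sub>R (- R) + (e2 * e2) *\<^sub>R (- P))"
    using perturb by blast
  interpret reconnection q r s p X0 Y0 \<alpha> \<beta> \<gamma> \<delta> e1 e2 t R P T1 "t + e2 *\<^sub>R (- R) + (e2 * e2) *\<^sub>R (- P)"
    by unfold_locales (use e1 e2 pos t in \<open>simp_all only: t_def R_def P_def T1_def\<close>)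
  show ?thesis using that gp_qs nonhemi_qs[OF nh] NC_qs[OF N] infl_qs by blast
qed

end

theorem nonhemi:
  assumes "gen_pos ps" "\<not> in_hemisphere ps" shows "6 \<le> num_crossings ps + inflections 1 ps"
  using assms
proof (induction "num_crossings ps" arbitrary: ps rule: less_induct)
  case less
  show ?case
  proof (cases "num_crossings ps = 0 \<or> num_crossings ps \<ge> 6")
    case True
    then show ?thesis using simple_nonhemi[OF less(2) _ less(3)] NC_0[of ps] by auto
  next
    case False
    then obtain g h where gh: "g \<in> undirected_steps (ps @ [hd ps])" "h \<in> undirected_steps (ps @ [hd ps])" "XS g h"
      unfolding num_crossings_def by (metis (no_types, lifting) Collect_empty_eq card.empty case_prodE)
    obtain p q where pq: "g = {p, q}" "(p, q) \<in> steps (ps @ [hd ps])" using gh(1) by (auto simp: undirected_steps_def)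
    obtain A B where AB: "ps @ [hd ps] = A @ p # q # B" using pe_split[OF pq(2)] by blast
    \<comment> \<open>A rotation makes pq the closing edge, as the locale \<open>crossing\<close>
      requires.\<close>
    obtain us vs where uv: "ps = us @ vs" "hd (vs @ us) = q" "last (vs @ us) = p" "vs \<noteq> []"
    proof (cases B rule: rev_cases)
      case Nil
      then have "ps = A @ [p]" "hd ps = q" using AB by auto
      then show ?thesis using that[of "[]" ps] by simp
    next
      case (snoc B' x)
      then have "ps = (A @ [p]) @ (q # B')" using AB by simp
      then show ?thesis using that[of "A @ [p]" "q # B'"] by simp
    qed
    let ?rs = "vs @ us"
    have rot: "gen_pos ?rs" "inflections 1 ?rs = inflections 1 ps" using gp_rot[of us vs] less(2) uv by simp_all
    have ue_rot: "undirected_steps (?rs @ [hd ?rs]) = undirected_steps (ps @ [hd ps])"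
    proof (cases us)
      case (Cons u us')
      obtain v vs' where v: "vs = v # vs'" using uv(4) by (cases vs) auto
      show ?thesis using ue_append[of vs u "us' @ [v]"] ue_append[of us v "vs' @ [u]"] by (auto simp: uv(1) v Cons)
    qed (simp add: uv)
    have NCr: "num_crossings ?rs = num_crossings ps" unfolding num_crossings_def ue_rot ..
    have hr: "\<not> in_hemisphere ?rs" using less(3) unfolding in_hemisphere_def uv(1) by auto
    have "h \<in> undirected_steps (?rs @ [hd ?rs])" using gh(2) unfolding ue_rot .
    then obtain r s where rs: "h = {r, s}" "(r, s) \<in> steps (?rs @ [hd ?rs])"  unfolding undirected_steps_def by auto
    have Xpq: "X p q r s" using gh(3) pq rs by simp
    obtain C1 C2 where C: "?rs @ [q] = C1 @ r # s # C2" using pe_split[OF rs(2)] uv(2) by metis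
    \<comment> \<open>The edge rs is not the closing edge, does not start at q and does not end at
      p, since crossing edges have no common vertex.\<close>
    have "C2 \<noteq> []"
    proof
      assume "C2 = []"
      then have "r = p" using C uv(3) by (metis append_butlast_last_id append_is_Nil_conv butlast_append butlast_snoc last_snoc list.distinct(1) append.assoc append_Cons append_Nil butlast.simps(2))
      then show False using Xpq by simp
    qed
    then have C': "?rs = C1 @ r # s # butlast C2" using C by (metis butlast_append butlast_snoc butlast.simps(2) list.distinct(1))
    have "C1 \<noteq> []"
    proof
      assume "C1 = []"
      then have "r = q" using C' uv(2) by simp
      then show False using Xpq by simp
    qed
    then obtain X0 where X0: "C1 = q # X0" using C' uv(2) by (metis hd_append2 list.collapse)
    have "butlast C2 \<noteq> []"
    proof
      assume "butlast C2 = []"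
      then have "s = p" using C' uv(3) by simp
      then show False using Xpq by simp
    qed
    then obtain Y0 where Y0: "butlast C2 = Y0 @ [p]" using C' uv(3)
      by (metis append_butlast_last_id last_ConsR last_appendR list.distinct(1))
    have L: "?rs = q # X0 @ r # s # Y0 @ [p]" using C' X0 Y0 by simp
    interpret crossing q r s p X0 Y0 using rot(1) Xpq unfolding L by unfold_locales
    obtain \<alpha> \<beta> \<gamma> \<delta> \<kappa> where c: "\<alpha> > 0" "\<beta> > 0" "\<gamma> > 0" "\<delta> > 0" "\<kappa> = 1 \<or> \<kappa> = (-1::real)"
      "\<alpha> *\<^sub>R p + \<beta> *\<^sub>R q = \<kappa> *\<^sub>R (\<gamma> *\<^sub>R r + \<delta> *\<^sub>R s)" using X_combo[OF Xpq] .
    from c(5) show ?thesis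
    proof
      assume "\<kappa> = -1"
      then show ?thesis using odd_case[of \<alpha> \<beta> \<gamma> \<delta>] c NCr rot unfolding L by simp
    next
      assume "\<kappa> = 1"
      then have c6: "\<alpha> *\<^sub>R p + \<beta> *\<^sub>R q = \<gamma> *\<^sub>R r + \<delta> *\<^sub>R s" using c by simp
      have N6: "num_crossings (q # X0 @ r # s # Y0 @ [p]) < 6" using False NCr unfolding L by simp
      obtain qs where "gen_pos qs" "\<not> in_hemisphere qs" "num_crossings qs + 2 \<le> num_crossings ps" "inflections 1 qs \<le> inflections 1 ps + 2"
        using even_case[OF c6 c(1-4) hr[unfolded L] N6] NCr rot unfolding L by metis
      then show ?thesis using less(1)[of qs] by linarith
    qed
  qed
qed

subsection \<open>Space polygons\<close>

lemma coplanar_D: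
  assumes "D a b c = 0" shows "coplanar {0, a, b, c}"
proof -
  have sp: "coplanar {0, a, b, c}" if "{a, b, c} \<subseteq> span {x, y}" for x y
  proof -
    have "affine hull {0, x, y} = span {0, x, y}" by (intro affine_hull_span_0 hull_inc) simp
    then have "span {x, y} = affine hull {0, x, y}" by (simp add: span_insert_0)
    then have "{0, a, b, c} \<subseteq> affine hull {0, x, y}" using that span_0 by auto
    then show ?thesis unfolding coplanar_def by blast
  qed
  show ?thesis
  proof (cases "cross3 b c = 0")
    case True
    then consider "b = 0" | "c = 0" | k where "c = k *\<^sub>R b" unfolding cross_eq_0 collinear_lemma by blast
    then show ?thesis
    proof cases
      case 1 then show ?thesis by (intro sp[of a c]) (auto intro: span_base span_0)
    next
      case 2 then show ?thesis by (intro sp[of a b]) (auto intro: span_base span_0)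
    next
      case 3 then show ?thesis by (intro sp[of a b]) (auto intro: span_base span_scale)
    qed
  next
    case False
    define q where "q = cross3 b c"
    have "D b c q \<noteq> 0" using False D_cyc(1)[of b c q] by (simp add: D_def q_def)
    then have "a = (1 / D b c q) *\<^sub>R (D b c q *\<^sub>R a)" by simp
    also have "D b c q *\<^sub>R a = D a c q *\<^sub>R b - D a b q *\<^sub>R c"
      using D_relation[of b c q a] assms by (simp add: algebra_simps)
    finally have "a \<in> span {b, c}" by (metis span_scale span_diff span_base insertI1 insertI2 singletonI)
    then show ?thesis by (intro sp[of b c]) (auto intro: span_base)
  qed
qed

lemma sdist_sorted: "pairwise_ne2 xs = sorted_wrt ne2 xs"
  by (induction xs) auto

lemma tri_nth: "i + 2 < length xs \<Longrightarrow> tri xs ! i = (D (xs ! i) (xs ! (i + 1)) (xs ! (i + 2)) > 0)"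
proof (induction xs arbitrary: i rule: tri.induct)
  case (1 x y z r)
  then show ?case by (cases i) auto
qed auto

lemma ch_sum: "changes xs = (\<Sum>i<length xs - 1. if xs ! i = xs ! Suc i then 0 else 1)"
  by (induction xs rule: changes.induct) (auto simp: sum.lessThan_Suc_shift simp del: sum.lessThan_Suc)

lemma pe_nth: "steps xs = {(xs ! i, xs ! Suc i) | i. Suc i < length xs}"
proof (induction xs rule: steps.induct)
  case (1 x y zs)
  have "{(f i, f (Suc i)) | i. Suc i < Suc m} = insert (f 0, f 1) {(f (Suc i), f (Suc (Suc i))) | i. Suc i < m}"
    if "m > 0" for f :: "nat \<Rightarrow> 'a" and m
  proof (intro set_eqI iffI)
    fix z assume "z \<in> {(f i, f (Suc i)) | i. Suc i < Suc m}"
    then obtain i where "z = (f i, f (Suc i))" "i < m" by auto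
    then show "z \<in> insert (f 0, f 1) {(f (Suc i), f (Suc (Suc i))) | i. Suc i < m}" by (cases i) auto
  next
    fix z assume "z \<in> insert (f 0, f 1) {(f (Suc i), f (Suc (Suc i))) | i. Suc i < m}"
    then show "z \<in> {(f i, f (Suc i)) | i. Suc i < Suc m}" using that by fastforce
  qed
  from this[of "Suc (length zs)" "\<lambda>i. (x # y # zs) ! i"] show ?case using 1 by simp
qed auto

lemma sgn_sarc: assumes "a > 0" "b > 0" shows "sgn (a *\<^sub>R p + b *\<^sub>R q) \<in> sarc p q"
proof -
  define c where "c = 1 / (a + b)"
  have c: "c > 0" "c * (a + b) = 1" using assms by (auto simp: c_def)
  have "c *\<^sub>R (a *\<^sub>R p + b *\<^sub>R q) = (1 - c * b) *\<^sub>R p + (c * b) *\<^sub>R q" using c(2) by (simp add: algebra_simps flip: scaleR_add_left)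
  moreover have "0 \<le> c * b" "c * b \<le> 1" using c assms by (simp_all add: algebra_simps) (smt (verit) mult_pos_pos)
  ultimately have "c *\<^sub>R (a *\<^sub>R p + b *\<^sub>R q) \<in> closed_segment p q" unfolding closed_segment_def by blast
  moreover have "sgn (c *\<^sub>R (a *\<^sub>R p + b *\<^sub>R q)) = sgn (a *\<^sub>R p + b *\<^sub>R q)" using c by (simp add: sgn_scaleR)
  ultimately show ?thesis unfolding sarc_def by (metis image_eqI)
qed

lemma X_sarc: assumes "X p q r s" shows "sarc p q \<inter> sarc r s \<noteq> {} \<or> sarc p q \<inter> uminus ` sarc r s \<noteq> {}"
proof -
  obtain \<alpha> \<beta> \<gamma> \<delta> \<kappa> where c: "\<alpha> > 0" "\<beta> > 0" "\<gamma> > 0" "\<delta> > 0" "\<kappa> = 1 \<or> \<kappa> = (-1::real)"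
      "\<alpha> *\<^sub>R p + \<beta> *\<^sub>R q = \<kappa> *\<^sub>R (\<gamma> *\<^sub>R r + \<delta> *\<^sub>R s)" using X_combo[OF assms] .
  have 1: "sgn (\<alpha> *\<^sub>R p + \<beta> *\<^sub>R q) \<in> sarc p q" "sgn (\<gamma> *\<^sub>R r + \<delta> *\<^sub>R s) \<in> sarc r s"
    using sgn_sarc[OF c(1,2)] sgn_sarc[OF c(3,4)] by simp_all
  have "sgn (\<alpha> *\<^sub>R p + \<beta> *\<^sub>R q) = \<kappa> *\<^sub>R sgn (\<gamma> *\<^sub>R r + \<delta> *\<^sub>R s)" using c by (auto simp: sgn_scaleR sgn_minus simp del: minus_add_distrib)
  then show ?thesis using c(5) 1 by (metis IntI empty_iff image_eqI scaleR_minus1_left scaleR_one)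
qed

locale polygon =
  fixes v :: "nat \<Rightarrow> real^3" and n :: nat
  assumes n: "n \<ge> 6" and gen: "general_position n v"
begin

definition "ps = map (\<lambda>i. tang n v (int i)) [0..<n]"

lemma pv_mod: "pv n v (k mod int n + c) = pv n v (k + c)"
  by (simp add: pv_def mod_add_left_eq)

lemma tang_mod: "tang n v (k mod int n + c) = tang n v (k + c)"
  unfolding tang_def using pv_mod[of k c] pv_mod[of k "c + 1"] by (simp add: add.assoc)

lemma tang_nat: obtains i where "i < n" "tang n v k = tang n v (int i)" "int i = k mod int n"
proof -
  have "0 \<le> k mod int n" "k mod int n < int n" using n by simp_all
  then have "nat (k mod int n) < n" "int (nat (k mod int n)) = k mod int n" by simp_all
  then show ?thesis using that[of "nat (k mod int n)"] tang_mod[of k 0] by simp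
qed

lemma D_tang: "i < n \<Longrightarrow> j < n \<Longrightarrow> k < n \<Longrightarrow> i \<noteq> j \<Longrightarrow> j \<noteq> k \<Longrightarrow> i \<noteq> k \<Longrightarrow>
  D (tang n v (int i)) (tang n v (int j)) (tang n v (int k)) \<noteq> 0"
  using gen coplanar_D unfolding general_position_def by blast

lemma ne2_tang: assumes "i < n" "j < n" "i \<noteq> j" shows "ne2 (tang n v (int i)) (tang n v (int j))"
proof -
  have "(0 \<noteq> i \<and> 0 \<noteq> j) \<or> (1 \<noteq> i \<and> 1 \<noteq> j) \<or> (2 \<noteq> i \<and> 2 \<noteq> j)" by auto
  moreover have "0 < n" "1 < n" "2 < n" using n by simp_all
  ultimately obtain k where k: "k < n" "k \<noteq> i" "k \<noteq> j" by metis
  have "D (tang n v (int i)) (tang n v (int j)) (tang n v (int k)) \<noteq> 0" using D_tang assms k by metis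
  then show ?thesis unfolding ne2_def by auto
qed

lemma length_ps: "length ps = n" by (simp add: ps_def)

lemma gp_ps: "gen_pos ps"
  unfolding gen_pos_def
proof (intro conjI)
  show "3 \<le> length ps" using n by (simp add: length_ps)
  show "pairwise_ne2 ps" unfolding sdist_sorted sorted_wrt_iff_nth_less length_ps by (auto simp: ps_def intro: ne2_tang)
  show "generic (set ps)" unfolding generic_def
  proof (intro ballI impI)
    fix x y z assume a: "x \<in> set ps" "y \<in> set ps" "z \<in> set ps" "ne2 x y \<and> ne2 y z \<and> ne2 x z"
    obtain i j k where ijk: "i < n" "j < n" "k < n" "x = tang n v (int i)" "y = tang n v (int j)" "z = tang n v (int k)"
      using a(1-3) by (auto simp: ps_def)
    have "i \<noteq> j" "j \<noteq> k" "i \<noteq> k" using a(4) unfolding ijk by auto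
    then show "D x y z \<noteq> 0" using D_tang ijk by simp
  qed
qed

lemma edge_pos: "\<exists>l>0. pv n v (k + 1) - pv n v k = l *\<^sub>R tang n v k"
proof -
  define i where "i = nat (k mod int n)"
  have i: "int i = k mod int n" "i < n" using n by (simp_all add: i_def nat_less_iff)
  have "pv n v k = v i" using pv_def i_def by simp
  moreover have "pv n v (k + 1) = v ((i + 1) mod n)"
  proof -
    have "(k + 1) mod int n = (int i + 1) mod int n" unfolding i(1) by (simp add: mod_add_left_eq)
    also have "\<dots> = int ((i + 1) mod n)" by (simp add: zmod_int add.commute)
    finally have "(k + 1) mod int n = int ((i + 1) mod n)" .
    then show ?thesis by (simp add: pv_def)
  qed
  moreover have "v ((i + 1) mod n) \<noteq> v i" using gen i unfolding general_position_def by blast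
  ultimately have "pv n v (k + 1) - pv n v k \<noteq> 0" by simp
  then show ?thesis unfolding tang_def
    by (intro exI[of _ "norm (pv n v (k + 1) - pv n v k)"]) (simp add: sgn_div_norm)
qed

lemma nonhemi_ps: "\<not> in_hemisphere ps"
proof
  assume "in_hemisphere ps"
  then obtain h where "\<forall>x\<in>set ps. h \<bullet> x > 0" by (auto simp: in_hemisphere_def)
  then have h: "h \<bullet> tang n v (int i) > 0" if "i < n" for i using that by (simp add: ps_def)
  have "(\<Sum>i<n. h \<bullet> (pv n v (int (Suc i)) - pv n v (int i))) > 0"
  proof (rule sum_pos)
    fix i assume "i \<in> {..<n}"
    obtain l where "l > 0" "pv n v (int i + 1) - pv n v (int i) = l *\<^sub>R tang n v (int i)" using edge_pos by blast
    then show "h \<bullet> (pv n v (int (Suc i)) - pv n v (int i)) > 0" using h[of i] \<open>i \<in> {..<n}\<close> by (simp add: add.commute)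
  qed (use n in \<open>auto simp: lessThan_empty_iff\<close>)
  moreover have "(\<Sum>i<n. h \<bullet> (pv n v (int (Suc i)) - pv n v (int i))) = h \<bullet> (pv n v (int n) - pv n v (int 0))"
    unfolding inner_sum_right[symmetric] by (subst sum_lessThan_telescope[of "\<lambda>i. pv n v (int i)"]) simp
  ultimately show False by (simp add: pv_def)
qed

section \<open>Flattenings as inflections, and parallel vertices as crossings\<close>

definition "turn k \<longleftrightarrow> D (tang n v (k - 1)) (tang n v k) (tang n v (k + 1)) > 0"

lemma D_consec: "D (tang n v (k - 1)) (tang n v k) (tang n v (k + 1)) \<noteq> 0"
proof -
  obtain a where a: "a < n" "tang n v (k - 1) = tang n v (int a)" "int a = (k - 1) mod int n" by (rule tang_nat)
  obtain b where b: "b < n" "tang n v k = tang n v (int b)" "int b = k mod int n" by (rule tang_nat)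
  obtain c where c: "c < n" "tang n v (k + 1) = tang n v (int c)" "int c = (k + 1) mod int n" by (rule tang_nat)
  have ne: "x mod int n \<noteq> y mod int n" if "x < y" "y < x + int n" for x y
  proof
    assume "x mod int n = y mod int n"
    then have "int n dvd y - x" unfolding mod_eq_dvd_iff by (subst dvd_minus_iff[symmetric]) simp
    then show False using zdvd_not_zless[of "y - x" "int n"] that by simp
  qed
  have "a \<noteq> b" "b \<noteq> c" "a \<noteq> c" using ne[of "k - 1" k] ne[of k "k + 1"] ne[of "k - 1" "k + 1"] n a b c by auto
  then show ?thesis unfolding a(2) b(2) c(2) using D_tang a(1) b(1) c(1) by blast
qed

text \<open>From the middle plane, vertex k + 3 is reached along tangent k + 2 but vertex k - 1
  against tangent k - 1. This minus sign turns lying on the same side into a change of turning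
  direction.\<close>

lemma flattening_turn: "flattening n v k \<longleftrightarrow> turn k \<noteq> turn (k + 1)"
proof -
  let ?u = "tang n v"
  obtain l0 l1 l2 l3 where l: "l0 > 0" "l1 > 0" "l2 > 0"
    and e0: "pv n v k - pv n v (k - 1) = l0 *\<^sub>R ?u (k - 1)" and e1: "pv n v (k + 1) - pv n v k = l1 *\<^sub>R ?u k"
    and e2: "pv n v (k + 2) - pv n v (k + 1) = l2 *\<^sub>R ?u (k + 1)" and e3: "pv n v (k + 3) - pv n v (k + 2) = l3 *\<^sub>R ?u (k + 2)" "l3 > 0"
    using edge_pos[of "k - 1"] edge_pos[of k] edge_pos[of "k + 1"] edge_pos[of "k + 2"] by (auto simp: add.assoc)
  let ?N = "cross3 (pv n v (k + 1) - pv n v k) (pv n v (k + 2) - pv n v k)"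
  let ?d = "D (?u (k - 1)) (?u k) (?u (k + 1))" and ?d' = "D (?u k) (?u (k + 1)) (?u (k + 2))"
  have p2: "pv n v (k + 2) - pv n v k = l1 *\<^sub>R ?u k + l2 *\<^sub>R ?u (k + 1)" using e1 e2 by (simp add: algebra_simps)
  have p3: "pv n v (k + 3) - pv n v k = l1 *\<^sub>R ?u k + l2 *\<^sub>R ?u (k + 1) + l3 *\<^sub>R ?u (k + 2)" using e3 p2 by (simp add: algebra_simps)
  have p0: "pv n v (k - 1) - pv n v k = - (l0 *\<^sub>R ?u (k - 1))" using e0 by (simp add: algebra_simps)
  have N: "?N \<bullet> x = D x (l1 *\<^sub>R ?u k) (l1 *\<^sub>R ?u k + l2 *\<^sub>R ?u (k + 1))" for x
    unfolding D_def e1 p2 by (simp add: inner_commute)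
  have a: "?N \<bullet> (pv n v (k - 1) - pv n v k) = - (l0 * l1 * l2 * ?d)" unfolding N p0 by simp
  have b: "?N \<bullet> (pv n v (k + 3) - pv n v k) = l1 * l2 * l3 * ?d'"
    unfolding N p3 using D_cyc(2)[of "?u (k + 2)" "?u k" "?u (k + 1)"] by simp
  have "flattening n v k \<longleftrightarrow> (l0 * l1 * l2 * (l1 * l2 * l3)) * (?d * ?d') < 0"
    unfolding flattening_def Let_def a b by (simp add: mult_ac)
  also have "\<dots> \<longleftrightarrow> ?d * ?d' < 0" using l e3(2) by (simp add: mult_less_0_iff)
  also have "\<dots> \<longleftrightarrow> turn k \<noteq> turn (k + 1)"
    using D_consec[of k] D_consec[of "k + 1"] by (auto simp: turn_def add.assoc mult_less_0_iff)
  finally show ?thesis .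
qed

lemma infl_flattenings: "inflections 1 ps = num_flattenings n v"
proof -
  have wrap: "tang n v (int n + c) = tang n v c" for c using tang_mod[of "int n" c] by simp
  have nz: "ps \<noteq> []" using n length_ps by auto
  have nth: "ps ! j = tang n v (int j)" if "j < n" for j using that by (simp add: ps_def)
  have last: "last ps = tang n v (- 1)"
    using n wrap[of "-1"] nth[of "n - 1"] by (simp add: last_conv_nth[OF nz] length_ps of_nat_diff)
  have hd: "hd ps = tang n v (int n)" using n wrap[of 0] nth[of 0] by (simp add: hd_conv_nth[OF nz])
  \<comment> \<open>Entry i of the extended list is tangent i - 1, so that the i-th triple is
    centred at tangent i.\<close>
  have L: "last ps # ps @ [hd ps] = map (\<lambda>i. tang n v (int i - 1)) [0..<n + 2]"
  proof (rule nth_equalityI)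
    fix i assume "i < length (last ps # ps @ [hd ps])"
    then consider "i = 0" | j where "i = Suc j" "j < n" | "i = Suc n" by (cases i) (auto simp: length_ps less_Suc_eq)
    then show "(last ps # ps @ [hd ps]) ! i = map (\<lambda>i. tang n v (int i - 1)) [0..<n + 2] ! i"
    proof cases
      case 1 then show ?thesis by (simp add: last del: upt_Suc)
    next
      case 2 then show ?thesis using nth[of j] by (simp add: nth_append length_ps del: upt_Suc)
    next
      case 3 then show ?thesis by (simp add: nth_append length_ps hd del: upt_Suc)
    qed
  qed (simp add: length_ps)
  have S: "turn_signs 1 ps = map (\<lambda>i. turn (int i)) [0..<n]"
  proof (rule nth_equalityI)
    fix i assume "i < length (turn_signs 1 ps)"
    then have i: "i < n" by (simp add: length_sgl length_ps)
    then have "turn_signs 1 ps ! i = (D (tang n v (int i - 1)) (tang n v (int (i + 1) - 1)) (tang n v (int (i + 2) - 1)) > 0)"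
      unfolding turn_signs_def using L by (simp add: tri_nth del: upt_Suc)
    then show "turn_signs 1 ps ! i = map (\<lambda>i. turn (int i)) [0..<n] ! i" using i by (simp add: turn_def add.commute)
  qed (simp add: length_sgl length_ps)
  have "turn (int n) = turn 0" unfolding turn_def using wrap[of "-1"] wrap[of 0] wrap[of 1] by simp
  then have "turn_signs 1 ps @ [flip_sign 1 (hd (turn_signs 1 ps))] = map (\<lambda>i. turn (int i)) [0..<Suc n]" using n by (simp add: S hd_map)
  then have "inflections 1 ps = (\<Sum>i<n. if turn (int i) = turn (int (Suc i)) then 0 else 1)"
    unfolding inflections_def ch_sum by (simp del: upt_Suc)
  also have "\<dots> = (\<Sum>i<n. if flattening n v (int i) then 1 else 0)"
    by (intro sum.cong) (auto simp: flattening_turn add.commute)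
  also have "\<dots> = card {i \<in> {..<n}. flattening n v (int i)}" by (simp flip: sum.inter_filter)
  finally show ?thesis by (simp add: num_flattenings_def)
qed

text \<open>Edge i ends at tangent i, in agreement with the numbering of
  \<open>tedge\<close>.\<close>

definition "ed i = {tang n v (int i - 1), tang n v (int i)}"

lemma ue_ed: "undirected_steps (ps @ [hd ps]) \<subseteq> ed ` {..<n}"
proof
  fix g assume "g \<in> undirected_steps (ps @ [hd ps])"
  then obtain i where i: "i < n" "g = {(ps @ [hd ps]) ! i, (ps @ [hd ps]) ! Suc i}"
    unfolding undirected_steps_def pe_nth by (auto simp: length_ps)
  have "(ps @ [hd ps]) ! j = tang n v (int j)" if "j \<le> n" for j
    using that n tang_mod[of "int n" 0] by (auto simp: nth_append length_ps ps_def hd_map)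
  then have g: "g = {tang n v (int i), tang n v (int i + 1)}" using i by (simp add: add.commute)
  \<comment> \<open>The step from tangent i to tangent i + 1 is edge number i + 1, taken modulo
    n.\<close>
  obtain j where j: "j < n" "int j = (int i + 1) mod int n" by (rule tang_nat[of "int i + 1"])
  have "ed j = g" unfolding ed_def g j(2) using tang_mod[of "int i + 1" "-1"] tang_mod[of "int i + 1" 0] by simp
  then show "g \<in> ed ` {..<n}" using j by blast
qed

text \<open>\<open>X\<close> is a strict crossing and fails for arcs with a common endpoint, which
  rules out equal and adjacent edges.\<close>

lemma XS_ed: assumes "i < n" "j < n" "XS (ed i) (ed j)" shows "nonadj n i j" "parallel_same n v i j \<or> parallel_inv n v i j"
proof -
  have X: "X (tang n v (int i - 1)) (tang n v (int i)) (tang n v (int j - 1)) (tang n v (int j))"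
    using assms(3) by (simp add: ed_def)
  have adj: "tang n v (int j - 1) = tang n v (int i)" if "(i + 1) mod n = j" for i j
  proof -
    have "int j = (int i + 1) mod int n" using that by (auto simp: zmod_int add.commute)
    then show ?thesis using tang_mod[of "int i + 1" "-1"] by simp
  qed
  show "nonadj n i j" unfolding nonadj_def
  proof (intro conjI notI)
    assume "i = j" then show False using X by simp
  next
    assume "(i + 1) mod n = j" then show False using X adj[of i j] by simp
  next
    assume "(j + 1) mod n = i" then show False using X adj[of j i] by simp
  qed
  show "parallel_same n v i j \<or> parallel_inv n v i j"
    using X_sarc[OF X] unfolding parallel_same_def parallel_inv_def tedge_def .
qed

text \<open>The factor 2 passes from ordered pairs to pairs i < j, each of which is counted in
  \<open>Tplus\<close> or in \<open>Tminus\<close>.\<close>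

lemma NC_le: "num_crossings ps \<le> 2 * (Tplus n v + Tminus n v)"
proof -
  let ?K = "{(i, j). i < n \<and> j < n \<and> XS (ed i) (ed j)}"
  let ?K1 = "{(i, j). i < j \<and> j < n \<and> XS (ed i) (ed j)}"
  let ?P = "{(i, j). i < j \<and> j < n \<and> nonadj n i j \<and> parallel_same n v i j}"
  let ?M = "{(i, j). i < j \<and> j < n \<and> nonadj n i j \<and> parallel_inv n v i j}"
  have fin: "finite ?K" by (rule finite_subset[of _ "{..<n} \<times> {..<n}"]) auto
  have fin1: "finite ?K1" by (rule finite_subset[OF _ fin]) auto
  have finPM: "finite ?P" "finite ?M" by (rule finite_subset[of _ "{..<n} \<times> {..<n}"]; auto)+
  have "num_crossings ps \<le> card ((\<lambda>(i, j). (ed i, ed j)) ` ?K)"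
    unfolding num_crossings_def
  proof (rule card_mono)
    show "{(g, h). g \<in> undirected_steps (ps @ [hd ps]) \<and> h \<in> undirected_steps (ps @ [hd ps]) \<and> XS g h} \<subseteq> (\<lambda>(i, j). (ed i, ed j)) ` ?K"
    proof (intro subrelI)
      fix g h assume "(g, h) \<in> {(g, h). g \<in> undirected_steps (ps @ [hd ps]) \<and> h \<in> undirected_steps (ps @ [hd ps]) \<and> XS g h}"
      then obtain i j where "(i, j) \<in> ?K" "g = ed i" "h = ed j" using ue_ed by blast
      then show "(g, h) \<in> (\<lambda>(i, j). (ed i, ed j)) ` ?K" by (intro image_eqI[of _ _ "(i, j)"]) simp_all
    qed
  qed (use fin in simp)
  also have "\<dots> \<le> card ?K" by (rule card_image_le[OF fin])
  also have "\<dots> \<le> card (?K1 \<union> prod.swap ` ?K1)"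
  proof (rule card_mono)
    show "?K \<subseteq> ?K1 \<union> prod.swap ` ?K1"
    proof
      fix z assume "z \<in> ?K"
      then obtain i j where z: "z = (i, j)" "i < n" "j < n" "XS (ed i) (ed j)" by auto
      then have "i \<noteq> j" by auto
      then consider "i < j" | "j < i" by linarith
      then show "z \<in> ?K1 \<union> prod.swap ` ?K1"
      proof cases
        case 1 then show ?thesis using z by simp
      next
        case 2
        then have "(j, i) \<in> ?K1" using z XS_sym by simp
        then have "prod.swap (j, i) \<in> prod.swap ` ?K1" by (rule imageI)
        then show ?thesis unfolding z(1) swap_simp by (rule UnI2)
      qed
    qed
  qed (use fin1 in simp)
  also have "\<dots> \<le> card ?K1 + card ?K1"
    using card_Un_le[of ?K1 "prod.swap ` ?K1"] card_image_le[OF fin1, of prod.swap] by linarith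
  also have "\<dots> \<le> 2 * (card ?P + card ?M)"
  proof -
    have "nonadj n i j \<and> (parallel_same n v i j \<or> parallel_inv n v i j)" if "i < j" "j < n" "XS (ed i) (ed j)" for i j
      using XS_ed[of i j] that by simp
    then have "card ?K1 \<le> card (?P \<union> ?M)" by (intro card_mono) (use finPM in auto)
    then have "card ?K1 \<le> card ?P + card ?M" using card_Un_le by (rule order.trans)
    then show ?thesis by (simp only: mult_2 add_mono)
  qed
  finally show ?thesis unfolding Tplus_def Tminus_def by simp
qed

end

theorem theorem15:
  fixes v :: "nat \<Rightarrow> real^3" and n :: nat
  assumes "n \<ge> 6"
    and "general_position n v"
  shows "2 * (Tplus n v + Tminus n v) + num_flattenings n v \<ge> 6"
proof -
  interpret polygon v n using assms by unfold_locales
  show ?thesis using nonhemi[OF gp_ps nonhemi_ps] NC_le infl_flattenings by linarith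
qed

end
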